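(* Let $n\ge 3$ and let $EA_n$ be the $n$-dimensional godan graph. Then $\kappa_4(EA_n)=n-1$.
   Context: Godan graph: let $S_n$ be the symmetric group on $[n]=\{1,\dots,n\}$, with composition $(\sigma\circ\tau)(i)=\sigma(\tau(i))$. For $n\ge 3$ let $\Omega^*=\{(12),(123),(132)\}\cup\{(12)(3i)\mid 4\le i\le n\}\subseteq S_n$ (cycle notation). $EA_n$ is the simple graph with vertex set $S_n$ in which $u$ and $v$ are adjacent if and only if $u=v\circ s^*$ for some $s^*\in\Omega^*$ (the set $\Omega^*$ is closed under inverses). Generalized connectivity: for a simple graph $G$ and $S\subseteq V(G)$, an $S$-tree is a tree $T$ that is a subgraph of $G$ with $S\subseteq V(T)$. $S$-trees $T_1,\dots,T_r$ in $G$ are internally edge disjoint $S$-trees (IDSTs) if $V(T_i)\cap V(T_j)=S$ and $E(T_i)\cap E(T_j)=\emptyset$ for all $1\le i<j\le r$. $\kappa_G(S)$ is the maximum number of IDSTs in $G$, and for $2\le k\le|V(G)|$, $\kappa_k(G)=\min\{\kappa_G(S)\mid S\subseteq V(G),\ |S|=k\}$. *)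

theory Defs
  imports
    "HOL-Combinatorics.Cycles"
    "Graph_Theory.Graph_Theory"
begin

text \<open>
  A simple graph is a \<^locale>\<open>pair_graph\<close>: a finite, loop-free, symmetric set of vertex
  pairs, where the two arcs \<open>(u, v)\<close> and \<open>(v, u)\<close> together stand for the edge \<open>uv\<close>.
  The library predicate \<open>Digraph_Component.tree\<close> is unsuitable here: on symmetric
  digraphs it regards the closed walk \<open>u, v, u\<close> as a cycle. A closed walk of length at least 3
  without repeated vertices is precisely a cycle of the undirected graph.
\<close>

definition undirected_tree :: "'a pair_pre_digraph \<Rightarrow> bool" where
  "undirected_tree T \<longleftrightarrow>
     pair_graph T \<and> connected (with_proj T) \<and>
     \<not> (\<exists>p. pre_digraph.cycle (with_proj T) p \<and> 3 \<le> length p)"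

definition S_tree :: "'a pair_pre_digraph \<Rightarrow> 'a set \<Rightarrow> 'a pair_pre_digraph \<Rightarrow> bool" where
  "S_tree G S T \<longleftrightarrow>
     undirected_tree T \<and> subgraph (with_proj T) (with_proj G) \<and> S \<subseteq> pverts T"

definition IDSTs ::
  "'a pair_pre_digraph \<Rightarrow> 'a set \<Rightarrow> nat \<Rightarrow> (nat \<Rightarrow> 'a pair_pre_digraph) \<Rightarrow> bool" where
  "IDSTs G S r T \<longleftrightarrow>
     (\<forall>i\<in>{1..r}. S_tree G S (T i)) \<and>
     (\<forall>i j. 1 \<le> i \<and> i < j \<and> j \<le> r \<longrightarrow>
        pverts (T i) \<inter> pverts (T j) = S \<and> parcs (T i) \<inter> parcs (T j) = {})"

definition kappa_set :: "'a pair_pre_digraph \<Rightarrow> 'a set \<Rightarrow> nat" where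
  "kappa_set G S = Max {r. \<exists>T. IDSTs G S r T}"

definition kappa :: "nat \<Rightarrow> 'a pair_pre_digraph \<Rightarrow> nat" where
  "kappa k G = Min {kappa_set G S | S. S \<subseteq> pverts G \<and> card S = k}"

definition godan_gens :: "nat \<Rightarrow> (nat \<Rightarrow> nat) set" where
  "godan_gens n =
     {cycle_of_list [1, 2], cycle_of_list [1, 2, 3], cycle_of_list [1, 3, 2]} \<union>
     {cycle_of_list [1, 2] \<circ> cycle_of_list [3, i] | i. 4 \<le> i \<and> i \<le> n}"

definition godan_graph :: "nat \<Rightarrow> (nat \<Rightarrow> nat) pair_pre_digraph" where
  "godan_graph n =
     \<lparr> pverts = {u. u permutes {1..n}},
       parcs = {(u, v). u permutes {1..n} \<and> v permutes {1..n} \<and>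
                        (\<exists>s\<in>godan_gens n. u = v \<circ> s)} \<rparr>"

lemma godan_gens_permutes:
  assumes "n \<ge> 3" "s \<in> godan_gens n"
  shows "s permutes {1..n}"
proof -
  have cyc: "cycle_of_list cs permutes {1..n}" if "set cs \<subseteq> {1..n}" for cs
    using cycle_permutes that by (rule permutes_subset)
  consider "s = cycle_of_list [1, 2]" | "s = cycle_of_list [1, 2, 3]" | "s = cycle_of_list [1, 3, 2]"
    | i where "4 \<le> i" "i \<le> n" "s = cycle_of_list [1, 2] \<circ> cycle_of_list [3, i]"
    using assms(2) unfolding godan_gens_def by blast
  then show ?thesis
  proof cases
    case 4
    show ?thesis
      unfolding 4(3) using assms(1) 4(1,2) by (intro permutes_compose cyc) auto
  qed (use assms(1) in \<open>simp only:, intro cyc, simp\<close>)+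
qed

lemma godan_gens_inverse:
  assumes "s \<in> godan_gens n"
  shows "\<exists>t\<in>godan_gens n. s \<circ> t = id"
proof -
  consider "s = cycle_of_list [1, 2]" | "s = cycle_of_list [1, 2, 3]" | "s = cycle_of_list [1, 3, 2]"
    | i where "4 \<le> i" "i \<le> n" "s = cycle_of_list [1, 2] \<circ> cycle_of_list [3, i]"
    using assms unfolding godan_gens_def by blast
  then show ?thesis
  proof cases
    case 1
    have "s \<circ> s = id"
      unfolding 1 by (rule ext) (simp add: transpose_def)
    then show ?thesis using assms by blast
  next
    case 2
    have "s \<circ> cycle_of_list [1, 3, 2] = id"
      unfolding 2 by (rule ext) (simp add: transpose_def)
    moreover have "cycle_of_list [1, 3, 2] \<in> godan_gens n"
      unfolding godan_gens_def by blast
    ultimately show ?thesis by blast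
  next
    case 3
    have "s \<circ> cycle_of_list [1, 2, 3] = id"
      unfolding 3 by (rule ext) (simp add: transpose_def)
    moreover have "cycle_of_list [1, 2, 3] \<in> godan_gens n"
      unfolding godan_gens_def by blast
    ultimately show ?thesis by blast
  next
    case 4
    have "s \<circ> s = id"
      unfolding 4(3) using 4(1) by (intro ext) (simp add: transpose_def)
    then show ?thesis using assms by blast
  qed
qed

lemma godan_gens_not_id:
  assumes "s \<in> godan_gens n"
  shows "s \<noteq> id"
proof -
  have "cycle_of_list [1, 2] (1::nat) \<noteq> 1" "cycle_of_list [1, 2, 3] (1::nat) \<noteq> 1"
    "cycle_of_list [1, 3, 2] (1::nat) \<noteq> 1"
    "(cycle_of_list [1, 2] \<circ> cycle_of_list [3, i]) (1::nat) \<noteq> 1" if "4 \<le> i" for i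
    using that by (simp_all add: transpose_def)
  with assms have "s 1 \<noteq> 1"
    unfolding godan_gens_def by blast
  then show ?thesis by auto
qed

lemma pair_graph_godan_graph: "pair_graph (godan_graph n)"
proof unfold_locales
  fix e assume e: "e \<in> parcs (godan_graph n)"
  then show "fst e \<in> pverts (godan_graph n)" "snd e \<in> pverts (godan_graph n)"
    by (auto simp: godan_graph_def)
  show "fst e \<noteq> snd e"
  proof
    assume eq: "fst e = snd e"
    obtain u s where u: "u permutes {1..n}" "s \<in> godan_gens n" "u = u \<circ> s"
      using e eq by (cases e) (auto simp: godan_graph_def)
    have "s x = x" for x
    proof -
      have "u (s x) = u x" using fun_cong[OF u(3), of x] by simp
      then show ?thesis using permutes_inj[OF u(1)] by (simp add: inj_eq)
    qed
    then have "s = id" by auto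
    then show False using godan_gens_not_id u(2) by blast
  qed
next
  have fin: "finite (pverts (godan_graph n))"
    by (simp add: godan_graph_def finite_permutations)
  then show "finite (pverts (godan_graph n))" .
  show "finite (parcs (godan_graph n))"
    by (rule finite_subset[OF _ finite_cartesian_product[OF fin fin]])
      (auto simp: godan_graph_def)
next
  show "symmetric (with_proj (godan_graph n))"
    unfolding symmetric_def with_proj_simps
  proof (rule symI)
    fix u v assume "(u, v) \<in> parcs (godan_graph n)"
    then obtain s where s: "u permutes {1..n}" "v permutes {1..n}" "s \<in> godan_gens n" "u = v \<circ> s"
      by (auto simp: godan_graph_def)
    obtain t where t: "t \<in> godan_gens n" "s \<circ> t = id"
      using godan_gens_inverse[OF s(3)] by blast
    have "v = u \<circ> t"
      using s(4) t(2) by (simp add: comp_assoc)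
    with s(1,2) t(1) show "(v, u) \<in> parcs (godan_graph n)"
      unfolding godan_graph_def by auto
  qed
qed

lemma S_tree_arcs_nonempty:
  assumes "S_tree G S T" "card S \<ge> 2"
  shows "parcs T \<noteq> {}"
proof
  assume empty: "parcs T = {}"
  have "finite S"
    using assms(2) card.infinite by fastforce
  then obtain u v where uv: "u \<in> S" "v \<in> S" "u \<noteq> v"
    using assms(2) card_le_Suc0_iff_eq[of S] by fastforce
  have "connected (with_proj T)" "S \<subseteq> pverts T"
    using assms(1) by (auto simp: S_tree_def undirected_tree_def)
  then have "u \<rightarrow>\<^sup>*\<^bsub>with_proj (mk_symmetric (with_proj T))\<^esub> v"
    using uv by (auto simp: connected_def strongly_connected_def mk_symmetric_def)
  then have "(u, v) \<in> (arcs_ends (with_proj (mk_symmetric (with_proj T))))\<^sup>*"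
    by (rule reachable_rtranclI)
  moreover have "parcs (mk_symmetric (with_proj T)) = {}"
    by (simp add: mk_symmetric_def empty)
  ultimately show False using uv(3) by simp
qed

text \<open>For \<open>|S| \<ge> 2\<close> the maximum in the definition of \<^const>\<open>kappa_set\<close> ranges over a finite
  nonempty set.\<close>

lemma finite_IDSTs:
  assumes "pair_graph G" "card S \<ge> 2"
  shows "finite {r. \<exists>T. IDSTs G S r T}"
proof (rule finite_subset)
  have fin: "finite (parcs G)"
    using assms(1) by (simp add: pair_graph_def pair_digraph_def pair_fin_digraph.pair_finite_arcs)
  show "{r. \<exists>T. IDSTs G S r T} \<subseteq> {..card (parcs G)}"
  proof clarsimp
    fix r T assume T: "IDSTs G S r T"
    define f where "f i = (SOME e. e \<in> parcs (T i))" for i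
    have tree: "S_tree G S (T i)" if "i \<in> {1..r}" for i
      using T that by (auto simp: IDSTs_def)
    have f: "f i \<in> parcs (T i)" if "i \<in> {1..r}" for i
      unfolding f_def using S_tree_arcs_nonempty[OF tree[OF that] assms(2)] by (simp add: some_in_eq)
    have disj: "f i \<noteq> f j" if "i \<in> {1..r}" "j \<in> {1..r}" "i < j" for i j
    proof -
      have "parcs (T i) \<inter> parcs (T j) = {}"
        using T that by (simp add: IDSTs_def)
      then show ?thesis using f[OF that(1)] f[OF that(2)] by auto
    qed
    have "inj_on f {1..r}"
    proof (rule inj_onI)
      fix i j assume "i \<in> {1..r}" "j \<in> {1..r}" "f i = f j"
      then show "i = j" using disj[of i j] disj[of j i] by (cases i j rule: linorder_cases) auto
    qed
    moreover have "f ` {1..r} \<subseteq> parcs G"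
    proof
      fix e assume "e \<in> f ` {1..r}"
      then obtain i where i: "i \<in> {1..r}" "e = f i" by blast
      have "parcs (T i) \<subseteq> parcs G"
        using tree[OF i(1)] by (simp add: S_tree_def subgraph_def)
      then show "e \<in> parcs G" using f[OF i(1)] i(2) by blast
    qed
    ultimately have "card {1..r} \<le> card (parcs G)"
      using fin by (rule card_inj_on_le)
    then show "r \<le> card (parcs G)" by simp
  qed
qed simp

lemma IDSTs_0: "IDSTs G S 0 T"
  by (simp add: IDSTs_def)

end

theory Submission
  imports Defs
begin

text \<open>
  Upper bound: if \<open>S\<close> contains adjacent \<open>u\<close> and \<open>v\<close>, which have degree \<open>n\<close>, then \<open>n\<close> trees would use
  each arc at \<open>u\<close> and at \<open>v\<close> exactly once, so the tree through \<open>uv\<close> would consist of that edge only.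

  Lower bound: the neighbours of a permutation \<open>x\<close> are \<open>(a j) \<circ> x \<circ> (1 2)\<close> with \<open>a = x 3\<close> and
  \<open>j \<in> {1..n}\<close>, where \<open>j = a\<close> gives \<open>x \<circ> (1 2)\<close>. Restricting \<open>x\<close> to \<open>{3..n}\<close> and recording its parity therefore turns the
  graph into two layers of an arrangement graph (injections \<open>{3..n} \<rightarrow> {1..n}\<close>, where the value at
  the centre 3 is swapped with any other value), with corresponding vertices joined. Disjoint trees are
  given as a colouring of the vertices and of the edges inside \<open>S\<close> in which every colour
  connects \<open>S\<close>. The colourings come by induction on \<open>n\<close>. Fix a position \<open>p \<noteq> 3\<close>; the
  injections with a given value at \<open>p\<close> form a copy of the smaller graph. If \<open>S\<close> lies in one copy, use the
  induction hypothesis there and one tree outside. Otherwise give each colour \<open>j\<close> the copy with value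
  \<open>j\<close>, except for one copy that meets \<open>S\<close>, and link each point of \<open>S\<close> by short paths to all these copies: a
  vertex with centre value \<open>j\<close> has a neighbour in copy \<open>j\<close>. The cases \<open>n = 3\<close> and \<open>n = 4\<close> are checked from
  explicit certificates.
\<close>

section \<open>Packings of trees as colourings\<close>

text \<open>Every generator except (1 2) is even, and two permutations that agree on {3..n} differ
  at most by (1 2); this is why parity can replace positions 1 and 2. Colouring a vertex by its
  centre value would serve all colours at once. Two things disturb this. An edge between two members
  of \<open>S\<close> in one layer can carry only one colour. And the paths that leave a member of
  \<open>S\<close> inside its own copy take vertices away from the part of that copy which must stay
  connected for the copy's own colour. Both are repaired by detours through the other layer, and
  these detours need a non-central position other than \<open>p\<close>. Hence the induction step
  asks for at least three positions, and exactly the cases with one or two positions are left to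
  certificates. The value \<open>c\<close> of the copy that gets no tree names no colour, so n - 1
  of the n values remain as colours, which matches the upper bound.\<close>

definition packing_edge ::
  "('a \<Rightarrow> 'a \<Rightarrow> bool) \<Rightarrow> 'a set \<Rightarrow> ('a \<Rightarrow> 'c) \<Rightarrow> ('a \<Rightarrow> 'a \<Rightarrow> 'c) \<Rightarrow> 'c \<Rightarrow> 'a \<Rightarrow> 'a \<Rightarrow> bool" where
  "packing_edge E S col ecol j u v \<longleftrightarrow>
     E u v \<and> (if u \<in> S \<and> v \<in> S then ecol u v = j
              else (u \<in> S \<or> col u = j) \<and> (v \<in> S \<or> col v = j))"

text \<open>The members of \<open>S\<close> lie in every tree, so vertex colours cannot decide which
  tree owns an edge between two of them; \<open>ecol\<close> does. Connectedness of each colour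
  suffices, because a tree can be chosen inside it afterwards.\<close>

definition packs :: "('a \<Rightarrow> 'a \<Rightarrow> bool) \<Rightarrow> 'a set \<Rightarrow> 'c set \<Rightarrow> bool" where
  "packs E S J \<longleftrightarrow> (\<exists>col ecol. (\<forall>u v. ecol u v = ecol v u) \<and>
     (\<forall>j\<in>J. \<forall>s\<in>S. \<forall>t\<in>S. (packing_edge E S col ecol j)\<^sup>*\<^sup>* s t))"

lemma packing_edgeI:
  assumes "E u v" "u \<in> S \<or> col u = j" "v \<in> S \<or> col v = j" "u \<in> S \<Longrightarrow> v \<in> S \<Longrightarrow> ecol u v = j"
  shows "packing_edge E S col ecol j u v"
  using assms by (auto simp: packing_edge_def)

lemma packing_edge_sym:
  assumes "symp E" "\<And>u v. ecol u v = ecol v u"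
  shows "symp (packing_edge E S col ecol j)"
  using assms(1) by (auto simp: symp_def packing_edge_def assms(2)[of _ _] split: if_splits)

lemma rtranclp_symp: "symp R \<Longrightarrow> R\<^sup>*\<^sup>* a b \<Longrightarrow> R\<^sup>*\<^sup>* b a"
  by (metis symp_rtranclp sympD)

text \<open>Colours are pulled back along \<open>\<phi>\<close>. The condition on \<open>E'\<close>
  keeps a path that starts in the image of \<open>A\<close> inside that image, so it lifts step by
  step. Used both for symmetries and for passing between models of the graph.\<close>

lemma packs_inj_image:
  assumes inj: "inj_on \<phi> A" and S: "S \<subseteq> A"
    and E: "\<And>u v. u \<in> A \<Longrightarrow> E' (\<phi> u) v \<Longrightarrow> \<exists>w\<in>A. v = \<phi> w \<and> E u w"
    and p: "packs E' (\<phi> ` S) J"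
  shows "packs E S J"
proof -
  obtain col ecol where sym: "\<forall>u v. ecol u v = ecol v u"
    and con: "\<forall>j\<in>J. \<forall>s\<in>\<phi>`S. \<forall>t\<in>\<phi>`S. (packing_edge E' (\<phi>`S) col ecol j)\<^sup>*\<^sup>* s t"
    using p unfolding packs_def by blast
  have mem: "\<phi> u \<in> \<phi> ` S \<longleftrightarrow> u \<in> S" if "u \<in> A" for u
    using inj S that by (meson inj_on_image_mem_iff)
  have path: "\<exists>w\<in>A. t = \<phi> w \<and> (packing_edge E S (col \<circ> \<phi>) (\<lambda>u v. ecol (\<phi> u) (\<phi> v)) j)\<^sup>*\<^sup>* s w"
    if "(packing_edge E' (\<phi>`S) col ecol j)\<^sup>*\<^sup>* (\<phi> s) t" "s \<in> A" for j s t
    using that(1)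
  proof (induction rule: rtranclp_induct)
    case base
    then show ?case using that(2) by blast
  next
    case (step t t')
    then obtain w where w: "w \<in> A" "t = \<phi> w"
      "(packing_edge E S (col \<circ> \<phi>) (\<lambda>u v. ecol (\<phi> u) (\<phi> v)) j)\<^sup>*\<^sup>* s w" by blast
    have "E' (\<phi> w) t'" using step(2) w(2) by (simp add: packing_edge_def)
    then obtain w' where w': "w' \<in> A" "t' = \<phi> w'" "E w w'" using E w(1) by blast
    have "packing_edge E S (col \<circ> \<phi>) (\<lambda>u v. ecol (\<phi> u) (\<phi> v)) j w w'"
      using step(2) w w' mem by (auto simp: packing_edge_def)
    with w(3) have "(packing_edge E S (col \<circ> \<phi>) (\<lambda>u v. ecol (\<phi> u) (\<phi> v)) j)\<^sup>*\<^sup>* s w'" by (rule rtranclp.rtrancl_into_rtrancl)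
    then show ?case using w' by blast
  qed
  have "(packing_edge E S (col \<circ> \<phi>) (\<lambda>u v. ecol (\<phi> u) (\<phi> v)) j)\<^sup>*\<^sup>* s t"
    if st: "j \<in> J" "s \<in> S" "t \<in> S" for j s t
  proof -
    have "(packing_edge E' (\<phi>`S) col ecol j)\<^sup>*\<^sup>* (\<phi> s) (\<phi> t)" using con st by blast
    from path[OF this] obtain w where "w \<in> A" "\<phi> t = \<phi> w"
      "(packing_edge E S (col \<circ> \<phi>) (\<lambda>u v. ecol (\<phi> u) (\<phi> v)) j)\<^sup>*\<^sup>* s w"
      using st(2) S by auto
    moreover have "t = w" using inj_onD[OF inj calculation(2)] S st(3) calculation(1) by blast
    ultimately show ?thesis by simp
  qed
  then show ?thesis unfolding packs_def using sym
    by (intro exI[of _ "col \<circ> \<phi>"] exI[of _ "\<lambda>u v. ecol (\<phi> u) (\<phi> v)"]) auto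
qed

lemma packs_recolour:
  assumes "packs E S J" "bij_betw f J J'"
  shows "packs E S J'"
proof -
  obtain col ecol where sym: "\<forall>u v. ecol u v = ecol v u"
    and con: "\<forall>j\<in>J. \<forall>s\<in>S. \<forall>t\<in>S. (packing_edge E S col ecol j)\<^sup>*\<^sup>* s t"
    using assms(1) unfolding packs_def by blast
  have "(packing_edge E S (f \<circ> col) (\<lambda>u v. f (ecol u v)) j)\<^sup>*\<^sup>* s t"
    if j: "j \<in> J'" and st: "s \<in> S" "t \<in> S" for j s t
  proof -
    obtain i where i: "i \<in> J" "j = f i" using assms(2) j by (auto simp: bij_betw_def)
    have "(packing_edge E S col ecol i)\<^sup>*\<^sup>* s t" using con i st by blast
    then show ?thesis
      by (rule rtranclp_mono[THEN predicate2D, rotated]) (auto simp: packing_edge_def i split: if_splits)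
  qed
  then show ?thesis unfolding packs_def using sym
    by (intro exI[of _ "f \<circ> col"] exI[of _ "\<lambda>u v. f (ecol u v)"]) auto
qed

lemma packs_card_cong:
  assumes "packs E S J" "finite J" "finite J'" "card J = card J'"
  shows "packs E S J'"
  using packs_recolour[OF assms(1)] finite_same_card_bij[OF assms(2-4)] by blast

section \<open>From connected colour classes to internally edge disjoint trees\<close>

definition parent_tree :: "'a set \<Rightarrow> 'a \<Rightarrow> ('a \<Rightarrow> 'a) \<Rightarrow> 'a pair_pre_digraph" where
  "parent_tree P r par = \<lparr> pverts = P,
     parcs = {(u, par u) | u. u \<in> P - {r}} \<union> {(par u, u) | u. u \<in> P - {r}} \<rparr>"

lemma pcas_nth:
  assumes "pcas u p v"
  shows "(\<forall>i<length p. fst (p ! i) = (if i = 0 then u else snd (p ! (i - 1)))) \<and>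
         (p \<noteq> [] \<longrightarrow> snd (last p) = v)"
  using assms
proof (induction p arbitrary: u)
  case Nil
  then show ?case by simp
next
  case (Cons e es)
  then have e: "fst e = u" "pcas (snd e) es v" by auto
  note IH = Cons.IH[OF e(2)]
  have "fst ((e # es) ! i) = (if i = 0 then u else snd ((e # es) ! (i - 1)))"
    if "i < length (e # es)" for i
  proof (cases i)
    case 0
    then show ?thesis using e by simp
  next
    case (Suc k)
    then have "fst (es ! k) = (if k = 0 then snd e else snd (es ! (k - 1)))" using IH that by simp
    then show ?thesis using Suc by (cases k) auto
  qed
  moreover have "snd (last (e # es)) = v" using IH e by (cases es) auto
  ultimately show ?case by blast
qed

lemma tl_pawalk_verts: "pcas u p v \<Longrightarrow> tl (pawalk_verts u p) = map snd p"
proof (induction p arbitrary: u)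
  case (Cons e es)
  then show ?case by (cases es) auto
qed simp

lemma pverts_parent_tree [simp]: "pverts (parent_tree P r par) = P"
  by (simp add: parent_tree_def)

text \<open>A deepest vertex of a cycle would have two distinct neighbours on the cycle, but both
  would have to be its parent.\<close>

lemma parent_tree_undirected_tree:
  fixes dep :: "'a \<Rightarrow> nat"
  assumes fin: "finite P" and r: "r \<in> P"
    and par: "\<And>u. u \<in> P - {r} \<Longrightarrow> par u \<in> P \<and> dep (par u) < dep u"
  shows "undirected_tree (parent_tree P r par)"
proof -
  let ?T = "parent_tree P r par"
  interpret T: pair_graph ?T
  proof unfold_locales
    fix e assume "e \<in> parcs ?T"
    then obtain u where "u \<in> P - {r}" "e = (u, par u) \<or> e = (par u, u)"
      by (auto simp: parent_tree_def)
    then show "fst e \<in> pverts ?T" "snd e \<in> pverts ?T" "fst e \<noteq> snd e"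
      using par[of u] by auto
  next
    show "finite (pverts ?T)" using fin by (simp add: parent_tree_def)
    have "parcs ?T \<subseteq> P \<times> P" using par by (auto simp: parent_tree_def)
    then show "finite (parcs ?T)" using fin by (meson finite_SigmaI finite_subset)
    show "symmetric (with_proj ?T)"
      by (auto simp: symmetric_def parent_tree_def sym_def)
  qed
  have reach: "r \<rightarrow>\<^sup>*\<^bsub>with_proj ?T\<^esub> u \<and> u \<rightarrow>\<^sup>*\<^bsub>with_proj ?T\<^esub> r" if "u \<in> P" for u
    using that
  proof (induction "dep u" arbitrary: u rule: less_induct)
    case less
    show ?case
    proof (cases "u = r")
      case True
      then show ?thesis using r T.reachable_refl[of r] by simp
    next
      case False
      then have u: "u \<in> P - {r}" using less.prems by blast
      note IH = less.hyps[of "par u"] par[OF u]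
      have "(u, par u) \<in> parcs ?T" "(par u, u) \<in> parcs ?T"
        using u by (auto simp: parent_tree_def)
      then show ?thesis using IH
        by (meson T.adj_reachable_trans T.reachable_adj_trans)
    qed
  qed
  have sc: "strongly_connected (with_proj ?T)"
    unfolding strongly_connected_def
  proof (intro conjI ballI)
    show "verts (with_proj ?T) \<noteq> {}" using r by auto
    fix u v assume "u \<in> verts (with_proj ?T)" "v \<in> verts (with_proj ?T)"
    then show "u \<rightarrow>\<^sup>*\<^bsub>with_proj ?T\<^esub> v"
      using reach[of u] reach[of v] by (auto intro: T.reachable_trans)
  qed
  have con: "connected (with_proj ?T)"
    using sc unfolding connected_def strongly_connected_def T.reachable_mk_symmetric_eq[OF T.sym_arcs]
    by (simp add: mk_symmetric_def)
  have "False" if cyc: "pre_digraph.cycle (with_proj ?T) p" and len: "3 \<le> length p" for p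
  proof -
    obtain u where u: "T.awalk u p u" "distinct (tl (pawalk_verts u p))"
      using cyc by (auto simp: T.cycle_def)
    have cas: "pcas u p u" and sub: "set p \<subseteq> parcs ?T"
      using u(1) by (auto simp: T.awalk_def)
    define L where "L = length p"
    \<comment> \<open>Cyclic indexing gives every vertex of the cycle a predecessor and a successor,
      also where the closed walk begins and ends.\<close>
    define v where "v i = snd (p ! (i mod L))" for i
    have Lpos: "L \<ge> 3" using len L_def by simp
    have dist: "distinct (map snd p)" using u(2) tl_pawalk_verts[OF cas] by simp
    have inj: "v i = v k \<Longrightarrow> i mod L = k mod L" for i k
    proof -
      assume eq: "v i = v k"
      have "i mod L < length p" "k mod L < length p" using Lpos unfolding L_def[symmetric] by simp_all
      then show "i mod L = k mod L" using eq nth_eq_iff_index_eq[OF dist, of "i mod L" "k mod L"]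
        by (simp add: v_def)
    qed
    have step: "fst (p ! i) = (if i = 0 then u else snd (p ! (i - 1)))" if "i < L" for i
      using pcas_nth[OF cas] that L_def by blast
    have arc: "(v i, v (Suc i)) \<in> parcs ?T" for i
    proof -
      have lt: "Suc i mod L < L" using Lpos by simp
      have "fst (p ! (Suc i mod L)) = v i"
      proof (cases "Suc i mod L = 0")
        case True
        then have im: "i mod L = L - 1" by (auto simp: mod_Suc split: if_splits)
        have "fst (p ! 0) = u" using step[of 0] lt True by simp
        moreover have "snd (last p) = u" using pcas_nth[OF cas] Lpos L_def by (metis list.size(3) not_numeral_le_zero)
        moreover have "last p = p ! (L - 1)" using last_conv_nth[of p] Lpos L_def by fastforce
        ultimately show ?thesis using True im by (simp add: v_def)
      next
        case False
        then have "Suc i mod L = Suc (i mod L)" by (auto simp: mod_Suc split: if_splits)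
        then show ?thesis using step[OF lt] by (simp add: v_def)
      qed
      then have "p ! (Suc i mod L) = (v i, v (Suc i))" by (simp add: v_def prod_eq_iff)
      moreover have "p ! (Suc i mod L) \<in> set p" using lt L_def by (intro nth_mem) simp
      ultimately show ?thesis using sub by auto
    qed
    \<comment> \<open>The index set starts at 1 so that \<open>k - 1\<close> below is a true
      predecessor and not truncated at 0.\<close>
    have "(\<lambda>i. dep (v i)) ` {1..L} \<noteq> {}" using Lpos by auto
    then have "Max ((\<lambda>i. dep (v i)) ` {1..L}) \<in> (\<lambda>i. dep (v i)) ` {1..L}" by (intro Max_in) auto
    then obtain k where k: "k \<in> {1..L}" "Max ((\<lambda>i. dep (v i)) ` {1..L}) = dep (v k)" by blast
    have kmax: "dep (v i) \<le> dep (v k)" if "i \<in> {1..L}" for i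
      unfolding k(2)[symmetric] using that by (intro Max_ge) auto
    have top: "dep (v i) \<le> dep (v k)" for i
    proof -
      have "i mod L < L" using Lpos by simp
      then have "(if i mod L = 0 then L else i mod L) \<in> {1..L}" by auto
      from kmax[OF this] show ?thesis by (auto simp: v_def split: if_splits)
    qed
    \<comment> \<open>A neighbour in the tree is the parent or a child, and a child would be deeper
      than \<open>v k\<close>.\<close>
    have up: "x = par (v k)" if "(x, v k) \<in> parcs ?T \<or> (v k, x) \<in> parcs ?T" "dep x \<le> dep (v k)" for x
    proof -
      have "x = par (v k) \<or> v k = par x \<and> x \<in> P - {r}"
        using that(1) by (auto simp: parent_tree_def)
      then consider "x = par (v k)" | "v k = par x" "x \<in> P - {r}" by argo
      then show ?thesis
      proof cases
        case 2
        then have "dep (v k) < dep x" using par by simp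
        then show ?thesis using that(2) by simp
      qed
    qed
    have "v (k - 1) = par (v k)" using arc[of "k - 1"] k(1) by (intro up) (auto simp: top)
    moreover have "v (Suc k) = par (v k)" using arc[of k] by (intro up) (auto simp: top)
    \<comment> \<open>Both cyclic neighbours are the parent, so two indices at distance 2 agree
      modulo \<open>L\<close>, although \<open>L \<ge> 3\<close>.\<close>
    ultimately have "(k - 1) mod L = Suc k mod L" using inj by simp
    then have "L dvd Suc k - (k - 1)" using mod_eq_dvd_iff_nat[of "k - 1" "Suc k" L] by auto
    moreover have "Suc k - (k - 1) = 2" using k(1) by auto
    ultimately show False using Lpos by (auto dest: dvd_imp_le)
  qed
  then show ?thesis using T.pair_graph con unfolding undirected_tree_def by blast
qed

text \<open>A breadth-first tree: \<open>dep\<close> is the distance from \<open>s\<close> along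
  \<open>R\<close>, and the parent of \<open>u\<close> is the last vertex before \<open>u\<close> on
  a shortest path.\<close>

lemma S_tree_of_connected:
  assumes G: "pair_graph G" and S: "S \<subseteq> pverts G" "s \<in> S"
    and R: "symp R" "\<And>u v. R u v \<Longrightarrow> (u, v) \<in> parcs G"
    and con: "\<And>t. t \<in> S \<Longrightarrow> R\<^sup>*\<^sup>* s t"
  shows "\<exists>T. S_tree G S T \<and> pverts T \<subseteq> {u. R\<^sup>*\<^sup>* s u} \<and> (\<forall>(u, v)\<in>parcs T. R u v)"
proof -
  interpret G: pair_graph G by fact
  define P where "P = {u. R\<^sup>*\<^sup>* s u}"
  define dep where "dep u = (LEAST k. (R ^^ k) s u)" for u
  have depth: "(R ^^ dep u) s u" if "u \<in> P" for u
    unfolding dep_def using that by (auto simp: P_def rtranclp_power intro: LeastI)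
  have depmin: "dep u \<le> k" if "(R ^^ k) s u" for u k
    unfolding dep_def using that by (rule Least_le)
  have "\<exists>w. w \<in> P \<and> dep w < dep u \<and> R w u" if u: "u \<in> P - {s}" for u
  proof -
    have "(R ^^ dep u) s u" using u depth by blast
    moreover have "dep u \<noteq> 0" using calculation u by (metis DiffD2 insertI1 relpowp_0_E)
    ultimately obtain k w where k: "dep u = Suc k" "(R ^^ k) s w" "R w u"
      by (metis not0_implies_Suc relpowp_Suc_E)
    then have "w \<in> P" by (auto simp: P_def rtranclp_power)
    then show ?thesis using k depmin[OF k(2)] by auto
  qed
  then obtain par where par: "\<And>u. u \<in> P - {s} \<Longrightarrow> par u \<in> P \<and> dep (par u) < dep u \<and> R (par u) u"
    by metis
  have PG: "P \<subseteq> pverts G"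
  proof
    fix u assume "u \<in> P"
    then have "R\<^sup>*\<^sup>* s u" by (simp add: P_def)
    then show "u \<in> pverts G"
      by (induction rule: rtranclp_induct) (use S R(2) in \<open>auto dest: G.in_arcsD2\<close>)
  qed
  let ?T = "parent_tree P s par"
  have fin: "finite P" using PG G.pair_finite_verts finite_subset by blast
  have ut: "undirected_tree ?T"
    using par by (intro parent_tree_undirected_tree[where dep = dep] fin) (auto simp: P_def)
  have Rarcs: "R u v" if "(u, v) \<in> parcs ?T" for u v
    using that par R(1) by (auto simp: parent_tree_def dest: sympD)
  have "pair_graph ?T" using ut by (simp add: undirected_tree_def)
  then interpret T: pair_graph ?T .
  have "subgraph (with_proj ?T) (with_proj G)"
    using PG Rarcs R(2) T.wf_digraph G.wf_digraph
    by (auto simp: subgraph_def compatible_def parent_tree_def)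
  moreover have "S \<subseteq> pverts ?T" using con by (auto simp: parent_tree_def P_def)
  ultimately have "S_tree G S ?T" using ut by (simp add: S_tree_def)
  then show ?thesis using Rarcs by (intro exI[of _ ?T]) (auto simp: parent_tree_def P_def)
qed

text \<open>A vertex outside \<open>S\<close> has one colour, so two trees meet only in
  \<open>S\<close>. An edge either has an end outside \<open>S\<close>, which fixes its tree, or is
  assigned by \<open>ecol\<close>.\<close>

lemma IDSTs_of_packs:
  assumes G: "pair_graph G" and S: "S \<subseteq> pverts G" "S \<noteq> {}"
    and p: "packs (\<lambda>u v. (u, v) \<in> parcs G) S {1..r}"
  shows "\<exists>T. IDSTs G S r T"
proof -
  interpret G: pair_graph G by fact
  obtain s where s: "s \<in> S" using S(2) by blast
  let ?E = "\<lambda>u v. (u, v) \<in> parcs G"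
  obtain col ecol where sym: "\<And>u v. ecol u v = ecol v u"
    and con: "\<And>j s t. j \<in> {1..r} \<Longrightarrow> s \<in> S \<Longrightarrow> t \<in> S \<Longrightarrow> (packing_edge ?E S col ecol j)\<^sup>*\<^sup>* s t"
    using p unfolding packs_def by blast
  have symE: "symp ?E" by (auto intro: sympI G.arcs_symmetric)
  have "\<exists>T. S_tree G S T \<and> pverts T \<subseteq> {u. (packing_edge ?E S col ecol j)\<^sup>*\<^sup>* s u} \<and>
      (\<forall>(u, v)\<in>parcs T. packing_edge ?E S col ecol j u v)" if "j \<in> {1..r}" for j
    by (rule S_tree_of_connected[OF G S(1) s packing_edge_sym[OF symE sym]])
      (use con[OF that s] in \<open>auto simp: packing_edge_def\<close>)
  then obtain T where T: "\<And>j. j \<in> {1..r} \<Longrightarrow> S_tree G S (T j) \<and>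
      pverts (T j) \<subseteq> {u. (packing_edge ?E S col ecol j)\<^sup>*\<^sup>* s u} \<and>
      (\<forall>(u, v)\<in>parcs (T j). packing_edge ?E S col ecol j u v)"
    by metis
  have colv: "u \<in> S \<or> col u = j" if "(packing_edge ?E S col ecol j)\<^sup>*\<^sup>* s u" for u j
    using that s by (induction rule: rtranclp_induct) (auto simp: packing_edge_def split: if_splits)
  have edge_eq: "i = j" if "packing_edge ?E S col ecol i u v" "packing_edge ?E S col ecol j u v" for i j u v
    using that by (auto simp: packing_edge_def split: if_splits)
  have "pverts (T i) \<inter> pverts (T j) = S \<and> parcs (T i) \<inter> parcs (T j) = {}"
    if ij: "1 \<le> i" "i < j" "j \<le> r" for i j
  proof
    have i: "i \<in> {1..r}" and j: "j \<in> {1..r}" using ij by auto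
    have "S \<subseteq> pverts (T i)" "S \<subseteq> pverts (T j)" using T[OF i] T[OF j] by (auto simp: S_tree_def)
    moreover have "u \<in> S" if "u \<in> pverts (T i)" "u \<in> pverts (T j)" for u
      using colv[of i u] colv[of j u] T[OF i] T[OF j] that ij by auto
    ultimately show "pverts (T i) \<inter> pverts (T j) = S" by blast
    show "parcs (T i) \<inter> parcs (T j) = {}"
    proof (rule ccontr)
      assume "parcs (T i) \<inter> parcs (T j) \<noteq> {}"
      then obtain u v where "(u, v) \<in> parcs (T i)" "(u, v) \<in> parcs (T j)" by auto
      then have "i = j" using T[OF i] T[OF j] by (intro edge_eq[of i u v j]) blast+
      then show False using ij(2) by simp
    qed
  qed
  then have "IDSTs G S r T" using T by (auto simp: IDSTs_def)
  then show ?thesis by blast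
qed

section \<open>The star model\<close>

definition inside :: "('a \<Rightarrow> 'a \<Rightarrow> bool) \<Rightarrow> 'a set \<Rightarrow> 'a \<Rightarrow> 'a \<Rightarrow> bool" where
  "inside R B u v \<longleftrightarrow> R u v \<and> u \<in> B \<and> v \<in> B"

definition linked :: "('a \<Rightarrow> 'a \<Rightarrow> bool) \<Rightarrow> 'a set \<Rightarrow> bool" where
  "linked R B \<longleftrightarrow> (\<forall>u\<in>B. \<forall>v\<in>B. (inside R B)\<^sup>*\<^sup>* u v)"

lemma rtranclp_mono': "R\<^sup>*\<^sup>* a b \<Longrightarrow> (\<And>x y. R x y \<Longrightarrow> Q x y) \<Longrightarrow> Q\<^sup>*\<^sup>* a b"
  by (rule rtranclp_mono[THEN predicate2D, of R Q]) auto

lemma inside_mono: "(inside R B)\<^sup>*\<^sup>* a b \<Longrightarrow> B \<subseteq> B' \<Longrightarrow> (inside R B')\<^sup>*\<^sup>* a b"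
  by (erule rtranclp_mono') (auto simp: inside_def)

lemma symp_inside: "symp R \<Longrightarrow> symp (inside R B)"
  by (auto simp: symp_def inside_def)

lemma linked_root:
  assumes "symp R" "\<And>u. u \<in> B \<Longrightarrow> (inside R B)\<^sup>*\<^sup>* u r"
  shows "linked R B"
  unfolding linked_def
  by (meson assms rtranclp_symp rtranclp_trans symp_inside)

lemma linkedD: "linked R B \<Longrightarrow> u \<in> B \<Longrightarrow> v \<in> B \<Longrightarrow> (inside R B)\<^sup>*\<^sup>* u v"
  unfolding linked_def by blast

lemma inside_step: "R u v \<Longrightarrow> u \<in> B \<Longrightarrow> v \<in> B \<Longrightarrow> (inside R B)\<^sup>*\<^sup>* v w \<Longrightarrow> (inside R B)\<^sup>*\<^sup>* u w"
  by (rule converse_rtranclp_into_rtranclp) (auto simp: inside_def)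

definition nb :: "'i \<Rightarrow> ('i \<Rightarrow> 'v) \<Rightarrow> 'v \<Rightarrow> 'i \<Rightarrow> 'v" where
  "nb c f j = transpose (f c) j \<circ> f"

lemma nb_ctr [simp]: "nb c f j c = j"
  by (simp add: nb_def)

lemma nb_self [simp]: "nb c f (f c) = f"
  by (simp add: nb_def)

lemma nb_nb_back [simp]: "nb c (nb c f j) (f c) = f"
  by (simp add: nb_def fun_eq_iff transpose_def)

lemma nb_eq_iff [simp]: "nb c f j = nb c f k \<longleftrightarrow> j = k"
  by (metis nb_ctr)

lemma nb_eqD: "nb c f j = nb c g k \<Longrightarrow> j = k"
  by (metis nb_ctr)

text \<open>The values of \<open>h\<close> lie outside \<open>V\<close>, so transposing two elements
  of \<open>V\<close> does not touch the positions outside \<open>I\<close>. Freezing position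
  \<open>p\<close> at value \<open>c\<close> then yields a star on literally the same functions,
  without an isomorphism to carry along. The relation \<open>cardV\<close> (n values, n - 2
  positions) survives this.\<close>

locale star =
  fixes ctr :: 'i and I :: "'i set" and V :: "'v set" and h :: "'i \<Rightarrow> 'v"
  assumes finI: "finite I" and ctrI: "ctr \<in> I" and finV: "finite V"
    and cardV: "card V = card I + 2" and hV: "i \<notin> I \<Longrightarrow> h i \<notin> V"
begin

definition W :: "('i \<Rightarrow> 'v) set" where
  "W = {f. inj_on f I \<and> f ` I \<subseteq> V \<and> (\<forall>i. i \<notin> I \<longrightarrow> f i = h i)}"

definition A :: "('i \<Rightarrow> 'v) \<Rightarrow> ('i \<Rightarrow> 'v) \<Rightarrow> bool" where
  "A f g \<longleftrightarrow> f \<in> W \<and> g \<in> W \<and> f \<noteq> g \<and> g = nb ctr f (g ctr)"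

definition E :: "('i \<Rightarrow> 'v) \<times> bool \<Rightarrow> ('i \<Rightarrow> 'v) \<times> bool \<Rightarrow> bool" where
  "E u v \<longleftrightarrow> (if snd u = snd v then A (fst u) (fst v) else fst u \<in> W \<and> fst u = fst v)"

lemma W_V: "f \<in> W \<Longrightarrow> i \<in> I \<Longrightarrow> f i \<in> V"
  by (auto simp: W_def)

lemma W_ctr: "f \<in> W \<Longrightarrow> f ctr \<in> V"
  using W_V ctrI by blast

lemma W_inj: "f \<in> W \<Longrightarrow> i \<in> I \<Longrightarrow> k \<in> I \<Longrightarrow> f i = f k \<longleftrightarrow> i = k"
  by (auto simp: W_def inj_on_def)

lemma W_eqI: "f \<in> W \<Longrightarrow> g \<in> W \<Longrightarrow> (\<And>i. i \<in> I \<Longrightarrow> f i = g i) \<Longrightarrow> f = g"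
  by (rule ext) (metis (mono_tags, lifting) W_def mem_Collect_eq)

lemma W_transpose: "f \<in> W \<Longrightarrow> a \<in> V \<Longrightarrow> b \<in> V \<Longrightarrow> transpose a b \<circ> f \<in> W"
  using hV by (auto simp: W_def inj_on_def transpose_def)

lemma W_nb: "f \<in> W \<Longrightarrow> j \<in> V \<Longrightarrow> nb ctr f j \<in> W"
  using W_transpose[OF _ W_ctr] by (simp add: nb_def)

lemma nb_at: "f \<in> W \<Longrightarrow> i \<in> I \<Longrightarrow> i \<noteq> ctr \<Longrightarrow> nb ctr f j i = (if f i = j then f ctr else f i)"
  using W_inj[of f i ctr] ctrI by (auto simp: nb_def transpose_def)

lemma W_nonempty: "W \<noteq> {}"
proof -
  have "\<exists>f. f ` I \<subseteq> V \<and> inj_on f I"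
    using card_le_inj[OF finI finV] cardV by auto
  then obtain f where f: "f ` I \<subseteq> V" "inj_on f I" by blast
  have "(\<lambda>i. if i \<in> I then f i else h i) \<in> W"
    using f by (auto simp: W_def inj_on_def)
  then show ?thesis by blast
qed

lemma W_ex1: assumes "a \<in> V" shows "\<exists>f\<in>W. f ctr = a"
  using W_nonempty W_nb assms nb_ctr by (metis ex_in_conv)

lemma W_ex2:
  assumes "a \<in> V" "b \<in> V" "a \<noteq> b" "p \<in> I" "p \<noteq> ctr"
  shows "\<exists>f\<in>W. f ctr = a \<and> f p = b"
proof -
  obtain f where f: "f \<in> W" "f ctr = a" using W_ex1 assms(1) by blast
  have "transpose (f p) b \<circ> f \<in> W" using f assms W_V W_transpose by blast
  moreover have "(transpose (f p) b \<circ> f) ctr = a"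
    using f assms W_inj[of f p ctr] ctrI by (auto simp: transpose_def)
  moreover have "(transpose (f p) b \<circ> f) p = b" by simp
  ultimately show ?thesis by blast
qed

lemma A_nb: "f \<in> W \<Longrightarrow> j \<in> V \<Longrightarrow> j \<noteq> f ctr \<Longrightarrow> A f (nb ctr f j)"
  unfolding A_def using W_nb by (metis nb_ctr)

lemma A_sym: "symp A"
proof (rule sympI)
  fix f g assume "A f g"
  then show "A g f" unfolding A_def by (metis nb_nb_back)
qed

lemma A_ctr: "A f g \<Longrightarrow> f ctr \<noteq> g ctr"
  unfolding A_def by (metis nb_self)

lemma A_eq: "A f g \<Longrightarrow> nb ctr f (g ctr) = g"
  unfolding A_def by auto

lemma A_W: "A f g \<Longrightarrow> f \<in> W \<and> g \<in> W"
  unfolding A_def by auto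

lemma E_sym: "symp E"
  using A_sym by (auto simp: symp_def E_def)

lemma E_same [simp]: "E (f, b) (g, b) \<longleftrightarrow> A f g"
  by (simp add: E_def)

lemma E_flip [simp]: "b \<noteq> b' \<Longrightarrow> E (f, b) (g, b') \<longleftrightarrow> f \<in> W \<and> f = g"
  by (simp add: E_def)

lemma star_copy:
  assumes "p \<in> I" "p \<noteq> ctr" "c \<in> V"
  shows "star ctr (I - {p}) (V - {c}) (h(p := c))"
proof
  show "finite (I - {p})" "finite (V - {c})" using finI finV by auto
  show "ctr \<in> I - {p}" using assms ctrI by auto
  have "card I > 0" using finI assms(1) card_gt_0_iff by blast
  then show "card (V - {c}) = card (I - {p}) + 2" using assms cardV by simp
  fix i assume "i \<notin> I - {p}"
  then show "(h(p := c)) i \<notin> V - {c}" using hV by auto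
qed

lemma W_copy:
  assumes "p \<in> I" "p \<noteq> ctr" "c \<in> V"
  shows "star.W (I - {p}) (V - {c}) (h(p := c)) = {f \<in> W. f p = c}"
proof -
  interpret C: star ctr "I - {p}" "V - {c}" "h(p := c)" using star_copy[OF assms] .
  show ?thesis
  proof (intro set_eqI iffI)
    fix f assume "f \<in> C.W"
    then have f: "inj_on f (I - {p})" "f ` (I - {p}) \<subseteq> V - {c}" "\<And>i. i \<notin> I - {p} \<Longrightarrow> f i = (h(p := c)) i"
      by (auto simp: C.W_def)
    have "f p = c" using f(3)[of p] by simp
    moreover have "inj_on f (insert p (I - {p}))"
      using f(1,2) calculation by (subst inj_on_insert) auto
    then have "inj_on f I" using assms(1) by (simp add: insert_absorb)
    moreover have "f ` I \<subseteq> V" using f(2) calculation assms by blast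
    moreover have "f i = h i" if "i \<notin> I" for i using f(3)[of i] that assms(1) by auto
    ultimately show "f \<in> {f \<in> W. f p = c}" by (auto simp: W_def)
  next
    fix f assume "f \<in> {f \<in> W. f p = c}"
    then have f: "f \<in> W" "f p = c" by auto
    have "f i \<noteq> c" if "i \<in> I - {p}" for i using W_inj[OF f(1), of i p] f(2) that assms(1) by auto
    then have "f ` (I - {p}) \<subseteq> V - {c}" using W_V[OF f(1)] by blast
    moreover have "inj_on f (I - {p})" using f(1) by (auto simp: W_def intro: inj_on_subset)
    moreover have "f i = (h(p := c)) i" if "i \<notin> I - {p}" for i
      using f that by (cases "i = p") (auto simp: W_def)
    ultimately show "f \<in> C.W" unfolding C.W_def by blast
  qed
qed

lemma A_copy:
  assumes "p \<in> I" "p \<noteq> ctr" "c \<in> V"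
  shows "star.A ctr (I - {p}) (V - {c}) (h(p := c)) f g \<longleftrightarrow> A f g \<and> f p = c \<and> g p = c"
proof -
  interpret C: star ctr "I - {p}" "V - {c}" "h(p := c)" using star_copy[OF assms] .
  show ?thesis unfolding C.A_def A_def W_copy[OF assms] by auto
qed

lemma E_copy:
  assumes "p \<in> I" "p \<noteq> ctr" "c \<in> V"
  shows "star.E ctr (I - {p}) (V - {c}) (h(p := c)) u v \<longleftrightarrow> E u v \<and> fst u p = c \<and> fst v p = c"
proof -
  interpret C: star ctr "I - {p}" "V - {c}" "h(p := c)" using star_copy[OF assms] .
  show ?thesis unfolding C.E_def E_def A_copy[OF assms] W_copy[OF assms] by auto
qed

text \<open>Exchanging the values at \<open>ctr\<close> and \<open>p\<close> is the only move that
  changes the value at \<open>p\<close>. So within its layer a vertex has exactly one neighbour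
  outside its copy, its exit, and this lies in the copy named by its centre value.\<close>

lemma exit_props:
  assumes "f \<in> W" "p \<in> I" "p \<noteq> ctr"
  shows "A f (nb ctr f (f p))" "nb ctr f (f p) p = f ctr"
  using assms A_nb[of f "f p"] W_V[of f p] W_inj[of f p ctr] ctrI nb_at[of f p] by auto

end

text \<open>Induction over the positions: each copy is connected, and from any copy one passes to
  copy \<open>c\<close> at a vertex with centre value \<open>c\<close>.\<close>

lemma star_linked: "star ctr I V h \<Longrightarrow> linked (star.A ctr I V h) (star.W I V h)"
proof (induction "card I" arbitrary: I V h)
  case 0
  interpret star ctr I V h by fact
  show ?case using 0 finI ctrI by auto
next
  case (Suc n)
  interpret star ctr I V h by fact
  show ?case
  proof (cases "I = {ctr}")
    case True
    have "inside A W f g" if "f \<in> W" "g \<in> W" "f \<noteq> g" for f g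
    proof -
      have "g = nb ctr f (g ctr)"
        using that True W_nb[of f "g ctr"] W_ctr[of g] by (intro W_eqI) auto
      then show ?thesis using that by (simp add: inside_def A_def)
    qed
    then show ?thesis unfolding linked_def by (metis r_into_rtranclp rtranclp.rtrancl_refl)
  next
    case False
    then obtain p where p: "p \<in> I" "p \<noteq> ctr" using ctrI by blast
    have copies: "(inside A {f \<in> W. f p = c})\<^sup>*\<^sup>* f g" if "c \<in> V" "f \<in> W" "g \<in> W" "f p = c" "g p = c" for c f g
    proof -
      interpret C: star ctr "I - {p}" "V - {c}" "h(p := c)" using star_copy[OF p that(1)] .
      have "linked C.A C.W" using Suc(1)[OF _ C.star_axioms] Suc(2) p finI by simp
      then have "(inside C.A C.W)\<^sup>*\<^sup>* f g" using that by (simp add: linked_def W_copy[OF p that(1)])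
      then show ?thesis
        by (rule rtranclp_mono') (auto simp: inside_def W_copy[OF p that(1)] A_copy[OF p that(1)])
    qed
    obtain r where r: "r \<in> W" using W_nonempty by blast
    define c where "c = r p"
    have c: "c \<in> V" using r p W_V c_def by blast
    have "(inside A W)\<^sup>*\<^sup>* f r" if f: "f \<in> W" for f
    proof (cases "f p = c")
      case True
      show ?thesis by (rule inside_mono[OF copies[OF c f r True]]) (auto simp: c_def)
    next
      case False
      have fp: "f p \<in> V" using W_V f p by blast
      obtain g where g: "g \<in> W" "g ctr = c" "g p = f p" using W_ex2[OF c fp _ p] False by auto
      have 1: "(inside A W)\<^sup>*\<^sup>* f g" by (rule inside_mono[OF copies[OF fp f g(1)]]) (auto simp: g(3))
      have g': "nb ctr g (g p) \<in> W" "nb ctr g (g p) p = c"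
        using exit_props[OF g(1) p] g(2) A_W by auto
      have 2: "(inside A W)\<^sup>*\<^sup>* (nb ctr g (g p)) r"
        by (rule inside_mono[OF copies[OF c g'(1) r g'(2)]]) (auto simp: c_def)
      show ?thesis using 1 inside_step[OF exit_props(1)[OF g(1) p] g(1) g'(1) 2] by (rule rtranclp_trans)
    qed
    then show ?thesis using linked_root[OF A_sym] by blast
  qed
qed

context star
begin

text \<open>Deleting \<open>f0\<close> and any of its neighbours in a layer leaves that layer connected: the copies (by
  value at \<open>p\<close>) avoided by the closed neighbourhood are intact and joined to each other, and
  every other remaining vertex reaches one of them in at most three steps.\<close>

lemma linked_minus_closed_neighbourhood:
  assumes p: "p \<in> I" "p \<noteq> ctr" and f0: "f0 \<in> W"
    and B: "f0 \<in> B" "B \<subseteq> {nb ctr f0 j | j. j \<in> V}"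
  shows "linked A (W - B)"
proof -
  define i where "i = f0 p"
  define a where "a = f0 ctr"
  have ia: "i \<in> V" "a \<in> V" "i \<noteq> a" using f0 p ctrI W_V W_inj by (auto simp: i_def a_def)
  define N where "N = {nb ctr f0 j | j. j \<in> V}"
  \<comment> \<open>The closed neighbourhood lies in copy \<open>i\<close>, except for the exit of
    \<open>f0\<close>, which lies in copy \<open>a\<close>. All other copies are intact.\<close>
  have Np: "f p = (if f ctr = i then a else i)" if "f \<in> N" for f
    using that nb_at[OF f0 p] by (auto simp: N_def i_def a_def)
  have Nf0: "f = f0" if "f \<in> N" "f ctr = a" for f using that by (auto simp: N_def a_def)
  have BN: "B \<subseteq> N" using B by (simp add: N_def)
  have card: "card V \<ge> 4"
  proof -
    have "card {ctr, p} \<le> card I" using p ctrI finI by (intro card_mono) auto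
    then show ?thesis using cardV p by simp
  qed
  \<comment> \<open>An intact copy \<open>j1\<close> exists because there are at least four values;
    it is the meeting place for all remaining vertices.\<close>
  have "card (V - {i, a}) \<noteq> 0" using card ia finV by (simp add: card_Diff_subset)
  then obtain j1 where j1: "j1 \<in> V" "j1 \<noteq> i" "j1 \<noteq> a" by (metis DiffE card.empty equals0I insertI1 insertI2)
  obtain r where r: "r \<in> W" "r p = j1" using W_ex2[OF ia(1) j1(1) _ p] j1 by metis
  let ?P = "\<lambda>f. (inside A (W - B))\<^sup>*\<^sup>* f r"
  have copies: "(inside A (W - B))\<^sup>*\<^sup>* f g" if "f \<in> W" "g \<in> W" "f p = g p" "f p \<noteq> i" "f p \<noteq> a" for f g
  proof -
    have c: "f p \<in> V" using that p W_V by blast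
    interpret C: star ctr "I - {p}" "V - {f p}" "h(p := f p)" using star_copy[OF p c] .
    have "f \<in> C.W" "g \<in> C.W" unfolding W_copy[OF p c] using that by auto
    then have "(inside C.A C.W)\<^sup>*\<^sup>* f g" by (rule linkedD[OF star_linked[OF C.star_axioms]])
    then show ?thesis
    proof (rule rtranclp_mono')
      fix x y assume "inside C.A C.W x y"
      then have "A x y" "x \<in> W" "y \<in> W" "x p = f p" "y p = f p"
        by (auto simp: inside_def W_copy[OF p c] A_copy[OF p c])
      moreover have "x \<notin> B" "y \<notin> B" using Np[of x] Np[of y] BN calculation that by (auto split: if_splits)
      ultimately show "inside A (W - B) x y" by (simp add: inside_def)
    qed
  qed
  have far: "?P f" if f: "f \<in> W" "f p \<noteq> i" "f p \<noteq> a" for f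
  proof (cases "f p = j1")
    case True
    then show ?thesis using copies[OF f(1) r(1)] r j1 by auto
  next
    case False
    have fp: "f p \<in> V" using W_V f p by blast
    obtain g where g: "g \<in> W" "g ctr = j1" "g p = f p" using W_ex2[OF j1(1) fp _ p] False by auto
    note ex = exit_props[OF g(1) p]
    have g': "nb ctr g (g p) \<in> W" using ex A_W by blast
    have "g \<notin> B" "nb ctr g (g p) \<notin> B"
      using Np[of g] Np[of "nb ctr g (g p)"] BN g f ex j1 by (auto split: if_splits)
    moreover have "?P (nb ctr g (g p))" using copies[OF g' r(1)] ex g r j1 by auto
    ultimately have "?P g" using inside_step[of A g "nb ctr g (g p)" "W - B" r] ex(1) g' g(1) by simp
    then show ?thesis using copies[OF f(1) g(1)] f g by (auto intro: rtranclp_trans)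
  qed
  have near_a: "?P f" if f: "f \<in> W - B" "f p = a" "f ctr \<noteq> i" for f
  proof -
    note ex = exit_props[OF _ p, of f]
    have fa: "f ctr \<noteq> a" using f W_inj[of f p ctr] p ctrI by auto
    have W': "nb ctr f (f p) \<in> W" using ex A_W f by blast
    have "?P (nb ctr f (f p))" using far[OF W'] ex f fa by auto
    moreover have "nb ctr f (f p) \<notin> B" using Np[of "nb ctr f (f p)"] ex f fa BN by (auto split: if_splits)
    ultimately show ?thesis using inside_step[of A f "nb ctr f (f p)"] ex(1) f W' by auto
  qed
  have at_a: "?P f" if f: "f \<in> W - B" "f p = a" for f
  proof (cases "f ctr = i")
    case True
    \<comment> \<open>The exit of \<open>f\<close> would lead into the damaged copy
      \<open>i\<close>. Changing the centre to \<open>j1\<close> first stays in copy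
      \<open>a\<close> and off \<open>N\<close>.\<close>
    let ?g = "nb ctr f j1"
    have g: "?g \<in> W" "?g p = a" "?g ctr = j1" using W_nb[of f j1] f nb_at[of f p j1] p j1 by auto
    then have "?g \<notin> B" using Np[of ?g] BN j1 ia by auto
    then show ?thesis using inside_step[of A f ?g] near_a[of ?g] g j1 A_nb[of f j1] True f by auto
  next
    case False
    then show ?thesis using near_a f by blast
  qed
  have at_i: "?P f" if f: "f \<in> W - B" "f p = i" for f
  proof -
    note ex = exit_props[OF _ p, of f]
    let ?g = "nb ctr f (f p)"
    have W': "?g \<in> W" using ex A_W f by blast
    have fi: "f ctr \<noteq> i" using f W_inj[of f p ctr] p ctrI by auto
    \<comment> \<open>Only the exit of \<open>f0\<close> belongs to \<open>N\<close> without lying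
      in copy \<open>i\<close>, and it is the exit of no other vertex.\<close>
    have gB: "?g \<notin> B"
    proof
      assume gB: "?g \<in> B"
      then have "?g \<in> N" using BN by blast
      then have "?g = nb ctr f0 i" using f(2) by (auto simp: N_def dest: nb_eqD)
      moreover have "f ctr = a" using Np[OF \<open>?g \<in> N\<close>] ex(2) f fi by (auto split: if_splits)
      ultimately have "f = f0" by (metis a_def nb_nb_back)
      then show False using f B by blast
    qed
    have "?P ?g" using far[OF W'] at_a[of ?g] ex f fi W' gB by (cases "f ctr = a") auto
    then show ?thesis using inside_step[of A f ?g] ex(1) f W' gB by auto
  qed
  have "?P f" if "f \<in> W - B" for f
    using that far[of f] at_a[of f] at_i[of f] by blast
  then show ?thesis using linked_root[OF A_sym] by blast
qed

section \<open>Short paths from the given vertices\<close>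

text \<open>An arm of colour \<open>j\<close>, to be used inside a copy of a larger star: its last
  vertex has centre value \<open>j\<close>, so the exit of that vertex leads to copy
  \<open>j\<close> of the larger star.\<close>

definition reaches ::
  "(('i \<Rightarrow> 'v) \<times> bool) set \<Rightarrow> (('i \<Rightarrow> 'v) \<times> bool \<Rightarrow> 'v) \<Rightarrow>
   (('i \<Rightarrow> 'v) \<times> bool \<Rightarrow> ('i \<Rightarrow> 'v) \<times> bool \<Rightarrow> 'v) \<Rightarrow> 'v \<Rightarrow> ('i \<Rightarrow> 'v) \<times> bool \<Rightarrow> bool" where
  "reaches X col ecol j x \<longleftrightarrow> (\<exists>v. (packing_edge E X col ecol j)\<^sup>*\<^sup>* x v \<and> fst v \<in> W \<and>
     fst v ctr = j \<and> (v \<in> X \<or> col v = j))"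

lemma reaches_self: "x \<in> X \<Longrightarrow> fst x \<in> W \<Longrightarrow> fst x ctr = j \<Longrightarrow> reaches X col ecol j x"
  unfolding reaches_def by blast

lemma reaches_end: "x \<in> X \<or> col x = j \<Longrightarrow> fst x \<in> W \<Longrightarrow> fst x ctr = j \<Longrightarrow> reaches X col ecol j x"
  unfolding reaches_def by blast

lemma reaches_step:
  "packing_edge E X col ecol j x y \<Longrightarrow> reaches X col ecol j y \<Longrightarrow> reaches X col ecol j x"
  unfolding reaches_def by (blast intro: converse_rtranclp_into_rtranclp)

lemma reaches_nb:
  assumes f: "f \<in> W" "j \<in> V" "j \<noteq> f ctr" "(f, b) \<in> X"
    and n: "(nb ctr f j, b) \<notin> X" "col (nb ctr f j, b) = j"
  shows "reaches X col ecol j (f, b)"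
proof (rule reaches_step)
  show "packing_edge E X col ecol j (f, b) (nb ctr f j, b)"
    using f n A_nb by (intro packing_edgeI) auto
  show "reaches X col ecol j (nb ctr f j, b)"
    using f n W_nb by (intro reaches_end) auto
qed

definition all_arms :: "(('i \<Rightarrow> 'v) \<times> bool) set \<Rightarrow> bool" where
  "all_arms X \<longleftrightarrow> (\<exists>col ecol. (\<forall>u v. ecol u v = ecol v u) \<and> (\<forall>x\<in>X. \<forall>j\<in>V. reaches X col ecol j x))"

lemma all_armsI:
  assumes "\<And>u v. ecol u v = ecol v u" "\<And>x j. x \<in> X \<Longrightarrow> j \<in> V \<Longrightarrow> reaches X col ecol j x"
  shows "all_arms X"
  unfolding all_arms_def using assms by blast

text \<open>Colouring every vertex by its centre value serves all colours at once, except that an edge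
  between two members of \<open>X\<close> in one layer cannot have two colours. If all such edges
  meet in \<open>(g, b)\<close>, its neighbours give way and reach the colour of \<open>g\<close> through the other layer.\<close>

lemma all_arms_star:
  assumes XW: "fst ` X \<subseteq> W" and g: "g \<in> W"
    and only: "\<And>u w b'. (u, b') \<in> X \<Longrightarrow> (w, b') \<in> X \<Longrightarrow> A u w \<Longrightarrow> b' = b \<and> (u = g \<or> w = g)"
    and other: "\<And>k l. (k, \<not> b) \<in> X \<Longrightarrow> (l, b) \<in> X \<Longrightarrow> A g l \<Longrightarrow> nb ctr k (l ctr) = l \<Longrightarrow> k = l"
  shows "all_arms X"
proof -
  define L where "L = {l. (l, b) \<in> X \<and> A g l}"
  \<comment> \<open>The edge from \<open>g\<close> to a member \<open>l\<close> of \<open>L\<close>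
    serves the arm of \<open>g\<close>. For the colour of \<open>g\<close> the vertex
    \<open>l\<close> takes the path \<open>(l, b)\<close>, \<open>(l, \<not> b)\<close>,
    \<open>(g, \<not> b)\<close>, whose middle vertex is recoloured for this purpose.\<close>
  define col where "col v = (if snd v = (\<not> b) \<and> fst v \<in> L then g ctr else fst v ctr)"
    for v :: "('i \<Rightarrow> 'v) \<times> bool"
  define ecol where "ecol u v = (if snd u = snd v \<and> fst u = g then fst v ctr
      else if snd u = snd v \<and> fst v = g then fst u ctr else g ctr)" for u v :: "('i \<Rightarrow> 'v) \<times> bool"
  have gL: "g \<notin> L" using A_ctr[of g g] by (auto simp: L_def)
  have "reaches X col ecol j (f, b')" if x: "(f, b') \<in> X" "j \<in> V" for f b' j
  proof (cases "j = f ctr")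
    case True
    then show ?thesis using x XW by (intro reaches_self) auto
  next
    case False
    have f: "f \<in> W" using x XW by force
    have A: "A f (nb ctr f j)" using A_nb[OF f x(2) False] .
    show ?thesis
    proof (cases "b' = b \<and> f \<in> L \<and> j = g ctr")
      case True
      have Ag: "A f g" using True A_sym by (auto simp: L_def dest: sympD)
      have gX: "(g, \<not> b) \<notin> X"
        using other[of g f] True gL x A_eq[of g f] by (auto simp: L_def)
      have "packing_edge E X col ecol j (f, b) (f, \<not> b)"
        using True x f by (intro packing_edgeI) (auto simp: col_def ecol_def)
      moreover have "packing_edge E X col ecol j (f, \<not> b) (g, \<not> b)"
        using True gX gL Ag by (intro packing_edgeI) (auto simp: col_def)
      moreover have "reaches X col ecol j (g, \<not> b)"
        using True g gL by (intro reaches_end) (auto simp: col_def)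
      ultimately show ?thesis using True by (meson reaches_step)
    next
      case no: False
      have step: "packing_edge E X col ecol j (f, b') (nb ctr f j, b')"
        if "(nb ctr f j, b') \<in> X"
      proof -
        have b: "b' = b \<and> (f = g \<or> nb ctr f j = g)" using only[OF x(1) that A] .
        moreover have "f = g"
        proof (rule ccontr)
          assume "f \<noteq> g"
          then have "nb ctr f j = g" using b by blast
          then have "j = g ctr" "A g f" using A A_sym by (auto dest: sympD)
          then show False using no b x by (auto simp: L_def)
        qed
        ultimately show ?thesis using that x A by (intro packing_edgeI) (auto simp: ecol_def)
      qed
      show ?thesis
      proof (cases "(nb ctr f j, b') \<in> X")
        case True
        show ?thesis by (rule reaches_step[OF step[OF True]], rule reaches_self[OF True]) (use A A_W in auto)
      next
        case nX: False
        \<comment> \<open>Only a recoloured vertex could be in the way, and \<open>other\<close>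
          keeps these from being neighbours of members of \<open>X\<close> in their layer.\<close>
        have "col (nb ctr f j, b') = j"
        proof (rule ccontr)
          assume "col (nb ctr f j, b') \<noteq> j"
          then have l: "b' = (\<not> b)" "nb ctr f j \<in> L" by (auto simp: col_def split: if_splits)
          then have "f = nb ctr f j" using other[of f "nb ctr f j"] x by (auto simp: L_def)
          then show False using A A_ctr by metis
        qed
        then show ?thesis using reaches_nb[OF f x(2) False x(1) nX] by blast
      qed
    qed
  qed
  then show ?thesis by (intro all_armsI[of ecol X col]) (auto simp: ecol_def)
qed

lemma triangle_agree:
  assumes "A f g" "A g k" "A f k" "i \<in> I" "i \<noteq> ctr"
  shows "g i = f i" "k i = f i"
proof -
  have W: "f \<in> W" "g \<in> W" "k \<in> W" using assms A_W by auto
  have ne: "f ctr \<noteq> g ctr" "g ctr \<noteq> k ctr" "f ctr \<noteq> k ctr" using assms A_ctr by auto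
  have 1: "g i = (if f i = g ctr then f ctr else f i)"
    using nb_at[OF W(1) assms(4,5), of "g ctr"] A_eq[OF assms(1)] by simp
  have 2: "k i = (if f i = k ctr then f ctr else f i)"
    using nb_at[OF W(1) assms(4,5), of "k ctr"] A_eq[OF assms(3)] by simp
  have 3: "k i = (if g i = k ctr then g ctr else g i)"
    using nb_at[OF W(2) assms(4,5), of "k ctr"] A_eq[OF assms(2)] by simp
  show "g i = f i" "k i = f i" using 1 2 3 ne by (auto split: if_splits)
qed

text \<open>A detour of two moves to centre value \<open>j\<close>. Position \<open>q\<close> ends
  up with the old centre value of \<open>f\<close>, which keeps the detours of different vertices
  apart.\<close>

lemma nb_nb_path:
  assumes f: "f \<in> W" and q: "q \<in> I" "q \<noteq> ctr" and j: "j \<in> V" "j \<noteq> f q" "j \<noteq> f ctr"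
  shows "A f (nb ctr f (f q))" "A (nb ctr f (f q)) (nb ctr (nb ctr f (f q)) j)"
    "nb ctr f (f q) q = f ctr" "nb ctr (nb ctr f (f q)) j q = f ctr"
proof -
  note ex = exit_props[OF f q]
  show "A f (nb ctr f (f q))" "nb ctr f (f q) q = f ctr" using ex by auto
  have W': "nb ctr f (f q) \<in> W" using ex A_W by blast
  show "A (nb ctr f (f q)) (nb ctr (nb ctr f (f q)) j)" using A_nb[OF W' j(1)] j by simp
  show "nb ctr (nb ctr f (f q)) j q = f ctr" using nb_at[OF W' q] ex j by simp
qed

text \<open>The edges are used cyclically, from \<open>g\<close> to \<open>f\<close>, from
  \<open>k\<close> to \<open>g\<close> and from \<open>f\<close> to \<open>k\<close>. Each vertex
  then lacks one colour and fetches it in the other layer. The vertex over the target is no help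
  there, since it carries a different colour, so the path detours through position
  \<open>q\<close>.\<close>

lemma all_arms_triangle:
  assumes q: "q \<in> I" "q \<noteq> ctr" and T: "A f g" "A g k" "A f k"
  shows "all_arms {(f, b), (g, b), (k, b)}"
proof -
  let ?X = "{(f, b), (g, b), (k, b)}"
  have W: "f \<in> W" "g \<in> W" "k \<in> W" using T A_W by auto
  define t where "t = f q"
  have tq: "g q = t" "k q = t" "f q = t" using triangle_agree[OF T q] by (auto simp: t_def)
  have ctrs: "f ctr \<noteq> g ctr" "g ctr \<noteq> k ctr" "f ctr \<noteq> k ctr" using T A_ctr by auto
  have tne: "t \<noteq> f ctr" "t \<noteq> g ctr" "t \<noteq> k ctr" using W W_inj q ctrI tq by metis+
  have ne: "f \<noteq> g" "g \<noteq> k" "f \<noteq> k" using ctrs by auto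
  have T': "A g f" "A k g" "A k f" using T A_sym by (auto dest: sympD)
  define col where "col v =
    (if v = (k, \<not> b) \<or> v = (nb ctr k t, \<not> b) then f ctr
     else if v = (f, \<not> b) \<or> v = (nb ctr f t, \<not> b) then g ctr
     else if v = (g, \<not> b) \<or> v = (nb ctr g t, \<not> b) then k ctr else fst v ctr)" for v
  define ecol where "ecol u v = (if {fst u, fst v} = {f, g} then f ctr
     else if {fst u, fst v} = {g, k} then g ctr else k ctr)" for u v :: "('i \<Rightarrow> 'v) \<times> bool"
  have deep: "reaches ?X col ecol j (x, b)"
    if x: "x \<in> {f, g, k}" and j: "j \<in> V" "j \<noteq> t" "j \<noteq> x ctr"
      and c: "col (x, \<not> b) = j" "col (nb ctr x t, \<not> b) = j" for x j
  proof -
    have xW: "x \<in> W" and xq: "x q = t" using x W tq by auto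
    note path = nb_nb_path[OF xW q j(1), unfolded xq, OF j(2,3)]
    let ?y = "nb ctr (nb ctr x t) j"
    have "x ctr \<noteq> t" using x tne by auto
    then have "?y \<noteq> f" "?y \<noteq> g" "?y \<noteq> k" "?y \<noteq> nb ctr f t" "?y \<noteq> nb ctr g t" "?y \<noteq> nb ctr k t"
      using path(4) tq j by (metis nb_ctr)+
    then have cy: "col (?y, \<not> b) = j" by (simp add: col_def)
    have "packing_edge E ?X col ecol j (x, b) (x, \<not> b)"
      using x c xW by (intro packing_edgeI) auto
    moreover have "packing_edge E ?X col ecol j (x, \<not> b) (nb ctr x t, \<not> b)"
      using path c by (intro packing_edgeI) auto
    moreover have "packing_edge E ?X col ecol j (nb ctr x t, \<not> b) (?y, \<not> b)"
      using path c cy by (intro packing_edgeI) auto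
    moreover have "reaches ?X col ecol j (?y, \<not> b)"
      using cy path A_W by (intro reaches_end) auto
    ultimately show ?thesis by (meson reaches_step)
  qed
  have along: "reaches ?X col ecol (y ctr) (x, b)"
    if "x \<in> {f, g, k}" "y \<in> {f, g, k}" "A x y" "ecol (x, b) (y, b) = y ctr" for x y
  proof (rule reaches_step)
    show "packing_edge E ?X col ecol (y ctr) (x, b) (y, b)"
      using that by (intro packing_edgeI) auto
    show "reaches ?X col ecol (y ctr) (y, b)" using that W by (intro reaches_self) auto
  qed
  have plain: "reaches ?X col ecol j (x, b)"
    if x: "x \<in> {f, g, k}" and j: "j \<in> V" "j \<noteq> f ctr" "j \<noteq> g ctr" "j \<noteq> k ctr" for x j
  proof (rule reaches_nb)
    show "x \<in> W" "j \<in> V" "j \<noteq> x ctr" "(x, b) \<in> ?X" using x j W by auto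
    show "(nb ctr x j, b) \<notin> ?X" using j by (metis Pair_inject empty_iff insertE nb_ctr)
    show "col (nb ctr x j, b) = j" by (simp add: col_def)
  qed
  have sep: "nb ctr f t \<noteq> nb ctr g t" "nb ctr g t \<noteq> nb ctr k t" "nb ctr f t \<noteq> nb ctr k t"
    using exit_props(2)[OF _ q] W tq ctrs by metis+
  have sep2: "nb ctr x t \<noteq> f" "nb ctr x t \<noteq> g" "nb ctr x t \<noteq> k" for x
    using tne by (metis nb_ctr)+
  note sepc = sep sep[symmetric] sep2 sep2[symmetric] ne ne[symmetric]
  have V: "f ctr \<in> V" "g ctr \<in> V" "k ctr \<in> V" using W W_ctr by auto
  have f: "reaches ?X col ecol j (f, b)" if j: "j \<in> V" for j
  proof -
    consider "j = f ctr" | "j = g ctr" | "j = k ctr" | "j \<noteq> f ctr" "j \<noteq> g ctr" "j \<noteq> k ctr" by blast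
    then show ?thesis
    proof cases
      case 1
      then show ?thesis using W by (intro reaches_self) auto
    next
      case 2
      then show ?thesis using j ctrs tne sepc by (intro deep) (auto simp: col_def)
    next
      case 3
      then show ?thesis using along[of f k] T ne by (auto simp: ecol_def doubleton_eq_iff)
    qed (use plain j in auto)
  qed
  have g: "reaches ?X col ecol j (g, b)" if j: "j \<in> V" for j
  proof -
    consider "j = g ctr" | "j = k ctr" | "j = f ctr" | "j \<noteq> f ctr" "j \<noteq> g ctr" "j \<noteq> k ctr" by blast
    then show ?thesis
    proof cases
      case 1
      then show ?thesis using W by (intro reaches_self) auto
    next
      case 2
      then show ?thesis using j ctrs tne sepc by (intro deep) (auto simp: col_def)
    next
      case 3
      then show ?thesis using along[of g f] T' ne by (auto simp: ecol_def doubleton_eq_iff)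
    qed (use plain j in auto)
  qed
  have k: "reaches ?X col ecol j (k, b)" if j: "j \<in> V" for j
  proof -
    consider "j = k ctr" | "j = f ctr" | "j = g ctr" | "j \<noteq> f ctr" "j \<noteq> g ctr" "j \<noteq> k ctr" by blast
    then show ?thesis
    proof cases
      case 1
      then show ?thesis using W by (intro reaches_self) auto
    next
      case 2
      then show ?thesis using j ctrs tne sepc by (intro deep) (auto simp: col_def)
    next
      case 3
      then show ?thesis using along[of k g] T' ne by (auto simp: ecol_def doubleton_eq_iff)
    qed (use plain j in auto)
  qed
  show ?thesis
    by (rule all_armsI[of ecol ?X col]) (use f g k in \<open>auto simp: ecol_def insert_commute\<close>)
qed

text \<open>The vertices over \<open>f\<close> and \<open>g\<close> in the layer of \<open>k\<close>
  exchange their colours: \<open>f\<close> and \<open>g\<close> climb to their own, \<open>k\<close>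
  is adjacent to both, and all three continue by the detour through \<open>q\<close>.\<close>

lemma all_arms_triangle_two_layers:
  assumes q: "q \<in> I" "q \<noteq> ctr" and T: "A f g" "A g k" "A f k"
  shows "all_arms {(f, b), (g, b), (k, \<not> b)}"
proof -
  let ?X = "{(f, b), (g, b), (k, \<not> b)}"
  have W: "f \<in> W" "g \<in> W" "k \<in> W" using T A_W by auto
  define t where "t = f q"
  have tq: "g q = t" "k q = t" "f q = t" using triangle_agree[OF T q] by (auto simp: t_def)
  have ctrs: "f ctr \<noteq> g ctr" "g ctr \<noteq> k ctr" "f ctr \<noteq> k ctr" using T A_ctr by auto
  have tne: "t \<noteq> f ctr" "t \<noteq> g ctr" "t \<noteq> k ctr" using W W_inj q ctrI tq by metis+
  have ne: "f \<noteq> g" "g \<noteq> k" "f \<noteq> k" using ctrs by auto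
  have T': "A g f" "A k g" "A k f" using T A_sym by (auto dest: sympD)
  define col where "col v =
    (if v = (f, \<not> b) \<or> v = (nb ctr f t, \<not> b) then g ctr
     else if v = (g, \<not> b) \<or> v = (nb ctr g t, \<not> b) then f ctr else fst v ctr)" for v
  \<comment> \<open>A default value: the arms built below run along no edge between two members of
    \<open>?X\<close>.\<close>
  define ecol where "ecol u v = t" for u v :: "('i \<Rightarrow> 'v) \<times> bool"
  have sep: "nb ctr f t \<noteq> nb ctr g t" "nb ctr g t \<noteq> nb ctr k t" "nb ctr f t \<noteq> nb ctr k t"
    using exit_props(2)[OF _ q] W tq ctrs by metis+
  have sep2: "nb ctr x t \<noteq> f" "nb ctr x t \<noteq> g" "nb ctr x t \<noteq> k" for x
    using tne by (metis nb_ctr)+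
  note sepc = sep sep[symmetric] sep2 sep2[symmetric] ne ne[symmetric]
  have V: "f ctr \<in> V" "g ctr \<in> V" "k ctr \<in> V" using W W_ctr by auto
  have deep: "reaches ?X col ecol j (x, \<not> b)"
    if x: "x \<in> {f, g}" and j: "j \<in> V" "j \<noteq> t" "j \<noteq> x ctr"
      and c: "col (x, \<not> b) = j" "col (nb ctr x t, \<not> b) = j" for x j
  proof -
    have xW: "x \<in> W" and xq: "x q = t" using x W tq by auto
    note path = nb_nb_path[OF xW q j(1), unfolded xq, OF j(2,3)]
    let ?y = "nb ctr (nb ctr x t) j"
    have "x ctr \<noteq> t" using x tne by auto
    then have "?y \<noteq> f" "?y \<noteq> g" "?y \<noteq> k" "?y \<noteq> nb ctr f t" "?y \<noteq> nb ctr g t" "?y \<noteq> nb ctr k t"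
      using path(4) tq j by (metis nb_ctr)+
    then have cy: "col (?y, \<not> b) = j" "(?y, \<not> b) \<notin> ?X" by (auto simp: col_def)
    have xX: "(x, \<not> b) \<notin> ?X" "(nb ctr x t, \<not> b) \<notin> ?X" using x sepc by auto
    have "packing_edge E ?X col ecol j (x, \<not> b) (nb ctr x t, \<not> b)"
      using path c xX by (intro packing_edgeI) auto
    moreover have "packing_edge E ?X col ecol j (nb ctr x t, \<not> b) (?y, \<not> b)"
      using path c cy xX by (intro packing_edgeI) auto
    moreover have "reaches ?X col ecol j (?y, \<not> b)"
      using cy path A_W by (intro reaches_end) auto
    ultimately show ?thesis by (meson reaches_step)
  qed
  have colfg: "col (f, \<not> b) = g ctr" "col (nb ctr f t, \<not> b) = g ctr"
    "col (g, \<not> b) = f ctr" "col (nb ctr g t, \<not> b) = f ctr" using sepc by (auto simp: col_def)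
  have deepf: "reaches ?X col ecol (g ctr) (f, \<not> b)" and deepg: "reaches ?X col ecol (f ctr) (g, \<not> b)"
    using deep[of f "g ctr"] deep[of g "f ctr"] colfg V ctrs tne by auto
  have flip: "reaches ?X col ecol j (x, b)"
    if "x \<in> {f, g}" "col (x, \<not> b) = j" "reaches ?X col ecol j (x, \<not> b)" for x j
  proof (rule reaches_step)
    show "packing_edge E ?X col ecol j (x, b) (x, \<not> b)"
      using that W ne by (intro packing_edgeI) auto
  qed fact
  have k_via: "reaches ?X col ecol j (k, \<not> b)"
    if "x \<in> {f, g}" "col (x, \<not> b) = j" "reaches ?X col ecol j (x, \<not> b)" for x j
  proof (rule reaches_step)
    show "packing_edge E ?X col ecol j (k, \<not> b) (x, \<not> b)"
      using that W ne T' by (intro packing_edgeI) auto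
  qed fact
  have main: "reaches ?X col ecol j x" if x: "x \<in> ?X" and j: "j \<in> V" for x j
  proof -
    have plain: ?thesis if "j \<noteq> fst x ctr" "(nb ctr (fst x) j, snd x) \<notin> ?X"
      "col (nb ctr (fst x) j, snd x) = j"
      using reaches_nb[of "fst x" j "snd x" ?X col ecol] j that x W by auto
    have pl: "col (nb ctr k j, \<not> b) = j" if "j \<noteq> f ctr" "j \<noteq> g ctr"
    proof -
      have "nb ctr k j \<noteq> f" "nb ctr k j \<noteq> g" using that by auto
      moreover have "nb ctr k j \<noteq> nb ctr f t" "nb ctr k j \<noteq> nb ctr g t"
        using sep nb_eqD[of ctr k j f t] nb_eqD[of ctr k j g t] by auto
      ultimately show ?thesis by (simp add: col_def)
    qed
    consider "j = fst x ctr" | "x = (f, b)" "j = g ctr" | "x = (g, b)" "j = f ctr"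
      | "x = (k, \<not> b)" "j = f ctr" | "x = (k, \<not> b)" "j = g ctr"
      | "x = (f, b)" "j \<noteq> f ctr" "j \<noteq> g ctr" | "x = (g, b)" "j \<noteq> f ctr" "j \<noteq> g ctr"
      | "x = (k, \<not> b)" "j \<noteq> f ctr" "j \<noteq> g ctr" "j \<noteq> k ctr"
      using x by (elim insertE emptyE; hypsubst; simp; blast)
    then show ?thesis
    proof cases
      case 1
      then show ?thesis using x W by (intro reaches_self) auto
    next
      case 2
      then show ?thesis using flip[of f] colfg deepf by simp
    next
      case 3
      then show ?thesis using flip[of g] colfg deepg by simp
    next
      case 4
      then show ?thesis using k_via[of g] colfg deepg by simp
    next
      case 5
      then show ?thesis using k_via[of f] colfg deepf by simp
    next
      case 6
      then show ?thesis by (intro plain) (auto simp: col_def dest: arg_cong[of _ _ "\<lambda>f. f ctr"])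
    next
      case 7
      then show ?thesis by (intro plain) (auto simp: col_def dest: arg_cong[of _ _ "\<lambda>f. f ctr"])
    next
      case 8
      then show ?thesis using pl by (intro plain) (auto dest: arg_cong[of _ _ "\<lambda>f. f ctr"])
    qed
  qed
  show ?thesis by (rule all_armsI[of ecol ?X col]) (use main in \<open>auto simp: ecol_def\<close>)
qed

text \<open>The same-layer edges inside \<open>X\<close> form a star unless \<open>X\<close> is a
  triangle in one layer. When the third point lies in the other layer, the side condition of
  \<open>all_arms_star\<close> fails for both ends of the edge only if that point lies over a common
  neighbour of them.\<close>

lemma all_arms_upto3:
  assumes q: "q \<in> I" "q \<noteq> ctr" and X: "finite X" "card X \<le> 3" "fst ` X \<subseteq> W"
  shows "all_arms X"
proof (cases "\<exists>f g b. (f, b) \<in> X \<and> (g, b) \<in> X \<and> A f g")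
  case False
  obtain g where "g \<in> W" using W_nonempty by blast
  show ?thesis
  proof (cases "X = {}")
    case True
    then show ?thesis by (intro all_armsI[of "\<lambda>_ _. undefined"]) auto
  next
    case nonempty: False
    then obtain g b where "(g, b) \<in> X" by auto
    then show ?thesis using False X(3) by (intro all_arms_star[of X g b]) force+
  qed
next
  case True
  then obtain f g b where fg: "(f, b) \<in> X" "(g, b) \<in> X" "A f g" by blast
  have W: "f \<in> W" "g \<in> W" using fg A_W by auto
  have ne: "f \<noteq> g" using fg A_ctr by blast
  have Agf: "A g f" using fg A_sym by (auto dest: sympD)
  have irr: "\<not> A x x" for x using A_ctr by blast
  have "card (X - {(f, b), (g, b)}) \<le> 1" using X fg ne by (simp add: card_Diff_subset)
  then have one: "\<forall>u\<in>X - {(f, b), (g, b)}. \<forall>v\<in>X - {(f, b), (g, b)}. u = v"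
    unfolding One_nat_def card_le_Suc0_iff_eq[OF finite_Diff[OF X(1)]] .
  obtain z where z: "X \<subseteq> {(f, b), (g, b), z}"
  proof (cases "X - {(f, b), (g, b)} = {}")
    case True
    then show ?thesis using that[of "(f, b)"] by blast
  next
    case False
    then obtain z where "z \<in> X - {(f, b), (g, b)}" by blast
    then show ?thesis using that[of z] one by blast
  qed
  show ?thesis
  proof (cases "z \<in> X \<and> z \<noteq> (f, b) \<and> z \<noteq> (g, b)")
    case False
    then have "X = {(f, b), (g, b)}" using z fg by blast
    then show ?thesis using W irr by (intro all_arms_star[of X g b]) auto
  next
    case True
    obtain k b' where k: "z = (k, b')" by fastforce
    have Xeq: "X = {(f, b), (g, b), (k, b')}" using True z fg k by blast
    show ?thesis
    proof (cases "b' = b")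
      case True
      consider "A g k" "A f k" | "\<not> A f k" "\<not> A k f" | "\<not> A g k" "\<not> A k g"
        using A_sym by (auto dest: sympD)
      then show ?thesis
      proof cases
        case 1
        then show ?thesis using all_arms_triangle[OF q fg(3)] Xeq \<open>b' = b\<close> by simp
      next
        case 2
        show ?thesis
        proof (rule all_arms_star[of X g b])
          fix u w b'' assume "(u, b'') \<in> X" "(w, b'') \<in> X" "A u w"
          then show "b'' = b \<and> (u = g \<or> w = g)"
            unfolding Xeq using 2 irr \<open>b' = b\<close> by (elim insertE emptyE) auto
        qed (use W X(3) Xeq \<open>b' = b\<close> in auto)
      next
        case 3
        show ?thesis
        proof (rule all_arms_star[of X f b])
          fix u w b'' assume "(u, b'') \<in> X" "(w, b'') \<in> X" "A u w"
          then show "b'' = b \<and> (u = f \<or> w = f)"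
            unfolding Xeq using 3 irr \<open>b' = b\<close> by (elim insertE emptyE) auto
        qed (use W X(3) Xeq \<open>b' = b\<close> in auto)
      qed
    next
      case False
      then have b': "b' = (\<not> b)" by blast
      have kW: "k \<in> W" using X(3) Xeq by auto
      consider "nb ctr k (f ctr) = f \<Longrightarrow> k = f" | "nb ctr k (g ctr) = g \<Longrightarrow> k = g"
        | "nb ctr k (f ctr) = f" "k \<noteq> f" "nb ctr k (g ctr) = g" "k \<noteq> g" by blast
      then show ?thesis
      proof cases
        case 1
        show ?thesis
        proof (rule all_arms_star[of X g b])
          fix u w b'' assume "(u, b'') \<in> X" "(w, b'') \<in> X" "A u w"
          then show "b'' = b \<and> (u = g \<or> w = g)"
            unfolding Xeq using irr b' by (elim insertE emptyE) auto
        next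
          fix k' l assume "(k', \<not> b) \<in> X" "(l, b) \<in> X" "A g l" "nb ctr k' (l ctr) = l"
          moreover from this have "k' = k" "l = f" unfolding Xeq using irr b' by auto
          ultimately show "k' = l" using 1 by blast
        qed (use W X(3) in auto)
      next
        case 2
        show ?thesis
        proof (rule all_arms_star[of X f b])
          fix u w b'' assume "(u, b'') \<in> X" "(w, b'') \<in> X" "A u w"
          then show "b'' = b \<and> (u = f \<or> w = f)"
            unfolding Xeq using irr b' by (elim insertE emptyE) auto
        next
          fix k' l assume "(k', \<not> b) \<in> X" "(l, b) \<in> X" "A f l" "nb ctr k' (l ctr) = l"
          moreover from this have "k' = k" "l = g" unfolding Xeq using irr b' by auto
          ultimately show "k' = l" using 2 by blast
        qed (use W X(3) in auto)
      next
        case 3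
        then have "A k f" "A k g" using kW W by (auto simp: A_def)
        then have "A g k" "A f k" using A_sym by (auto dest: sympD)
        then show ?thesis using all_arms_triangle_two_layers[OF q fg(3)] Xeq b' by simp
      qed
    qed
  qed
qed

end

lemma lift_layer:
  assumes "(inside R B)\<^sup>*\<^sup>* f g" "\<And>x y. x \<in> B \<Longrightarrow> y \<in> B \<Longrightarrow> R x y \<Longrightarrow> Q (x, b) (y, b)"
  shows "Q\<^sup>*\<^sup>* (f, b) (g, b)"
  using assms(1)
proof (induction rule: rtranclp_induct)
  case (step y z)
  then have "Q (y, b) (z, b)" using assms(2) by (simp add: inside_def)
  then show ?case using step.IH by (rule rtranclp.rtrancl_into_rtrancl[rotated])
qed simp

section \<open>Connected cores in a copy that holds two members of the set\<close>

context star
begin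

text \<open>\<open>K\<close> is the part of a copy that belongs to the tree named after this copy,
  coloured \<open>c\<close> for the moment. It has to contain every vertex with centre value
  \<open>c\<close>, because the arms coming from copy \<open>c\<close> enter there.\<close>

definition core_data :: "(('i \<Rightarrow> 'v) \<times> bool) set \<Rightarrow> 'v \<Rightarrow> bool" where
  "core_data Z c \<longleftrightarrow> (\<exists>col ecol K. (\<forall>u v. ecol u v = ecol v u) \<and> Z \<subseteq> K \<and>
     (\<forall>u\<in>K. fst u \<in> W \<and> (u \<in> Z \<or> col u = c)) \<and>
     (\<forall>u\<in>K. \<forall>v\<in>K. (packing_edge E Z col ecol c)\<^sup>*\<^sup>* u v) \<and>
     (\<forall>f\<in>W. \<forall>b. f ctr = c \<longrightarrow> (f, b) \<in> K) \<and>
     (\<forall>z\<in>Z. \<forall>j\<in>V - {c}. reaches Z col ecol j z))"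

lemma core_dataI:
  assumes "\<And>u v. ecol u v = ecol v u" "Z \<subseteq> K"
    "\<And>u. u \<in> K \<Longrightarrow> fst u \<in> W" "\<And>u. u \<in> K \<Longrightarrow> u \<in> Z \<or> col u = c"
    "\<And>u. u \<in> K \<Longrightarrow> (packing_edge E Z col ecol c)\<^sup>*\<^sup>* u r"
    "\<And>f b. f \<in> W \<Longrightarrow> f ctr = c \<Longrightarrow> (f, b) \<in> K"
    "\<And>z j. z \<in> Z \<Longrightarrow> j \<in> V - {c} \<Longrightarrow> reaches Z col ecol j z"
  shows "core_data Z c"
proof -
  have "symp (packing_edge E Z col ecol c)" by (rule packing_edge_sym[OF E_sym]) (rule assms(1))
  then have "(packing_edge E Z col ecol c)\<^sup>*\<^sup>* u v" if "u \<in> K" "v \<in> K" for u v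
    using assms(5)[OF that(1)] assms(5)[OF that(2)] by (meson rtranclp_symp rtranclp_trans)
  then show ?thesis unfolding core_data_def
    by (intro exI[of _ col] exI[of _ ecol] exI[of _ K] conjI ballI allI impI) (use assms in \<open>auto simp del: split_paired_All\<close>)
qed

text \<open>Each member sends its arms to its neighbours with centre value other than
  \<open>c\<close>, and the rest of each layer stays connected. In the excluded case both members
  lose all neighbours in their layers and are left with each other only.\<close>

lemma core_data_two_layers:
  assumes p: "p \<in> I" "p \<noteq> ctr" and W: "f \<in> W" "g \<in> W" and c: "c \<in> V"
    and ne: "\<not> (f = g \<and> f ctr = c)"
  shows "core_data {(f, b), (g, \<not> b)} c"
proof -
  let ?Z = "{(f, b), (g, \<not> b)}"
  define N where "N x = {nb ctr x j | j. j \<in> V - {c}}" for x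
  define col where "col v = (if fst v \<in> N (if snd v = b then f else g) then fst v ctr else c)"
    for v :: "('i \<Rightarrow> 'v) \<times> bool"
  define ecol where "ecol u v = c" for u v :: "('i \<Rightarrow> 'v) \<times> bool"
  define R where "R x = W - insert x (N x)" for x
  define K where "K = {(x, b) | x. x \<in> R f} \<union> {(x, \<not> b) | x. x \<in> R g} \<union> ?Z"
  have ctrN: "x ctr \<noteq> c" if "x \<in> N y" for x y using that by (auto simp: N_def)
  have linkR: "linked A (R x)" if "x \<in> W" for x
    unfolding R_def
  proof (rule linked_minus_closed_neighbourhood[OF p that])
    have "x = nb ctr x (x ctr)" by simp
    then have "x \<in> {nb ctr x j | j. j \<in> V}" using W_ctr[OF that] by blast
    then show "insert x (N x) \<subseteq> {nb ctr x j | j. j \<in> V}" by (auto simp: N_def)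
  qed simp
  have colK: "u \<in> ?Z \<or> col u = c" if "u \<in> K" for u using that by (auto simp: K_def R_def col_def)
  have KW: "fst u \<in> W" if "u \<in> K" for u using that W by (auto simp: K_def R_def)
  have edge: "packing_edge E ?Z col ecol c u v" if "E u v" "u \<in> K" "v \<in> K" for u v
    using that colK by (intro packing_edgeI) (auto simp: ecol_def)
  have "card V \<ge> 4"
  proof -
    have "card {ctr, p} \<le> card I" using p ctrI finI by (intro card_mono) auto
    then show ?thesis using cardV p by simp
  qed
  moreover have "card {f p, g p, c} \<le> 3" by (simp add: card_insert_if)
  ultimately have "\<not> V \<subseteq> {f p, g p, c}" using card_mono[of "{f p, g p, c}" V] by auto
  \<comment> \<open>The value \<open>y\<close> at \<open>p\<close> keeps \<open>r\<close> different
    from \<open>f\<close> and \<open>g\<close>, and the centre value \<open>c\<close> keeps it off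
    the arms. So \<open>r\<close> is free in both layers and joins them.\<close>
  then obtain y where y: "y \<in> V" "y \<noteq> f p" "y \<noteq> g p" "y \<noteq> c" by blast
  obtain r where r: "r \<in> W" "r ctr = c" "r p = y" using W_ex2[OF c y(1) _ p] y by metis
  have rR: "r \<in> R f" "r \<in> R g" using r y ctrN by (auto simp: R_def)
  let ?P = "\<lambda>u. (packing_edge E ?Z col ecol c)\<^sup>*\<^sup>* u (r, b)"
  have Pf: "?P (x, b)" if "x \<in> R f" for x
    by (rule lift_layer[OF linkedD[OF linkR[OF W(1)] that rR(1)]])
      (intro edge; auto simp: K_def)
  have Pg: "?P (x, \<not> b)" if "x \<in> R g" for x
  proof -
    have "(packing_edge E ?Z col ecol c)\<^sup>*\<^sup>* (x, \<not> b) (r, \<not> b)"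
      by (rule lift_layer[OF linkedD[OF linkR[OF W(2)] that rR(2)]])
        (intro edge; auto simp: K_def)
    moreover have "packing_edge E ?Z col ecol c (r, \<not> b) (r, b)"
      using rR r by (intro edge) (auto simp: K_def)
    ultimately show ?thesis by (rule rtranclp.rtrancl_into_rtrancl)
  qed
  have step: "?P u" if "E u v" "u \<in> K" "v \<in> K" "?P v" for u v
    using edge[OF that(1-3)] that(4) by (rule converse_rtranclp_into_rtranclp)
  have Rc: "nb ctr x c \<in> R x" if "x \<in> W" "x ctr \<noteq> c" for x
    using that W_nb[OF that(1) c] ctrN[of "nb ctr x c"] by (auto simp: R_def dest: arg_cong[of _ _ "\<lambda>f. f ctr"])
  have Pz: "?P (f, b)"
  proof (cases "f ctr = c")
    case True
    \<comment> \<open>All neighbours of \<open>f\<close> in its layer belong to arms now. The way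
      into the core is the same function in the other layer, which \<open>ne\<close> keeps
      free.\<close>
    then have "f \<in> R g" using ne W ctrN by (auto simp: R_def)
    then show ?thesis using step[of "(f, b)" "(f, \<not> b)"] Pg W by (auto simp: K_def)
  next
    case False
    then show ?thesis using step[of "(f, b)" "(nb ctr f c, b)"] Rc[OF W(1)] Pf A_nb[OF W(1) c] W
      by (auto simp: K_def)
  qed
  have Pw: "?P (g, \<not> b)"
  proof (cases "g ctr = c")
    case True
    then have "g \<in> R f" using ne W ctrN by (auto simp: R_def)
    then show ?thesis using step[of "(g, \<not> b)" "(g, b)"] Pf W by (auto simp: K_def)
  next
    case False
    then show ?thesis using step[of "(g, \<not> b)" "(nb ctr g c, \<not> b)"] Rc[OF W(2)] Pg A_nb[OF W(2) c] W
      by (auto simp: K_def)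
  qed
  show ?thesis
  proof (rule core_dataI[of ecol ?Z K col c "(r, b)"])
    show "?P u" if "u \<in> K" for u using that Pf Pg Pz Pw by (auto simp: K_def)
    show "(x, b') \<in> K" if "x \<in> W" "x ctr = c" for x b'
      using that ctrN by (cases "b' = b") (auto simp: K_def R_def)
    show "reaches ?Z col ecol j z" if z: "z \<in> ?Z" and j: "j \<in> V - {c}" for z j
    proof (cases "j = fst z ctr")
      case True
      then show ?thesis using z W by (intro reaches_self) auto
    next
      case False
      have "nb ctr (fst z) j \<noteq> fst z" using False by (metis nb_ctr)
      then have "(nb ctr (fst z) j, snd z) \<notin> ?Z" using z by auto
      moreover have "col (nb ctr (fst z) j, snd z) = j" using z j by (auto simp: col_def N_def)
      ultimately show ?thesis using reaches_nb[of "fst z" j "snd z" ?Z col ecol] z j False W by auto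
    qed
  qed (use KW colK in \<open>auto simp: ecol_def K_def\<close>)
qed

text \<open>Usually the arms stay in layer \<open>b\<close>, and the untouched other layer holds the
  core together. Only for an adjacent pair with both centre values different from \<open>c\<close>
  does the common edge have to serve two arms; one of them moves to the other layer, which remains
  connected after losing \<open>f\<close> and \<open>g\<close>.\<close>

lemma core_data_one_layer:
  assumes p: "p \<in> I" "p \<noteq> ctr" and W: "f \<in> W" "g \<in> W" and c: "c \<in> V"
  shows "core_data {(f, b), (g, b)} c"
proof -
  let ?Z = "{(f, b), (g, b)}"
  define N where "N = {nb ctr x j | x j. x \<in> {f, g} \<and> j \<in> V - {c}}"
  have ctrN: "x ctr \<noteq> c" if "x \<in> N" for x using that by (auto simp: N_def)
  have irr: "\<not> A x x" for x using A_ctr by blast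
  obtain r where r: "r \<in> W" "r ctr = c" using W_ex1 c by blast
  show ?thesis
  proof (cases "A f g \<and> f ctr \<noteq> c \<and> g ctr \<noteq> c")
    case False
    define col where "col v = (if snd v = b \<and> fst v \<in> N then fst v ctr else c)"
      for v :: "('i \<Rightarrow> 'v) \<times> bool"
    \<comment> \<open>If the pair is adjacent, one of the centre values is \<open>c\<close>, which
      needs no arm; the edge goes to the colour of the other.\<close>
    define ecol where "ecol u v = (if f ctr = c then g ctr else f ctr)" for u v :: "('i \<Rightarrow> 'v) \<times> bool"
    define K where "K = {v. fst v \<in> W \<and> (v \<in> ?Z \<or> snd v = (\<not> b) \<or> fst v \<notin> N)}"
    have colK: "u \<in> ?Z \<or> col u = c" if "u \<in> K" for u using that by (auto simp: K_def col_def)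
    have edge: "packing_edge E ?Z col ecol c u v" if "E u v" "u \<in> K" "v \<in> K" "snd u = (\<not> b) \<or> snd v = (\<not> b)" for u v
      using that colK by (intro packing_edgeI) auto
    let ?P = "\<lambda>u. (packing_edge E ?Z col ecol c)\<^sup>*\<^sup>* u (r, \<not> b)"
    have P1: "?P (x, \<not> b)" if "x \<in> W" for x
      by (rule lift_layer[OF linkedD[OF star_linked[OF star_axioms] that r(1)]])
        (intro edge; auto simp: K_def)
    have P: "?P u" if u: "u \<in> K" for u
    proof (cases "snd u = b")
      case True
      then have "packing_edge E ?Z col ecol c u (fst u, \<not> b)"
        using u by (intro edge) (auto simp: K_def E_def)
      moreover have "?P (fst u, \<not> b)" using P1 u by (auto simp: K_def)
      ultimately show ?thesis by (rule converse_rtranclp_into_rtranclp)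
    next
      case False
      then show ?thesis using P1[of "fst u"] u by (cases u) (auto simp: K_def)
    qed
    show ?thesis
    proof (rule core_dataI[of ecol ?Z K col c "(r, \<not> b)"])
      show "?P u" if "u \<in> K" for u using P that .
      show "reaches ?Z col ecol j z" if z: "z \<in> ?Z" and j: "j \<in> V - {c}" for z j
      proof (cases "j = fst z ctr")
        case True
        then show ?thesis using z W by (intro reaches_self) auto
      next
        case nself: False
        have zW: "fst z \<in> W" "snd z = b" using z W by auto
        have Az: "A (fst z) (nb ctr (fst z) j)" using A_nb[OF zW(1)] j nself by auto
        show ?thesis
        proof (cases "(nb ctr (fst z) j, b) \<in> ?Z")
          case True
          have "nb ctr (fst z) j \<noteq> fst z" using nself by (metis nb_ctr)
          then have or: "fst z = f \<and> nb ctr (fst z) j = g \<or> fst z = g \<and> nb ctr (fst z) j = f"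
            using True z by (cases z) auto
          then have "A f g" using Az A_sym by (auto dest: sympD)
          then have "f ctr = c \<or> g ctr = c" "f ctr \<noteq> g ctr" using False A_ctr by auto
          moreover have "j = g ctr \<and> fst z = f \<or> j = f ctr \<and> fst z = g" using or by (metis nb_ctr)
          ultimately have "ecol z (nb ctr (fst z) j, b) = j" using j by (auto simp: ecol_def)
          then have "packing_edge E ?Z col ecol j z (nb ctr (fst z) j, b)"
            using True z Az zW by (intro packing_edgeI) (auto simp: E_def)
          moreover have "reaches ?Z col ecol j (nb ctr (fst z) j, b)"
            using True W by (intro reaches_self) auto
          ultimately show ?thesis by (rule reaches_step)
        next
          case nZ: False
          have "fst z \<in> {f, g}" using z by auto
          then have "nb ctr (fst z) j \<in> N" unfolding N_def using j by blast
          then have "col (nb ctr (fst z) j, snd z) = j" using zW by (simp add: col_def)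
          then show ?thesis using reaches_nb[of "fst z" j "snd z" ?Z col ecol] z j nself W nZ by auto
        qed
      qed
    qed (use W colK ctrN in \<open>auto simp: ecol_def K_def\<close>)
  next
    case True
    then have T: "A f g" "f ctr \<noteq> c" "g ctr \<noteq> c" "A g f" using A_sym by (auto dest: sympD)
    have ne: "f \<noteq> g" using T irr by blast
    define col where "col v = (if v \<in> {(f, \<not> b), (g, \<not> b)} then f ctr
       else if snd v = b \<and> fst v \<in> N then fst v ctr else c)" for v
    define ecol where "ecol u v = g ctr" for u v :: "('i \<Rightarrow> 'v) \<times> bool"
    define K where "K = {v. fst v \<in> W \<and> (v \<in> ?Z \<or> snd v = (\<not> b) \<and> fst v \<notin> {f, g} \<or> snd v = b \<and> fst v \<notin> N)}"
    have "f = nb ctr f (f ctr)" "g = nb ctr g (g ctr)" by simp_all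
    then have fgN: "f \<in> N" "g \<in> N"
      unfolding N_def using T W_ctr W by blast+
    have colK: "u \<in> ?Z \<or> col u = c" if "u \<in> K" for u
      using that by (cases u) (auto simp: K_def col_def)
    have edge: "packing_edge E ?Z col ecol c u v" if "E u v" "u \<in> K" "v \<in> K" "u \<notin> ?Z \<or> v \<notin> ?Z" for u v
      using that colK by (intro packing_edgeI) auto
    have "linked A (W - {f, g})"
    proof (rule linked_minus_closed_neighbourhood[OF p W(1)])
      have "f = nb ctr f (f ctr)" "g = nb ctr f (g ctr)" using A_eq[OF T(1)] by auto
      then show "{f, g} \<subseteq> {nb ctr f j | j. j \<in> V}" using W W_ctr by blast
    qed simp
    note link = linkedD[OF this]
    have rfg: "r \<noteq> f" "r \<noteq> g" using r T by auto
    let ?P = "\<lambda>u. (packing_edge E ?Z col ecol c)\<^sup>*\<^sup>* u (r, \<not> b)"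
    have P1: "?P (x, \<not> b)" if "x \<in> W" "x \<noteq> f" "x \<noteq> g" for x
    proof (rule lift_layer[OF link])
      show "x \<in> W - {f, g}" "r \<in> W - {f, g}" using that r rfg by auto
      fix y y' assume "y \<in> W - {f, g}" "y' \<in> W - {f, g}" "A y y'"
      then show "packing_edge E ?Z col ecol c (y, \<not> b) (y', \<not> b)"
        by (intro edge) (auto simp: K_def)
    qed
    have P2: "?P (x, b)" if "x \<in> W" "x \<notin> N" for x
    proof -
      have x: "x \<noteq> f" "x \<noteq> g" using that fgN by auto
      have "packing_edge E ?Z col ecol c (x, b) (x, \<not> b)"
        using that x by (intro edge) (auto simp: K_def)
      then show ?thesis using P1[OF that(1) x] by (rule converse_rtranclp_into_rtranclp)
    qed
    have P3: "?P (x, b)" if x: "x \<in> {f, g}" for x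
    proof -
      have xW: "x \<in> W" "x ctr \<noteq> c" using x W T by auto
      have y: "nb ctr x c \<in> W" "nb ctr x c \<notin> N" "nb ctr x c \<notin> {f, g}" using W_nb[OF xW(1) c] ctrN[of "nb ctr x c"] T by auto
      have "packing_edge E ?Z col ecol c (x, b) (nb ctr x c, b)"
        using x xW y A_nb[OF xW(1) c] by (intro edge) (auto simp: K_def)
      then show ?thesis using P2[OF y(1,2)] by (rule converse_rtranclp_into_rtranclp)
    qed
    show ?thesis
    proof (rule core_dataI[of ecol ?Z K col c "(r, \<not> b)"])
      show "?P u" if "u \<in> K" for u
        using that P1[of "fst u"] P2[of "fst u"] P3[of "fst u"] by (cases u) (auto simp: K_def)
      show "(x, b') \<in> K" if "x \<in> W" "x ctr = c" for x b'
        using that ctrN[of x] T by (cases "b' = b") (auto simp: K_def)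
      have colf: "col (f, \<not> b) = f ctr" "col (g, \<not> b) = f ctr" by (auto simp: col_def)
      have g_side: "reaches ?Z col ecol (f ctr) (g, b)"
      proof -
        have "packing_edge E ?Z col ecol (f ctr) (g, b) (g, \<not> b)"
          using W colf by (intro packing_edgeI) auto
        moreover have "packing_edge E ?Z col ecol (f ctr) (g, \<not> b) (f, \<not> b)"
          using T colf by (intro packing_edgeI) auto
        moreover have "reaches ?Z col ecol (f ctr) (f, \<not> b)"
          using W colf by (intro reaches_end) auto
        ultimately show ?thesis by (meson reaches_step)
      qed
      have f_side: "reaches ?Z col ecol (g ctr) (f, b)"
      proof (rule reaches_step)
        show "packing_edge E ?Z col ecol (g ctr) (f, b) (g, b)"
          using T by (intro packing_edgeI) (auto simp: ecol_def)
        show "reaches ?Z col ecol (g ctr) (g, b)" using W by (intro reaches_self) auto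
      qed
      have plain: "reaches ?Z col ecol j (x, b)"
        if x: "x \<in> {f, g}" and j: "j \<in> V - {c}" "j \<noteq> f ctr" "j \<noteq> g ctr" for x j
      proof (rule reaches_nb)
        show "x \<in> W" "j \<in> V" "j \<noteq> x ctr" "(x, b) \<in> ?Z" using x j W by auto
        show "(nb ctr x j, b) \<notin> ?Z" using j by (metis Pair_inject empty_iff insertE nb_ctr)
        have "nb ctr x j \<in> N" unfolding N_def using x j by blast
        then show "col (nb ctr x j, b) = j" by (simp add: col_def)
      qed
      show "reaches ?Z col ecol j z" if z: "z \<in> ?Z" and j: "j \<in> V - {c}" for z j
      proof (cases "j = fst z ctr")
        case True
        then show ?thesis using z W by (intro reaches_self) auto
      next
        case False
        consider "z = (f, b)" "j = g ctr" | "z = (g, b)" "j = f ctr"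
          | "z = (f, b)" "j \<noteq> g ctr" | "z = (g, b)" "j \<noteq> f ctr" using z by blast
        then show ?thesis
        proof cases
          case 3
          then show ?thesis using plain[of f j] j False by simp
        next
          case 4
          then show ?thesis using plain[of g j] j False by simp
        qed (use g_side f_side in simp_all)
      qed
    qed (use W colK in \<open>auto simp: ecol_def K_def\<close>)
  qed
qed

text \<open>\<open>Y\<close> collects forbidden ends of arms: in the larger star their exits are
  vertices already taken by rerouted arms of another copy.\<close>

definition arms :: "(('i \<Rightarrow> 'v) \<times> bool) set \<Rightarrow> (('i \<Rightarrow> 'v) \<times> bool) set \<Rightarrow> bool" where
  "arms X Y \<longleftrightarrow> (\<exists>col ecol. (\<forall>u v. ecol u v = ecol v u) \<and>
     (\<forall>x\<in>X. \<forall>j\<in>V. \<exists>v. (packing_edge E X col ecol j)\<^sup>*\<^sup>* x v \<and> fst v \<in> W \<and> fst v ctr = j \<and>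
        (v \<in> X \<or> col v = j) \<and> v \<notin> Y))"

lemma arms_of_all_arms: "all_arms X \<Longrightarrow> arms X {}"
  unfolding all_arms_def arms_def reaches_def by simp

text \<open>An arm may be prolonged from its end to the same function in the other layer, which has
  the same centre value; \<open>Y\<close> forbids at most one of these two ends.\<close>

lemma arms_nonadjacent:
  assumes XW: "fst ` X \<subseteq> W"
    and nonadj: "\<And>u w b. (u, b) \<in> X \<Longrightarrow> (w, b) \<in> X \<Longrightarrow> \<not> A u w"
    and Y: "\<And>u b. (u, b) \<in> Y \<Longrightarrow> (u, \<not> b) \<notin> Y"
  shows "arms X Y"
proof -
  define col where "col v = fst v ctr" for v :: "('i \<Rightarrow> 'v) \<times> bool"
  define ecol where "ecol u v = (if fst u = fst v then fst u ctr else undefined)"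
    for u v :: "('i \<Rightarrow> 'v) \<times> bool"
  let ?F = "packing_edge E X col ecol"
  have "\<exists>v. (?F j)\<^sup>*\<^sup>* (f, b) v \<and> fst v \<in> W \<and> fst v ctr = j \<and> (v \<in> X \<or> col v = j) \<and> v \<notin> Y"
    if x: "(f, b) \<in> X" and j: "j \<in> V" for f b j
  proof -
    have f: "f \<in> W" using x XW by force
    have g: "nb ctr f j \<in> W" using W_nb[OF f j] .
    have 1: "(?F j)\<^sup>*\<^sup>* (f, b) (nb ctr f j, b)"
    proof (cases "j = f ctr")
      case False
      have "A f (nb ctr f j)" using A_nb[OF f j False] .
      then have "?F j (f, b) (nb ctr f j, b)"
        using x nonadj by (intro packing_edgeI) (auto simp: col_def)
      then show ?thesis by blast
    qed simp
    have "?F j (nb ctr f j, b) (nb ctr f j, \<not> b)"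
      using g by (intro packing_edgeI) (auto simp: col_def ecol_def)
    then have 2: "(?F j)\<^sup>*\<^sup>* (f, b) (nb ctr f j, \<not> b)"
      using 1 by (rule rtranclp.rtrancl_into_rtrancl[rotated])
    show ?thesis
    proof (cases "(nb ctr f j, b) \<in> Y")
      case True
      then show ?thesis using 2 g Y by (intro exI[of _ "(nb ctr f j, \<not> b)"]) (auto simp: col_def)
    next
      case False
      then show ?thesis using 1 g by (intro exI[of _ "(nb ctr f j, b)"]) (auto simp: col_def)
    qed
  qed
  then have "\<forall>x\<in>X. \<forall>j\<in>V. \<exists>v. (?F j)\<^sup>*\<^sup>* x v \<and> fst v \<in> W \<and> fst v ctr = j \<and>
      (v \<in> X \<or> col v = j) \<and> v \<notin> Y" by (metis prod.collapse)
  moreover have "\<forall>u v. ecol u v = ecol v u" by (simp add: ecol_def)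
  ultimately show ?thesis unfolding arms_def by (intro exI[of _ col] exI[of _ ecol] conjI)
qed

text \<open>The edge is given to the colour of \<open>g\<close>, for which \<open>(g, b)\<close> is
  the only end; hence the condition on \<open>a\<close>. Every other colour has an end in each
  layer.\<close>

lemma arms_adjacent_pair_aux:
  assumes fg: "A f g" and a: "\<And>w. w \<in> Y \<Longrightarrow> w = a" "fst a ctr \<noteq> g ctr"
  shows "arms {(f, b), (g, b)} Y"
proof -
  let ?X = "{(f, b), (g, b)}"
  have W: "f \<in> W" "g \<in> W" and gf: "A g f" and ne: "f \<noteq> g" and cne: "f ctr \<noteq> g ctr"
    using A_W[OF fg] sympD[OF A_sym, OF fg] A_ctr[OF fg] by auto
  define col where "col v = (if v = (g, \<not> b) then f ctr else fst v ctr)"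
    for v :: "('i \<Rightarrow> 'v) \<times> bool"
  define ecol where "ecol u v = g ctr" for u v :: "('i \<Rightarrow> 'v) \<times> bool"
  let ?F = "packing_edge E ?X col ecol"
  let ?G = "\<lambda>j x. \<exists>v. (?F j)\<^sup>*\<^sup>* x v \<and> fst v \<in> W \<and> fst v ctr = j \<and> (v \<in> ?X \<or> col v = j) \<and> v \<notin> Y"
  have fin: "?G j x" if "(?F j)\<^sup>*\<^sup>* x v" "fst v \<in> W" "fst v ctr = j" "v \<in> ?X \<or> col v = j" "v \<notin> Y" for j x v
    using that by blast
  have flipf: "?F (f ctr) (f, b) (f, \<not> b)" "?F (f ctr) (f, \<not> b) (f, b)"
    using W ne by (auto intro!: packing_edgeI simp: col_def)
  have gback: "(?F (f ctr))\<^sup>*\<^sup>* (g, b) (f, \<not> b)"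
  proof -
    have "?F (f ctr) (g, b) (g, \<not> b)" using W by (intro packing_edgeI) (auto simp: col_def)
    moreover have "?F (f ctr) (g, \<not> b) (f, \<not> b)" using gf ne by (intro packing_edgeI) (auto simp: col_def)
    ultimately show ?thesis by (meson rtranclp.rtrancl_into_rtrancl rtranclp.rtrancl_refl)
  qed
  have aY: "(f, b) \<notin> Y \<or> (f, \<not> b) \<notin> Y" using a(1) by (metis Pair_inject)
  have ff: "?G (f ctr) (f, b)"
  proof (cases "(f, b) \<in> Y")
    case True
    show ?thesis by (rule fin[of _ _ "(f, \<not> b)"]) (use True aY flipf W ne in \<open>auto simp: col_def\<close>)
  next
    case False
    then show ?thesis by (intro fin[of _ _ "(f, b)"]) (use W in auto)
  qed
  have gf': "?G (f ctr) (g, b)"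
  proof (cases "(f, \<not> b) \<in> Y")
    case True
    have "(?F (f ctr))\<^sup>*\<^sup>* (g, b) (f, b)" using gback flipf(2) by (rule rtranclp.rtrancl_into_rtrancl)
    then show ?thesis by (rule fin) (use True aY W in auto)
  next
    case False
    show ?thesis by (rule fin[OF gback]) (use False W ne in \<open>auto simp: col_def\<close>)
  qed
  have fg': "?G (g ctr) (f, b)"
  proof -
    have "?F (g ctr) (f, b) (g, b)" using fg by (intro packing_edgeI) (auto simp: ecol_def)
    then have "(?F (g ctr))\<^sup>*\<^sup>* (f, b) (g, b)" by blast
    then show ?thesis by (rule fin) (use W a in auto)
  qed
  have gg: "?G (g ctr) (g, b)" by (rule fin[of _ _ "(g, b)"]) (use W a in auto)
  have other: "?G j (x, b)" if x: "x \<in> {f, g}" and j: "j \<in> V" "j \<noteq> f ctr" "j \<noteq> g ctr" for x j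
  proof -
    have xW: "x \<in> W" "j \<noteq> x ctr" using x W j by auto
    let ?y = "nb ctr x j"
    have y: "?y \<in> W" "?y \<noteq> f" "?y \<noteq> g" using W_nb[OF xW(1) j(1)] j by auto
    have s1: "?F j (x, b) (?y, b)" using x y A_nb[OF xW(1) j(1) xW(2)]
      by (intro packing_edgeI) (auto simp: col_def)
    have s2: "?F j (?y, b) (?y, \<not> b)" using y by (intro packing_edgeI) (auto simp: col_def)
    show ?thesis
    proof (cases "(?y, b) \<in> Y")
      case True
      then have "(?y, \<not> b) \<notin> Y" using a(1) by (metis Pair_inject)
      moreover have "(?F j)\<^sup>*\<^sup>* (x, b) (?y, \<not> b)"
        using s1 s2 by (meson rtranclp.rtrancl_into_rtrancl rtranclp.rtrancl_refl)
      ultimately show ?thesis using y by (intro fin[of j "(x, b)" "(?y, \<not> b)"]) (auto simp: col_def)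
    next
      case False
      moreover have "(?F j)\<^sup>*\<^sup>* (x, b) (?y, b)" using s1 by blast
      ultimately show ?thesis using y by (intro fin[of j "(x, b)" "(?y, b)"]) (auto simp: col_def)
    qed
  qed
  have "?G j x" if x: "x \<in> ?X" and j: "j \<in> V" for x j
  proof -
    consider "x = (f, b)" "j = f ctr" | "x = (f, b)" "j = g ctr" | "x = (g, b)" "j = f ctr"
      | "x = (g, b)" "j = g ctr" | y where "y \<in> {f, g}" "x = (y, b)" "j \<noteq> f ctr" "j \<noteq> g ctr"
      using x by blast
    then show ?thesis
    proof cases
      case 5
      then show ?thesis using other[OF 5(1) j] by simp
    qed (use ff gf' fg' gg in blast)+
  qed
  then have "\<forall>x\<in>?X. \<forall>j\<in>V. ?G j x" by blast
  moreover have "\<forall>u v. ecol u v = ecol v u" by (simp add: ecol_def)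
  ultimately show ?thesis unfolding arms_def by (intro exI[of _ col] exI[of _ ecol] conjI)
qed

text \<open>For an adjacent pair the forbidden vertex misses at least one of the two distinct centre
  values, and the edge is given to that colour.\<close>

lemma arms_upto2:
  assumes X: "finite X" "card X \<le> 2" "fst ` X \<subseteq> W"
    and Y: "\<And>w. w \<in> Y \<Longrightarrow> w = a"
  shows "arms X Y"
proof (cases "\<exists>f g b. (f, b) \<in> X \<and> (g, b) \<in> X \<and> A f g")
  case False
  then show ?thesis using Y by (intro arms_nonadjacent[OF X(3)]) (blast, metis Pair_inject)
next
  case True
  then obtain f g b where fg: "(f, b) \<in> X" "(g, b) \<in> X" "A f g" by blast
  have "f ctr \<noteq> g ctr" using fg A_ctr by blast
  then have "f \<noteq> g" by blast
  then have "card {(f, b), (g, b)} = 2" by simp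
  then have eq: "X = {(f, b), (g, b)}"
    using card_seteq[of X "{(f, b), (g, b)}"] X fg by auto
  have gf: "A g f" using sympD[OF A_sym, OF fg(3)] .
  show ?thesis
  proof (cases "fst a ctr = g ctr")
    case True
    then have "fst a ctr \<noteq> f ctr" using \<open>f ctr \<noteq> g ctr\<close> by simp
    from arms_adjacent_pair_aux[OF gf Y this, where b = b] show ?thesis
      unfolding eq by (simp add: insert_commute)
  next
    case False
    from arms_adjacent_pair_aux[OF fg(3) Y this, where b = b] show ?thesis unfolding eq by simp
  qed
qed

text \<open>If \<open>q\<close> still holds the value it has in \<open>f\<close>, exchange it with
  the centre. Otherwise \<open>q\<close> holds the old centre value, and a third value
  \<open>k\<close> is put at the centre, whereas \<open>nb ctr f k\<close> has the old value at
  \<open>q\<close>.\<close>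

lemma outside_neighbour:
  assumes q: "q \<in> I" "q \<noteq> ctr" and f: "f \<in> W" and t: "t \<in> V" "t \<noteq> f ctr"
  shows "\<exists>g. A (nb ctr f t) g \<and> g \<notin> {nb ctr f j | j. j \<in> V}"
proof -
  define i where "i = f q"
  define a where "a = f ctr"
  have g: "nb ctr f t \<in> W" using W_nb f t by blast
  have ia: "i \<in> V" "a \<in> V" "i \<noteq> a" using f q ctrI W_V W_inj by (auto simp: i_def a_def)
  show ?thesis
  proof (cases "t = i")
    case False
    have gq: "nb ctr f t q = i" using nb_at[OF f q, of t] False by (simp add: i_def)
    note ex = exit_props[OF g q, unfolded gq]
    have "nb ctr (nb ctr f t) i \<noteq> nb ctr f j" for j
    proof
      assume eq: "nb ctr (nb ctr f t) i = nb ctr f j"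
      then have "j = i" by (metis nb_ctr)
      then have "nb ctr f j q = a" using nb_at[OF f q, of j] by (simp add: i_def a_def)
      then show False using ex(2) eq t a_def by simp
    qed
    then show ?thesis using ex(1) by blast
  next
    case True
    have gq: "nb ctr f t q = a" using nb_at[OF f q, of t] True by (simp add: i_def a_def)
    have "card {ctr, q} \<le> card I" using q ctrI finI by (intro card_mono) auto
    then have "card V \<ge> 4" using cardV q by simp
    then have "\<not> V \<subseteq> {i, a}" using card_mono[of "{i, a}" V] ia by auto
    then obtain k where k: "k \<in> V" "k \<noteq> i" "k \<noteq> a" by blast
    have "nb ctr (nb ctr f t) k \<noteq> nb ctr f j" for j
    proof
      assume eq: "nb ctr (nb ctr f t) k = nb ctr f j"
      then have "j = k" by (metis nb_ctr)
      then have "nb ctr f j q = i" using nb_at[OF f q, of j] k by (simp add: i_def)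
      moreover have "nb ctr (nb ctr f t) k q = a" using nb_at[OF g q, of k] gq k by simp
      ultimately show False using eq ia by simp
    qed
    moreover have "A (nb ctr f t) (nb ctr (nb ctr f t) k)" using A_nb[OF g k(1)] k True by simp
    ultimately show ?thesis by blast
  qed
qed

text \<open>Colour \<open>j\<close> consists of the core \<open>K j\<close> inside copy
  \<open>j\<close> and of arms in the other copies that meet \<open>S\<close>. Each arm ends at a
  vertex with centre value \<open>j\<close>, whose exit enters the core. Members of \<open>S\<close>
  in copy \<open>j\<close> already lie in the core.\<close>

lemma packs_assembly:
  assumes p: "p \<in> I" "p \<noteq> ctr" and S: "fst ` S \<subseteq> W" and c: "c \<in> V"
    and sym: "\<And>u v. ecol u v = ecol v u"
    and K1: "\<And>j u. j \<in> V \<Longrightarrow> j \<noteq> c \<Longrightarrow> u \<in> K j \<Longrightarrow> u \<in> S \<or> col u = j"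
    and K2: "\<And>j u v. j \<in> V \<Longrightarrow> j \<noteq> c \<Longrightarrow> u \<in> K j \<Longrightarrow> v \<in> K j \<Longrightarrow> (packing_edge E S col ecol j)\<^sup>*\<^sup>* u v"
    and K4: "\<And>s. s \<in> S \<Longrightarrow> fst s p \<noteq> c \<Longrightarrow> s \<in> K (fst s p)"
    and exits: "\<And>z j. z \<in> S \<Longrightarrow> j \<in> V \<Longrightarrow> j \<noteq> c \<Longrightarrow> j \<noteq> fst z p \<Longrightarrow>
      \<exists>v. (packing_edge E S col ecol j)\<^sup>*\<^sup>* z v \<and> fst v \<in> W \<and> fst v p = fst z p \<and> fst v ctr = j \<and>
        (v \<in> S \<or> col v = j) \<and> (nb ctr (fst v) (fst z p), snd v) \<in> K j \<and>
        (v \<in> S \<longrightarrow> (nb ctr (fst v) (fst z p), snd v) \<in> S \<longrightarrow>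
          ecol v (nb ctr (fst v) (fst z p), snd v) = j)"
  shows "packs E S (V - {c})"
proof -
  have symF: "symp (packing_edge E S col ecol j)" for j
    by (rule packing_edge_sym[OF E_sym]) (rule sym)
  have to_core: "\<exists>u\<in>K j. (packing_edge E S col ecol j)\<^sup>*\<^sup>* s u"
    if s: "s \<in> S" and j: "j \<in> V" "j \<noteq> c" for s j
  proof (cases "fst s p = j")
    case True
    then show ?thesis using K4[OF s] j by blast
  next
    case False
    obtain v where v: "(packing_edge E S col ecol j)\<^sup>*\<^sup>* s v" "fst v \<in> W" "fst v p = fst s p"
      "v \<in> S \<or> col v = j" "(nb ctr (fst v) (fst s p), snd v) \<in> K j"
      "v \<in> S \<longrightarrow> (nb ctr (fst v) (fst s p), snd v) \<in> S \<longrightarrow>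
          ecol v (nb ctr (fst v) (fst s p), snd v) = j"
      using exits[OF s j] False by blast
    let ?u = "(nb ctr (fst v) (fst s p), snd v)"
    have "E v ?u" using exit_props(1)[OF v(2) p] v(3) by (simp add: E_def)
    then have "packing_edge E S col ecol j v ?u"
      using v(4) K1[OF j v(5)] v(6)[rule_format] by (rule packing_edgeI)
    with v(1) have "(packing_edge E S col ecol j)\<^sup>*\<^sup>* s ?u" by (rule rtranclp.rtrancl_into_rtrancl)
    then show ?thesis using v(5) by blast
  qed
  have "(packing_edge E S col ecol j)\<^sup>*\<^sup>* s s'" if st: "s \<in> S" "s' \<in> S" and j: "j \<in> V - {c}" for s s' j
  proof -
    have j': "j \<in> V" "j \<noteq> c" using j by auto
    obtain u where u: "u \<in> K j" "(packing_edge E S col ecol j)\<^sup>*\<^sup>* s u"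
      using to_core[OF st(1) j'] by blast
    obtain u' where u': "u' \<in> K j" "(packing_edge E S col ecol j)\<^sup>*\<^sup>* s' u'"
      using to_core[OF st(2) j'] by blast
    show ?thesis
      using rtranclp_trans[OF rtranclp_trans[OF u(2) K2[OF j' u(1) u'(1)]] rtranclp_symp[OF symF u'(2)]] .
  qed
  then show ?thesis unfolding packs_def using sym by (intro exI[of _ col] exI[of _ ecol]) auto
qed

lemma E_irr: "\<not> E u u"
  using A_ctr by (auto simp: E_def)

lemma copy_linked:
  assumes p: "p \<in> I" "p \<noteq> ctr" and e: "e \<in> V"
    and u: "fst u \<in> W" "fst u p = e" and v: "fst v \<in> W" "fst v p = e"
    and K: "\<And>x. fst x \<in> W \<Longrightarrow> fst x p = e \<Longrightarrow> x \<in> K"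
  shows "(inside E K)\<^sup>*\<^sup>* u v"
proof -
  interpret C: star ctr "I - {p}" "V - {e}" "h(p := e)" using star_copy[OF p e] .
  have "(inside C.A C.W)\<^sup>*\<^sup>* (fst u) (fst v)"
    by (rule linkedD[OF star_linked[OF C.star_axioms]]) (use u v in \<open>simp_all add: W_copy[OF p e]\<close>)
  then have 1: "(inside E K)\<^sup>*\<^sup>* (fst u, snd u) (fst v, snd u)"
    by (rule lift_layer) (auto simp: inside_def A_copy[OF p e] W_copy[OF p e] K)
  show ?thesis
  proof (cases "snd u = snd v")
    case True
    then show ?thesis using 1 by (cases u; cases v) simp
  next
    case False
    then have "inside E K (fst v, snd u) (fst v, snd v)" using v K by (auto simp: inside_def E_def)
    with 1 have "(inside E K)\<^sup>*\<^sup>* (fst u, snd u) (fst v, snd v)" by (rule rtranclp.rtrancl_into_rtrancl)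
    then show ?thesis by simp
  qed
qed

text \<open>The value \<open>d\<close> is absent from the star inside copy \<open>d\<close>, where
  colour \<open>d\<close> needs its core, while \<open>c\<close> is present there but names no
  colour of the packing. So inside this copy \<open>c\<close> stands in for \<open>d\<close>, which
  is what \<open>gl\<close> records.\<close>

lemma packs_two_copies:
  assumes p: "p \<in> I" "p \<noteq> ctr" and cd: "c \<in> V" "d \<in> V" "d \<noteq> c"
    and X: "fst ` X \<subseteq> W" "\<And>x. x \<in> X \<Longrightarrow> fst x p = c"
    and Z: "fst ` Z \<subseteq> W" "\<And>z. z \<in> Z \<Longrightarrow> fst z p = d"
    and arms: "star.arms ctr (I - {p}) (V - {c}) (h(p := c)) X {}"
    and core: "star.core_data ctr (I - {p}) (V - {d}) (h(p := d)) Z c"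
  shows "packs E (X \<union> Z) (V - {c})"
proof -
  interpret C: star ctr "I - {p}" "V - {c}" "h(p := c)" using star_copy[OF p cd(1)] .
  interpret D: star ctr "I - {p}" "V - {d}" "h(p := d)" using star_copy[OF p cd(2)] .
  note CW = W_copy[OF p cd(1)] and DW = W_copy[OF p cd(2)]
  let ?S = "X \<union> Z"
  from arms obtain colc ecolc where c1: "\<forall>u v. ecolc u v = ecolc v u"
    and c2: "\<forall>x\<in>X. \<forall>j\<in>V - {c}. \<exists>v. (packing_edge C.E X colc ecolc j)\<^sup>*\<^sup>* x v \<and> fst v \<in> C.W \<and>
      fst v ctr = j \<and> (v \<in> X \<or> colc v = j) \<and> v \<notin> {}"
    unfolding C.arms_def by (elim exE conjE)
  note symc = c1[rule_format] and armc = c2[rule_format]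
  from core obtain cold ecold Kd where d1: "\<forall>u v. ecold u v = ecold v u" and ZK: "Z \<subseteq> Kd"
    and d2: "\<forall>u\<in>Kd. fst u \<in> D.W \<and> (u \<in> Z \<or> cold u = c)"
    and d3: "\<forall>u\<in>Kd. \<forall>v\<in>Kd. (packing_edge D.E Z cold ecold c)\<^sup>*\<^sup>* u v"
    and d4: "\<forall>f\<in>D.W. \<forall>b. f ctr = c \<longrightarrow> (f, b) \<in> Kd"
    and d5: "\<forall>z\<in>Z. \<forall>j\<in>V - {d} - {c}. D.reaches Z cold ecold j z"
    unfolding D.core_data_def by (elim exE conjE)
  note symd = d1[rule_format] and KW = d2[rule_format] and Klink = d3[rule_format]
    and Kc = d4[rule_format] and armd = d5[rule_format]
  define gl where "gl j = (if j = c then d else j)" for j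
  define col where "col v = (if fst v p = c then colc v else if fst v p = d then gl (cold v) else fst v p)" for v
  \<comment> \<open>An edge of \<open>?S\<close> from copy \<open>c\<close> to another copy can only
    be the exit of an arm of the colour named by that other copy.\<close>
  define ecol where "ecol u v = (if fst u p = c \<and> fst v p = c then ecolc u v
     else if fst u p = d \<and> fst v p = d then gl (ecold u v)
     else if fst u p = c then fst v p else if fst v p = c then fst u p else d)" for u v
  have sym: "ecol u v = ecol v u" for u v using symc[of u v] symd[of u v] by (auto simp: ecol_def)
  have mem: "u \<in> ?S \<longleftrightarrow> u \<in> X" if "fst u p = c" for u using that X(2)[of u] Z(2)[of u] cd by auto
  have memd: "u \<in> ?S \<longleftrightarrow> u \<in> Z" if "fst u p = d" for u using that X(2)[of u] Z(2)[of u] cd by auto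
  have stepc: "packing_edge E ?S col ecol j u v" if "packing_edge C.E X colc ecolc j u v" for j u v
  proof -
    have "E u v" "fst u p = c" "fst v p = c" using that by (auto simp: packing_edge_def E_copy[OF p cd(1)])
    then show ?thesis using that mem[of u] mem[of v]
      by (simp add: packing_edge_def col_def ecol_def del: Un_iff split: if_splits)
  qed
  have stepd: "packing_edge E ?S col ecol (gl j) u v" if "packing_edge D.E Z cold ecold j u v" for j u v
  proof -
    have "E u v" "fst u p = d" "fst v p = d" using that by (auto simp: packing_edge_def E_copy[OF p cd(2)])
    then show ?thesis using that memd[of u] memd[of v] cd(3)
      by (auto simp add: packing_edge_def col_def ecol_def simp del: Un_iff split: if_splits)
  qed
  define K where "K j = (if j = d then Kd else {v. fst v \<in> W \<and> fst v p = j})" for j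
  show ?thesis
  proof (rule packs_assembly[OF p _ cd(1), of ?S ecol K col])
    show "fst ` ?S \<subseteq> W" using X Z by auto
    show "ecol u v = ecol v u" for u v by (rule sym)
    show K1: "u \<in> ?S \<or> col u = j" if "j \<in> V" "j \<noteq> c" "u \<in> K j" for j u
      using that KW[of u] cd by (auto simp: K_def col_def gl_def DW split: if_splits)
    show "(packing_edge E ?S col ecol j)\<^sup>*\<^sup>* u v" if j: "j \<in> V" "j \<noteq> c" and uv: "u \<in> K j" "v \<in> K j" for j u v
    proof (cases "j = d")
      case True
      have "(packing_edge D.E Z cold ecold c)\<^sup>*\<^sup>* u v" using Klink uv True by (simp add: K_def)
      then have "(packing_edge E ?S col ecol (gl c))\<^sup>*\<^sup>* u v" by (rule rtranclp_mono') (rule stepd)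
      then show ?thesis using True by (simp add: gl_def)
    next
      case False
      have "(inside E (K j))\<^sup>*\<^sup>* u v"
        by (rule copy_linked[OF p j(1)]) (use uv False in \<open>auto simp: K_def\<close>)
      then show ?thesis
      proof (rule rtranclp_mono')
        fix x y assume "inside E (K j) x y"
        then have xy: "E x y" "fst x p = j" "fst y p = j" using False by (auto simp: inside_def K_def)
        then have "x \<notin> ?S" "y \<notin> ?S" using X(2)[of x] Z(2)[of x] X(2)[of y] Z(2)[of y] False j by auto
        then show "packing_edge E ?S col ecol j x y"
          using xy False j by (intro packing_edgeI) (auto simp: col_def)
      qed
    qed
    show "s \<in> K (fst s p)" if "s \<in> ?S" "fst s p \<noteq> c" for s
      using that X(2)[of s] Z(2)[of s] Z(1) ZK cd by (auto simp: K_def)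
    show "\<exists>v. (packing_edge E ?S col ecol j)\<^sup>*\<^sup>* z v \<and> fst v \<in> W \<and> fst v p = fst z p \<and> fst v ctr = j \<and>
        (v \<in> ?S \<or> col v = j) \<and> (nb ctr (fst v) (fst z p), snd v) \<in> K j \<and>
        (v \<in> ?S \<longrightarrow> (nb ctr (fst v) (fst z p), snd v) \<in> ?S \<longrightarrow>
          ecol v (nb ctr (fst v) (fst z p), snd v) = j)"
      if z: "z \<in> ?S" and j: "j \<in> V" "j \<noteq> c" "j \<noteq> fst z p" for z j
    proof (cases "z \<in> X")
      case True
      obtain v where v: "(packing_edge C.E X colc ecolc j)\<^sup>*\<^sup>* z v" "fst v \<in> C.W" "fst v ctr = j" "v \<in> X \<or> colc v = j"
        using armc[OF True, of j] j by blast
      have vW: "fst v \<in> W" "fst v p = c" using v(2) by (auto simp: CW)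
      have zc: "fst z p = c" using True X by blast
      let ?u = "(nb ctr (fst v) c, snd v)"
      have ex: "fst ?u \<in> W" "fst ?u p = j" "fst ?u ctr = c"
        using exit_props[OF vW(1) p] vW v(3) A_W by auto
      \<comment> \<open>The arm arrives with centre value \<open>c\<close>, so for
        \<open>j = d\<close> it hits the core by the condition on centre value \<open>c\<close> in
        \<open>core_data\<close>.\<close>
      have "?u \<in> K j" using ex Kc by (auto simp: K_def DW)
      moreover have "(packing_edge E ?S col ecol j)\<^sup>*\<^sup>* z v" using v(1) by (rule rtranclp_mono') (rule stepc)
      moreover have "ecol v ?u = j" using ex vW j by (auto simp: ecol_def)
      ultimately show ?thesis using vW zc v(3,4) by (intro exI[of _ v]) (auto simp: col_def)
    next
      case False
      then have zd: "z \<in> Z" "fst z p = d" using z Z(2)[of z] by auto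
      obtain v where v: "(packing_edge D.E Z cold ecold j)\<^sup>*\<^sup>* z v" "fst v \<in> D.W" "fst v ctr = j" "v \<in> Z \<or> cold v = j"
        using armd[OF zd(1), of j] j zd unfolding D.reaches_def by auto
      have vW: "fst v \<in> W" "fst v p = d" using v(2) by (auto simp: DW)
      let ?u = "(nb ctr (fst v) d, snd v)"
      have ex: "fst ?u \<in> W" "fst ?u p = j"
        using exit_props[OF vW(1) p] vW v(3) A_W by auto
      have "?u \<in> K j" using ex j zd by (auto simp: K_def)
      moreover have "(packing_edge E ?S col ecol (gl j))\<^sup>*\<^sup>* z v" using v(1) by (rule rtranclp_mono') (rule stepd)
      moreover have "?u \<notin> ?S" using ex(2) X(2)[of ?u] Z(2)[of ?u] j zd by auto
      ultimately show ?thesis using vW zd v(3,4) j cd by (intro exI[of _ v]) (auto simp: col_def gl_def)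
    qed
  qed
qed

section \<open>The induction step\<close>

text \<open>On the left is the vertex where the arm from \<open>z\<close> enters the copy of
  \<open>w\<close>; on the right is the vertex where the arm from \<open>w\<close> to the copy of
  \<open>z\<close> ends. Both have centre value \<open>fst z p\<close>.\<close>

definition conf :: "'i \<Rightarrow> ('i \<Rightarrow> 'v) \<times> bool \<Rightarrow> ('i \<Rightarrow> 'v) \<times> bool \<Rightarrow> bool" where
  "conf p z w \<longleftrightarrow> nb ctr (nb ctr (fst z) (fst w p)) (fst z p) = nb ctr (fst w) (fst z p)"

lemma conf_sym: "conf p z w \<Longrightarrow> conf p w z"
  unfolding conf_def by (metis nb_ctr nb_nb_back)

text \<open>The members \<open>z\<close> of \<open>Z\<close> lie in distinct copies. For \<open>conf p z w\<close> in one layer the arms from \<open>z\<close>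
  to the copy of \<open>w\<close> and from \<open>w\<close> to the copy of \<open>z\<close> use the same edge; then \<open>z\<close> is rerouted through
  the other layer.\<close>

lemma packs_singles:
  assumes p: "p \<in> I" "p \<noteq> ctr" and q: "q \<in> I" "q \<noteq> ctr" "q \<noteq> p" and c: "c \<in> V"
    and X: "fst ` X \<subseteq> W" "\<And>x. x \<in> X \<Longrightarrow> fst x p = c"
    and Z: "fst ` Z \<subseteq> W" "\<And>z. z \<in> Z \<Longrightarrow> fst z p \<noteq> c"
    and inj: "\<And>z w. z \<in> Z \<Longrightarrow> w \<in> Z \<Longrightarrow> fst z p = fst w p \<Longrightarrow> z = w"
    and m: "m \<in> Z"
    and noconf: "\<And>z w. z \<in> Z \<Longrightarrow> w \<in> Z \<Longrightarrow> z \<noteq> m \<Longrightarrow> w \<noteq> m \<Longrightarrow> z \<noteq> w \<Longrightarrow> \<not> conf p z w"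
    and R_def: "R = {z \<in> Z. z \<noteq> m \<and> snd z = snd m \<and> conf p z m}"
    and arms: "star.arms ctr (I - {p}) (V - {c}) (h(p := c)) X
      {(nb ctr (fst z) (fst z p), \<not> snd z) | z. z \<in> R}"
  shows "packs E (X \<union> Z) (V - {c})"
proof -
  interpret C: star ctr "I - {p}" "V - {c}" "h(p := c)" using star_copy[OF p c] .
  note CW = W_copy[OF p c]
  let ?S = "X \<union> Z"
  define Y where "Y = {(nb ctr (fst z) (fst z p), \<not> snd z) | z. z \<in> R}"
  from arms obtain colc ecolc where c1: "\<forall>u v. ecolc u v = ecolc v u"
    and c2: "\<forall>x\<in>X. \<forall>j\<in>V - {c}. \<exists>v. (packing_edge C.E X colc ecolc j)\<^sup>*\<^sup>* x v \<and> fst v \<in> C.W \<and>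
      fst v ctr = j \<and> (v \<in> X \<or> colc v = j) \<and> v \<notin> Y"
    unfolding C.arms_def Y_def[symmetric] by (elim exE conjE)
  note symc = c1[rule_format] and armc = c2[rule_format]
  define t where "t = fst m p"
  \<comment> \<open>The colour whose arm does not run in the layer of \<open>z\<close>. For members
    outside \<open>R\<close> the value \<open>c\<close> removes nothing new from
    \<open>V - {c, tgt z}\<close>.\<close>
  define tgt where "tgt z = (if z \<in> R then t else c)" for z
  define Arm where "Arm z = {(nb ctr (fst z) j, snd z) | j. j \<in> V - {c, tgt z}} \<union>
     (if z \<in> R then {(fst z, \<not> snd z), (nb ctr (fst z) t, \<not> snd z)} else {})" for z
  \<comment> \<open>\<open>Arm z\<close> can contain \<open>z\<close> itself, for \<open>j\<close>
    equal to its centre value, but \<open>z\<close> has to stay in the core.\<close>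
  define K where "K e = {v. fst v \<in> W \<and> fst v p = e \<and> (\<forall>z\<in>Z. fst z p = e \<longrightarrow> v = z \<or> v \<notin> Arm z)}" for e
  define col where "col v = (if fst v p = c then colc v else if v \<in> K (fst v p) then fst v p
     else if \<exists>z\<in>R. fst z p = fst v p \<and> snd v \<noteq> snd z then t else fst v ctr)" for v
  \<comment> \<open>When a rerouted member and \<open>m\<close> are adjacent, their edge is left to
    the arm of \<open>m\<close>. The final default \<open>c\<close> is not a colour of the
    packing.\<close>
  define ecol where "ecol u v = (if fst u p = c \<and> fst v p = c then ecolc u v
     else if fst u p = c then fst v p else if fst v p = c then fst u p
     else if u \<in> R \<and> v \<notin> R then fst u p else if v \<in> R \<and> u \<notin> R then fst v p else c)" for u v
  have sym: "ecol u v = ecol v u" for u v using symc[of u v] by (auto simp: ecol_def)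
  have RZ: "z \<in> Z" "z \<noteq> m" "fst z p \<noteq> t" if "z \<in> R" for z
    using that inj[of z m] m by (auto simp: R_def t_def)
  have tV: "t \<in> V" "t \<noteq> c" using m Z p W_V by (auto simp: t_def)
  have ZW: "fst z \<in> W" "fst z p \<in> V" "fst z ctr \<noteq> fst z p" if "z \<in> Z" for z
    using that Z(1) W_V p ctrI W_inj[of "fst z" ctr p] by auto
  have nbp: "nb ctr (fst z) j p = fst z p" if "z \<in> Z" "j \<noteq> fst z p" for z j
    using nb_at[OF ZW(1)[OF that(1)] p] that by simp
  have memS: "u \<in> ?S \<longleftrightarrow> u = z" if "z \<in> Z" "fst u p = fst z p" for u z
    using that inj[of u z] X(2)[of u] Z(2)[of z] by auto
  have mem: "u \<in> ?S \<longleftrightarrow> u \<in> X" if "fst u p = c" for u using that X(2)[of u] Z(2)[of u] by auto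
  have stepc: "packing_edge E ?S col ecol j u v" if "packing_edge C.E X colc ecolc j u v" for j u v
  proof -
    have "E u v" "fst u p = c" "fst v p = c" using that by (auto simp: packing_edge_def E_copy[OF p c])
    then show ?thesis using that mem[of u] mem[of v]
      by (simp add: packing_edge_def col_def ecol_def del: Un_iff split: if_splits)
  qed
  have KI: "v \<in> K e" if "fst v \<in> W" "fst v p = e" "\<And>z. z \<in> Z \<Longrightarrow> fst z p = e \<Longrightarrow> v = z \<or> v \<notin> Arm z" for v e
    using that by (simp add: K_def)
  have KS: "z \<in> K (fst z p)" if "z \<in> Z" for z
    using that ZW inj by (auto simp: K_def)
  have linkK: "linked E (K e)" if e: "e \<in> V" "e \<noteq> c" for e
  proof (cases "\<exists>z\<in>Z. fst z p = e")
    case False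
    then have "K e = {v. fst v \<in> W \<and> fst v p = e}" by (auto simp: K_def)
    then show ?thesis unfolding linked_def using copy_linked[OF p e(1)] by auto
  next
    case True
    then obtain f b where z: "(f, b) \<in> Z" "f p = e" by auto
    interpret D: star ctr "I - {p}" "V - {e}" "h(p := e)" using star_copy[OF p e(1)] .
    note DW = W_copy[OF p e(1)] and DA = A_copy[OF p e(1)]
    have f: "f \<in> W" "f ctr \<noteq> e" using ZW[OF z(1)] z by auto
    have fD: "f \<in> D.W" using f z by (simp add: DW)
    have Kiff: "v \<in> K e \<longleftrightarrow> fst v \<in> D.W \<and> (v = (f, b) \<or> v \<notin> Arm (f, b))" for v
    proof -
      have one: "w = (f, b)" if "w \<in> Z" "fst w p = e" for w using inj[of w "(f, b)"] that z by simp
      have fe: "fst (f, b) p = e" using z by simp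
      have "(\<forall>z\<in>Z. fst z p = e \<longrightarrow> v = z \<or> v \<notin> Arm z) \<longleftrightarrow> v = (f, b) \<or> v \<notin> Arm (f, b)"
      proof
        assume "\<forall>z\<in>Z. fst z p = e \<longrightarrow> v = z \<or> v \<notin> Arm z"
        then show "v = (f, b) \<or> v \<notin> Arm (f, b)" using z(1) fe by blast
      next
        assume *: "v = (f, b) \<or> v \<notin> Arm (f, b)"
        show "\<forall>z\<in>Z. fst z p = e \<longrightarrow> v = z \<or> v \<notin> Arm z"
        proof (intro ballI impI)
          fix w assume "w \<in> Z" "fst w p = e"
          from one[OF this] * show "v = w \<or> v \<notin> Arm w" by simp
        qed
      qed
      then show ?thesis unfolding K_def DW mem_Collect_eq by blast
    qed
    have flip: "(inside E (K e))\<^sup>*\<^sup>* (g, b) r" if "(g, b) \<in> K e" "(g, \<not> b) \<in> K e" "(inside E (K e))\<^sup>*\<^sup>* (g, \<not> b) r" for g r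
      using that by (intro inside_step[OF _ that(1,2,3)]) (auto simp: K_def)
    show ?thesis
    proof (cases "(f, b) \<in> R")
      case False
      then have Arm: "Arm (f, b) = {(nb ctr f j, b) | j. j \<in> V - {c}}" by (auto simp: Arm_def tgt_def)
      \<comment> \<open>Without rerouting the other layer of the copy is intact, and every vertex of
        the core is one step away from it.\<close>
      have other: "(g, \<not> b) \<in> K e" if "g \<in> D.W" for g using that by (auto simp: Kiff Arm)
      have path: "(inside E (K e))\<^sup>*\<^sup>* (g, \<not> b) (f, \<not> b)" if "g \<in> D.W" for g
      proof (rule lift_layer[OF linkedD[OF star_linked[OF D.star_axioms] that fD]])
        fix x y assume "x \<in> D.W" "y \<in> D.W" "D.A x y"
        then show "inside E (K e) (x, \<not> b) (y, \<not> b)"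
          using other[of x] other[of y] unfolding inside_def DA by simp
      qed
      show ?thesis
      proof (rule linked_root[OF E_sym])
        fix u assume u: "u \<in> K e"
        then have "fst u \<in> D.W" by (simp add: Kiff)
        then show "(inside E (K e))\<^sup>*\<^sup>* u (f, \<not> b)"
          using path flip[of "fst u" "(f, \<not> b)"] other u by (cases u; cases "snd u = b") auto
      qed
    next
      case True
      note t = RZ(3)[OF True]
      have te: "t \<noteq> e" using t z by simp
      have tgt: "tgt (f, b) = t" using True by (simp add: tgt_def)
      have Arm: "Arm (f, b) = {(nb ctr f j, b) | j. j \<in> V - {c, t}} \<union> {(f, \<not> b), (nb ctr f t, \<not> b)}"
        using True by (auto simp: Arm_def tgt)
      \<comment> \<open>The rerouted arm takes these two vertices out of the other layer, which
        stays connected. In layer \<open>b\<close> they can no longer climb, so they need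
        connections of their own.\<close>
      define B where "B = {f, nb ctr f t}"
      have other: "(g, \<not> b) \<in> K e" if "g \<in> D.W - B" for g using that by (auto simp: Kiff Arm B_def)
      have fN: "f \<in> {nb ctr f j | j. j \<in> V - {e}}"
        using f W_ctr[OF f(1)] by (intro CollectI exI[of _ "f ctr"]) simp
      have tN: "nb ctr f t \<in> {nb ctr f j | j. j \<in> V - {e}}" using tV te by blast
      have "linked D.A (D.W - B)"
      proof (rule D.linked_minus_closed_neighbourhood[OF _ q(2) fD])
        show "q \<in> I - {p}" using q by simp
        show "B \<subseteq> {nb ctr f j | j. j \<in> V - {e}}" unfolding B_def using fN tN by simp
      qed (simp add: B_def)
      note link = linkedD[OF this]
      have cf: "c \<noteq> e" using e by simp
      \<comment> \<open>In layer \<open>b\<close> the vertex \<open>nb ctr f t\<close> is kept and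
        links \<open>f\<close> to the core; \<open>y\<close> is its neighbour off all arms.\<close>
      obtain y where y: "D.A (nb ctr f t) y" "y \<notin> {nb ctr f j | j. j \<in> V - {e}}" if "t \<noteq> f ctr"
        using D.outside_neighbour[of q f t] q fD tV te by blast
      have nbW: "nb ctr f j \<in> D.W" if "j \<in> V" "j \<noteq> e" for j
        using D.W_nb[OF fD, of j] that by simp
      have nbne: "nb ctr f j \<noteq> f" if "j \<noteq> f ctr" for j using that by (metis nb_ctr)
      obtain r where r: "r \<in> D.W - B"
      proof (cases "t = f ctr")
        case True
        then show ?thesis using that[of "nb ctr f c"] nbW[OF c cf] nbne[of c] tV by (auto simp: B_def)
      next
        case False
        then show ?thesis using that[of y] y D.A_W fN tN unfolding B_def by blast
      qed
      let ?P = "\<lambda>u. (inside E (K e))\<^sup>*\<^sup>* u (r, \<not> b)"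
      have P1: "?P (g, \<not> b)" if "g \<in> D.W - B" for g
      proof (rule lift_layer[OF link[OF that r]])
        fix x y assume "x \<in> D.W - B" "y \<in> D.W - B" "D.A x y"
        then show "inside E (K e) (x, \<not> b) (y, \<not> b)"
          using other[of x] other[of y] unfolding inside_def DA by simp
      qed
      have P2: "?P (g, b)" if "(g, b) \<in> K e" "g \<notin> B" for g
      proof (rule flip[OF that(1)])
        have "g \<in> D.W - B" using that by (simp add: Kiff)
        then show "(g, \<not> b) \<in> K e" "?P (g, \<not> b)" using other P1 by auto
      qed
      have tK: "(nb ctr f t, b) \<in> K e" using nbW[OF tV(1) te] by (auto simp: Kiff Arm)
      have cK: "(nb ctr f c, b) \<in> K e" using nbW[OF c cf] by (auto simp: Kiff Arm)
      have fK: "(f, b) \<in> K e" using fD by (simp add: Kiff)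
      have P3: "?P (nb ctr f t, b)" if "t \<noteq> f ctr"
      proof -
        have yW: "y \<in> D.W" "A (nb ctr f t) y" using y[OF that] D.A_W DA by auto
        have "y \<noteq> f" "y \<noteq> nb ctr f t" using y(2)[OF that] fN tN by blast+
        then have yB: "y \<notin> B" by (simp add: B_def)
        have "(y, b) \<notin> Arm (f, b)"
        proof
          assume "(y, b) \<in> Arm (f, b)"
          then obtain j where j: "y = nb ctr f j" "j \<in> V" by (auto simp: Arm)
          then have "j = e" using y(2)[OF that] by blast
          then have "y p = f ctr" using j nb_at[OF f(1) p, of e] z by simp
          then show False using yW f by (simp add: DW)
        qed
        then have "(y, b) \<in> K e" using yW by (simp add: Kiff)
        then show ?thesis using inside_step[of E "(nb ctr f t, b)" "(y, b)"] yW tK P2[of y] yB by simp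
      qed
      have P4: "?P (f, b)"
      proof (cases "t = f ctr")
        case True
        \<comment> \<open>Now \<open>nb ctr f t\<close> is \<open>f\<close> itself, so the link is
          the neighbour with centre value \<open>c\<close>, a colour that has no arm.\<close>
        have ne: "c \<noteq> f ctr" using True tV by simp
        have "A f (nb ctr f c)" using A_nb[OF f(1) c ne] .
        moreover have "nb ctr f c \<notin> B" using True nbne[OF ne] by (auto simp: B_def)
        ultimately show ?thesis using inside_step[of E "(f, b)" "(nb ctr f c, b)"] fK cK P2[OF cK] by simp
      next
        case False
        then show ?thesis using inside_step[of E "(f, b)" "(nb ctr f t, b)"] A_nb[OF f(1) tV(1) False] fK tK P3 by simp
      qed
      show ?thesis
      proof (rule linked_root[OF E_sym])
        fix u assume u: "u \<in> K e"
        obtain g b' where gb: "u = (g, b')" by fastforce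
        show "?P u"
        proof (cases "b' = b")
          case True
          show ?thesis
          proof (cases "g \<in> B")
            case True
            then show ?thesis using P3 P4 gb \<open>b' = b\<close> by (cases "t = f ctr") (auto simp: B_def)
          next
            case False
            then show ?thesis using P2 u gb True by simp
          qed
        next
          case False
          then have "b' = (\<not> b)" by blast
          then show ?thesis using P1[of g] u gb by (auto simp: Kiff Arm B_def)
        qed
      qed
    qed
  qed
  have colR: "col (g, \<not> snd z) = t" if "z \<in> R" "g = fst z \<or> g = nb ctr (fst z) t" for z g
  proof -
    have "(g, \<not> snd z) \<in> Arm z" "g p = fst z p"
      using that nbp[of z t] RZ[OF that(1)] by (auto simp: Arm_def)
    moreover have "(g, \<not> snd z) \<noteq> z" by (metis snd_conv)
    ultimately have "(g, \<not> snd z) \<notin> K (fst z p)" "g p = fst z p" using RZ(1)[OF that(1)] by (auto simp: K_def)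
    moreover from this have "\<exists>w\<in>R. fst w p = g p \<and> (\<not> snd z) \<noteq> snd w"
      using that(1) by (intro bexI[of _ z]) auto
    moreover have "fst z p \<noteq> c" using Z(2) RZ(1)[OF that(1)] .
    ultimately show ?thesis unfolding col_def by simp
  qed
  have colA: "col (nb ctr (fst z) j, snd z) = j"
    if z: "z \<in> Z" and j: "j \<in> V" "j \<noteq> c" "j \<noteq> tgt z" "j \<noteq> fst z p" "j \<noteq> fst z ctr" for z j
  proof -
    let ?v = "(nb ctr (fst z) j, snd z)"
    have vA: "?v \<in> Arm z" using j by (auto simp: Arm_def)
    have vp: "fst ?v p = fst z p" using nbp[OF z j(4)] by simp
    have vz: "?v \<noteq> z" using j(5) by (metis fst_conv nb_ctr)
    have noR: "\<not> (\<exists>w\<in>R. fst w p = fst ?v p \<and> snd ?v \<noteq> snd w)"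
    proof (rule notI, elim bexE conjE)
      fix w assume w: "w \<in> R" "fst w p = fst ?v p" "snd ?v \<noteq> snd w"
      then have "w = z" using inj[OF RZ(1)[OF w(1)] z] vp by simp
      then show False using w(3) by simp
    qed
    have nK: "?v \<notin> K (fst ?v p)"
    proof
      assume "?v \<in> K (fst ?v p)"
      then have "\<forall>w\<in>Z. fst w p = fst ?v p \<longrightarrow> ?v = w \<or> ?v \<notin> Arm w"
        unfolding K_def mem_Collect_eq by (elim conjE)
      from bspec[OF this z] show False using vp vA vz by argo
    qed
    have nc: "fst ?v p \<noteq> c" using Z(2)[OF z] vp by simp
    have "col ?v = fst ?v ctr" unfolding col_def using noR nK nc by (simp only: if_False)
    then show ?thesis by simp
  qed
  have confD: "w \<in> R \<and> z = m \<or> z \<in> R \<and> w = m" if "z \<in> Z" "w \<in> Z" "z \<noteq> w" "conf p z w" "snd z = snd w" for z w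
  proof (cases "z = m")
    case True
    then show ?thesis using that conf_sym[OF that(4)] unfolding R_def by simp
  next
    case False
    then have "w = m" using noconf[OF that(1,2)] that(3,4) by blast
    then show ?thesis using that unfolding R_def by simp
  qed
  show ?thesis
  proof (rule packs_assembly[OF p _ c, of ?S ecol K col])
    show "fst ` ?S \<subseteq> W" using X Z by auto
    show "ecol u v = ecol v u" for u v by (rule sym)
    show K1: "u \<in> ?S \<or> col u = j" if "j \<in> V" "j \<noteq> c" "u \<in> K j" for j u
    proof -
      have "fst u p = j" using that by (simp add: K_def)
      then show ?thesis using that by (simp add: col_def)
    qed
    show "(packing_edge E ?S col ecol j)\<^sup>*\<^sup>* u v" if j: "j \<in> V" "j \<noteq> c" and uv: "u \<in> K j" "v \<in> K j" for j u v
      using linkedD[OF linkK[OF j] uv]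
    proof (rule rtranclp_mono')
      fix x y assume xy: "inside E (K j) x y"
      then have p': "fst x p = j" "fst y p = j" and "E x y" "x \<in> K j" "y \<in> K j" by (auto simp: inside_def K_def)
      moreover have "\<not> (x \<in> ?S \<and> y \<in> ?S)"
      proof
        assume S: "x \<in> ?S \<and> y \<in> ?S"
        then have "x \<in> Z" "y \<in> Z" using X(2)[of x] X(2)[of y] p' j by auto
        then have "x = y" using inj p' by simp
        then show False using \<open>E x y\<close> E_irr by simp
      qed
      ultimately show "packing_edge E ?S col ecol j x y"
        using K1[OF j] by (intro packing_edgeI) auto
    qed
    show "s \<in> K (fst s p)" if "s \<in> ?S" "fst s p \<noteq> c" for s
      using that X(2)[of s] KS[of s] by auto
    show "\<exists>v. (packing_edge E ?S col ecol j)\<^sup>*\<^sup>* z v \<and> fst v \<in> W \<and> fst v p = fst z p \<and> fst v ctr = j \<and>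
        (v \<in> ?S \<or> col v = j) \<and> (nb ctr (fst v) (fst z p), snd v) \<in> K j \<and>
        (v \<in> ?S \<longrightarrow> (nb ctr (fst v) (fst z p), snd v) \<in> ?S \<longrightarrow>
          ecol v (nb ctr (fst v) (fst z p), snd v) = j)"
      if z: "z \<in> ?S" and j: "j \<in> V" "j \<noteq> c" "j \<noteq> fst z p" for z j
    proof (cases "z \<in> X")
      case True
      obtain v where v: "(packing_edge C.E X colc ecolc j)\<^sup>*\<^sup>* z v" "fst v \<in> C.W" "fst v ctr = j"
        "v \<in> X \<or> colc v = j" "v \<notin> Y"
        using armc[OF True, of j] j by blast
      have vW: "fst v \<in> W" "fst v p = c" using v(2) by (auto simp: CW)
      have zc: "fst z p = c" using True X by blast
      let ?u = "(nb ctr (fst v) c, snd v)"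
      have ex: "fst ?u \<in> W" "fst ?u p = j" "fst ?u ctr = c"
        using exit_props[OF vW(1) p] vW v(3) A_W by auto
      \<comment> \<open>Of all vertices on arms only \<open>(fst w, \<not> snd w)\<close> for a
        rerouted \<open>w\<close> can have centre value \<open>c\<close>; the arms from
        \<open>X\<close> avoid the vertices whose exit it is.\<close>
      have "?u \<in> K j"
      proof (rule KI[OF ex(1,2)], rule disjI2, rule notI)
        fix w assume w: "w \<in> Z" "fst w p = j" "?u \<in> Arm w"
        have "(\<exists>k. ?u = (nb ctr (fst w) k, snd w) \<and> k \<noteq> c) \<or>
            (w \<in> R \<and> (?u = (fst w, \<not> snd w) \<or> ?u = (nb ctr (fst w) t, \<not> snd w)))"
          using w(3) unfolding Arm_def by (cases "w \<in> R") auto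
        moreover have "?u \<noteq> (nb ctr (fst w) k, b)" if "k \<noteq> c" for k b
          using ex(3) that by (metis fst_conv nb_ctr)
        ultimately have "w \<in> R" "?u = (fst w, \<not> snd w)" using tV(2) by blast+
        then have "fst v = nb ctr (fst w) (fst w p)" "snd v = (\<not> snd w)"
          using nb_nb_back[of ctr "fst v" c] v(3) w(2) by auto
        then have "v \<in> Y" unfolding Y_def using \<open>w \<in> R\<close> by (cases v) auto
        then show False using v(5) by blast
      qed
      moreover have "(packing_edge E ?S col ecol j)\<^sup>*\<^sup>* z v" using v(1) by (rule rtranclp_mono') (rule stepc)
      moreover have "ecol v ?u = j" using ex vW j by (auto simp: ecol_def)
      ultimately show ?thesis using vW zc v(3,4) by (intro exI[of _ v]) (auto simp: col_def)
    next
      case False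
      then have zZ: "z \<in> Z" using z by blast
      define f where "f = fst z"
      define e where "e = fst z p"
      \<comment> \<open>The layer in which the arm of \<open>z\<close> with colour \<open>j\<close>
        ends.\<close>
      define bz where "bz = (if z \<in> R \<and> j = t then \<not> snd z else snd z)"
      have f: "f \<in> W" "f p = e" "f ctr \<noteq> e" "e \<in> V" "e \<noteq> c" using ZW[OF zZ] Z(2)[OF zZ] by (auto simp: f_def e_def)
      have je: "j \<noteq> e" using j by (simp add: e_def)
      let ?v = "(nb ctr f j, bz)"
      have vW: "nb ctr f j \<in> W" "nb ctr f j p = e" using W_nb[OF f(1) j(1)] nbp[OF zZ, of j] j by (auto simp: f_def e_def)
      have notS: "(g, b) \<notin> ?S" if "g p = e" "(g, b) \<noteq> z" for g b
        using memS[OF zZ, of "(g, b)"] that by (simp add: e_def)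
      have path: "(packing_edge E ?S col ecol j)\<^sup>*\<^sup>* z ?v \<and> (?v \<in> ?S \<or> col ?v = j)"
      proof (cases "z \<in> R \<and> j = t")
        case True
        then have bz: "bz = (\<not> snd z)" by (simp add: bz_def)
        have c1: "col (f, \<not> snd z) = j" "col (nb ctr f j, \<not> snd z) = j" using colR True by (auto simp: f_def)
        have "(f, \<not> snd z) \<noteq> z" by (metis snd_conv)
        then have nS: "(f, \<not> snd z) \<notin> ?S" using notS[of f "\<not> snd z"] f(2) by blast
        have "E z (f, \<not> snd z)" using f(1) by (simp add: E_def f_def)
        then have "packing_edge E ?S col ecol j z (f, \<not> snd z)"
          using z c1(1) nS by (intro packing_edgeI) blast+
        moreover have "(packing_edge E ?S col ecol j)\<^sup>*\<^sup>* (f, \<not> snd z) (nb ctr f j, \<not> snd z)"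
        proof (cases "j = f ctr")
          case False
          have "packing_edge E ?S col ecol j (f, \<not> snd z) (nb ctr f j, \<not> snd z)"
            using c1 A_nb[OF f(1) j(1) False] nS by (intro packing_edgeI) (simp_all add: f_def)
          then show ?thesis by blast
        qed simp
        ultimately show ?thesis using bz c1 by (simp add: converse_rtranclp_into_rtranclp)
      next
        case no: False
        then have bz: "bz = snd z" by (simp add: bz_def)
        show ?thesis
        proof (cases "j = f ctr")
          case True
          then have "?v = z" using bz by (simp add: f_def)
          then show ?thesis using zZ by simp
        next
          case False
          have "col ?v = j" using colA[OF zZ j(1,2) _ j(3)] False no j(2) bz
            by (auto simp: f_def tgt_def split: if_splits)
          moreover have "?v \<noteq> z" using False by (metis f_def fst_conv nb_ctr)
          moreover have "?v \<notin> ?S" using notS[of "nb ctr f j" bz] vW calculation by simp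
          moreover have "E z ?v" using A_nb[OF f(1) j(1) False] bz by (simp add: E_def f_def)
          ultimately have "packing_edge E ?S col ecol j z ?v" using zZ by (intro packing_edgeI) auto
          then show ?thesis using \<open>col ?v = j\<close> by blast
        qed
      qed
      let ?u = "(nb ctr (nb ctr f j) e, bz)"
      have ex: "fst ?u \<in> W" "fst ?u p = j" "fst ?u ctr = e"
        using exit_props[OF vW(1) p] vW A_W by auto
      \<comment> \<open>Entering the copy of \<open>w\<close> on one of its arms would mean a
        conflict between \<open>z\<close> and \<open>w\<close>. Then one of them is
        \<open>m\<close>, and a conflict within one layer has been resolved by moving the critical
        arm of the other one to the opposite layer.\<close>
      have uK: "?u \<in> K j"
      proof (rule KI[OF ex(1,2)], rule disjI2, rule notI)
        fix w assume w: "w \<in> Z" "fst w p = j" "?u \<in> Arm w"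
        have zw: "z \<noteq> w" using w j by auto
        have conf: "conf p z w \<longleftrightarrow> fst ?u = nb ctr (fst w) e"
          using w by (simp add: conf_def f_def e_def)
        consider k where "?u = (nb ctr (fst w) k, snd w)" "k \<noteq> tgt w"
          | "w \<in> R" "bz = (\<not> snd w)" "fst ?u = fst w \<or> fst ?u = nb ctr (fst w) t"
          using w(3) by (auto simp: Arm_def split: if_splits)
        then show False
        proof cases
          case 1
          then have "k = e" using ex(3) by (metis fst_conv nb_ctr)
          then have cf: "conf p z w" and bw: "bz = snd w" using 1 conf by auto
          then have "z = m \<or> w = m" using noconf[OF zZ w(1) _ _ zw] by blast
          then show False
          proof
            assume zm: "z = m"
            then have "z \<notin> R" using RZ(2) by blast
            then have "snd z = snd w" using bw by (simp add: bz_def)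
            then have "w \<in> R" using confD[OF zZ w(1) zw cf] RZ(2) zm zw by blast
            then show False using 1(2) \<open>k = e\<close> zm by (simp add: tgt_def t_def e_def)
          next
            assume wm: "w = m"
            then have "j = t" using w by (simp add: t_def)
            show False
            proof (cases "z \<in> R")
              case True
              then show False using bw \<open>j = t\<close> wm by (auto simp: bz_def R_def)
            next
              case False
              then have "snd z = snd w" using bw by (simp add: bz_def)
              then show False using confD[OF zZ w(1) zw cf] RZ(2) wm zw False by blast
            qed
          qed
        next
          case 2
          have "fst ?u = nb ctr (fst w) e" using 2(3)
          proof
            assume "fst ?u = fst w"
            then show ?thesis using ex(3) by (metis nb_self)
          next
            assume "fst ?u = nb ctr (fst w) t"
            then show ?thesis using ex(3) by (metis nb_ctr)
          qed
          then have cf: "conf p z w" using conf by simp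
          have "w \<noteq> m" using RZ(2) 2(1) by blast
          then have zm: "z = m" using noconf[OF zZ w(1) _ _ zw] cf by blast
          then have "bz = snd m" using RZ(2)[of z] by (auto simp: bz_def)
          then show False using 2 by (simp add: R_def)
        qed
      qed
      \<comment> \<open>Here the arm consists of \<open>z\<close> alone and its exit is a member
        \<open>w\<close> of \<open>Z\<close>. Being a conflict, this forces \<open>z = m\<close>
        with \<open>w\<close> rerouted, the case in which \<open>ecol\<close> favours
        \<open>m\<close>.\<close>
      have "ecol ?v ?u = j" if S: "?v \<in> ?S" "?u \<in> ?S"
      proof -
        have vz: "?v = z" using notS[of "nb ctr f j" bz] vW S by blast
        define w where "w = ?u"
        have w: "w \<in> Z" "fst w p = j" using S ex X(2)[of w] j by (auto simp: w_def)
        have zw: "z \<noteq> w" using w j by auto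
        have cf: "conf p z w"
        proof -
          have "nb ctr (fst w) e = fst w" using ex(3) w_def by (metis nb_self fst_conv)
          then show ?thesis using w(2) by (simp add: conf_def w_def f_def e_def)
        qed
        have bz: "bz = snd z" "snd w = bz" using vz w_def by auto
        have "\<not> (z \<in> R \<and> w = m)" using bz(1) w(2) by (auto simp: bz_def t_def)
        then have "w \<in> R" "z = m" using confD[OF zZ w(1) zw cf] bz by auto
        moreover have "z \<notin> R" using RZ(2) \<open>z = m\<close> by blast
        ultimately show ?thesis unfolding vz using w f zZ Z(2)[OF zZ] Z(2)[OF w(1)]
          by (simp add: ecol_def w_def[symmetric])
      qed
      then show ?thesis using path vW uK f by (intro exI[of _ ?v]) (auto simp: e_def)
    qed
  qed
qed

lemma outside_linked:
  assumes p: "p \<in> I" "p \<noteq> ctr"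
  shows "linked E {v. fst v \<in> W \<and> fst v p \<noteq> c}"
proof -
  let ?K = "{v :: ('i \<Rightarrow> 'v) \<times> bool. fst v \<in> W \<and> fst v p \<noteq> c}"
  obtain r where r: "r \<in> W" "r p \<noteq> c"
  proof -
    obtain f where f: "f \<in> W" using W_nonempty by blast
    show ?thesis
    proof (cases "f p = c")
      case True
      note ex = exit_props[OF f p]
      have "nb ctr f (f p) \<in> W" using ex A_W by blast
      moreover have "f ctr \<noteq> c" using True W_inj[OF f ctrI p(1)] p by auto
      ultimately show ?thesis using that[of "nb ctr f (f p)"] ex by simp
    next
      case False
      then show ?thesis using that f by blast
    qed
  qed
  define d where "d = r p"
  have d: "d \<in> V" using r p W_V d_def by blast
  have dc: "d \<noteq> c" using r d_def by simp
  show ?thesis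
  proof (rule linked_root[OF E_sym])
    fix u assume u: "u \<in> ?K"
    show "(inside E ?K)\<^sup>*\<^sup>* u (r, True)"
    proof (cases "fst u p = d")
      case True
      then show ?thesis using u r d_def dc by (intro copy_linked[OF p d]) auto
    next
      case False
      have e: "fst u p \<in> V" using u W_V p by blast
      obtain g where g: "g \<in> W" "g ctr = d" "g p = fst u p" using W_ex2[OF d e _ p] False by auto
      note ex = exit_props[OF g(1) p]
      have g': "nb ctr g (g p) \<in> W" using ex A_W by blast
      have 1: "(inside E ?K)\<^sup>*\<^sup>* u (g, True)"
        using u g by (intro copy_linked[OF p e]) auto
      have 2: "(inside E ?K)\<^sup>*\<^sup>* (nb ctr g (g p), True) (r, True)"
        using g' ex g r d_def dc by (intro copy_linked[OF p d]) auto
      have "(inside E ?K)\<^sup>*\<^sup>* (g, True) (r, True)"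
        by (rule inside_step[OF _ _ _ 2]) (use ex g g' u dc in auto)
      with 1 show ?thesis by (rule rtranclp_trans)
    qed
  qed
qed

lemma packs_one_copy:
  assumes p: "p \<in> I" "p \<noteq> ctr" and c: "c \<in> V"
    and S: "fst ` S \<subseteq> W" "\<And>s. s \<in> S \<Longrightarrow> fst s p = c"
    and packs: "packs (star.E ctr (I - {p}) (V - {c}) (h(p := c))) S {..<k::nat}"
  shows "packs E S {..<Suc k}"
proof -
  interpret C: star ctr "I - {p}" "V - {c}" "h(p := c)" using star_copy[OF p c] .
  from packs obtain colc ecolc where sym: "\<forall>u v. ecolc u v = ecolc v u"
    and con: "\<forall>j\<in>{..<k}. \<forall>s\<in>S. \<forall>t\<in>S. (packing_edge C.E S colc ecolc j)\<^sup>*\<^sup>* s t"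
    unfolding packs_def by (elim exE conjE)
  define col where "col v = (if fst v p = c then colc v else k)" for v
  let ?F = "packing_edge E S col ecolc"
  have symF: "symp (?F j)" for j by (rule packing_edge_sym[OF E_sym]) (rule sym[rule_format])
  let ?K = "{v. fst v \<in> W \<and> fst v p \<noteq> c}"
  have out: "(?F k)\<^sup>*\<^sup>* u v" if "u \<in> ?K" "v \<in> ?K" for u v
  proof (rule rtranclp_mono'[OF linkedD[OF outside_linked[OF p] that]])
    fix x y assume "inside E ?K x y"
    then have xy: "E x y" "fst x p \<noteq> c" "fst y p \<noteq> c" by (auto simp: inside_def)
    then have "x \<notin> S" "y \<notin> S" using S(2) by blast+
    then show "?F k x y" using xy by (intro packing_edgeI) (auto simp: col_def)
  qed
  have exit: "\<exists>u\<in>?K. ?F k s u" if s: "s \<in> S" for s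
  proof -
    have sW: "fst s \<in> W" "fst s p = c" using S s by auto
    let ?u = "(nb ctr (fst s) c, snd s)"
    note ex = exit_props[OF sW(1) p, unfolded sW(2)]
    have u: "fst ?u \<in> W" "fst ?u p \<noteq> c" using ex A_W W_inj[OF sW(1) ctrI p(1)] p sW(2) by auto
    then have "?u \<notin> S" using S(2) by blast
    then have "?F k s ?u" using s u ex by (intro packing_edgeI) (auto simp: col_def E_def)
    then show ?thesis using u by blast
  qed
  have "(?F j)\<^sup>*\<^sup>* s t" if st: "s \<in> S" "t \<in> S" and j: "j \<in> {..<Suc k}" for s t j
  proof (cases "j = k")
    case True
    obtain u v where uv: "u \<in> ?K" "?F k s u" "v \<in> ?K" "?F k t v" using exit[OF st(1)] exit[OF st(2)] by blast
    have "(?F k)\<^sup>*\<^sup>* v t" using uv(4) rtranclp_symp[OF symF] by blast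
    then show ?thesis using out[OF uv(1,3)] uv(2) True by (meson converse_rtranclp_into_rtranclp rtranclp_trans)
  next
    case False
    then have "(packing_edge C.E S colc ecolc j)\<^sup>*\<^sup>* s t" using con st j by auto
    then show ?thesis
    proof (rule rtranclp_mono')
      fix x y assume "packing_edge C.E S colc ecolc j x y"
      then show "?F j x y" by (auto simp: packing_edge_def E_copy[OF p c] col_def split: if_splits)
    qed
  qed
  then show ?thesis unfolding packs_def using sym by (intro exI[of _ col] exI[of _ ecolc]) blast
qed

text \<open>The pair in copy \<open>c\<close> only has to send out arms. The pair in copy
  \<open>d\<close> also needs a core there, and the exceptional case \<open>ne\<close> is inherited
  from that core.\<close>

lemma packs_two_pairs:
  assumes p: "p \<in> I" "p \<noteq> ctr" and q: "q \<in> I" "q \<noteq> ctr" "q \<noteq> p"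
    and cd: "c \<in> V" "d \<in> V" "d \<noteq> c"
    and X: "fst ` X \<subseteq> W" "\<And>x. x \<in> X \<Longrightarrow> fst x p = c" "finite X" "card X \<le> 2"
    and fg: "f \<in> W" "g \<in> W" "f p = d" "g p = d"
    and ne: "\<not> (f = g \<and> b \<noteq> b' \<and> f ctr = c)"
  shows "packs E (X \<union> {(f, b), (g, b')}) (V - {c})"
proof -
  interpret C: star ctr "I - {p}" "V - {c}" "h(p := c)" using star_copy[OF p cd(1)] .
  interpret D: star ctr "I - {p}" "V - {d}" "h(p := d)" using star_copy[OF p cd(2)] .
  have q': "q \<in> I - {p}" using q by simp
  have fgD: "f \<in> D.W" "g \<in> D.W" using fg by (auto simp: W_copy[OF p cd(2)])
  have c': "c \<in> V - {d}" using cd by auto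
  show ?thesis
  proof (rule packs_two_copies[OF p cd X(1,2)])
    show "fst ` {(f, b), (g, b')} \<subseteq> W" using fg by simp
    show "fst z p = d" if "z \<in> {(f, b), (g, b')}" for z using that fg by auto
    have "fst ` X \<subseteq> C.W" using X(1,2) by (auto simp: W_copy[OF p cd(1)])
    then show "C.arms X {}" using X by (intro C.arms_upto2) auto
    show "D.core_data {(f, b), (g, b')} c"
    proof (cases "b = b'")
      case True
      then show ?thesis using D.core_data_one_layer[OF q' q(2) fgD c'] by simp
    next
      case False
      then have "b' = (\<not> b)" by auto
      then show ?thesis using D.core_data_two_layers[OF q' q(2) fgD c'] ne by simp
    qed
  qed
qed

text \<open>Compare both sides of \<open>conf\<close> at \<open>q\<close>. The left side keeps the
  value of \<open>z\<close> there unless this is \<open>fst w p\<close>, and the right side keeps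
  the value of \<open>w\<close> unless this is \<open>fst z p\<close>.\<close>

lemma conf_shared_position:
  assumes q: "q \<in> I" "q \<noteq> ctr" "q \<noteq> p" and p: "p \<in> I" "p \<noteq> ctr"
    and W: "fst z \<in> W" "fst w \<in> W" and conf: "conf p z w" and ne: "fst z q \<noteq> fst w q"
  shows "fst z q = fst w p \<or> fst w q = fst z p"
proof -
  let ?f = "fst z" let ?g = "fst w"
  have V: "?g p \<in> V" "?f p \<in> V" using W W_V p by auto
  have f: "?f q \<noteq> ?f p" "?f ctr \<noteq> ?f p" using W_inj[OF W(1)] q p ctrI by auto
  have "nb ctr (nb ctr ?f (?g p)) (?f p) q = nb ctr ?g (?f p) q"
    using conf unfolding conf_def by simp
  then show ?thesis
    using nb_at[OF W_nb[OF W(1) V(1)] q(1,2), of "?f p"] nb_at[OF W(1) q(1,2), of "?g p"]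
      nb_at[OF W(2) q(1,2), of "?f p"] f ne by (auto split: if_splits)
qed

text \<open>The cases are the ways in which the values at a non-central position can split
  \<open>S\<close>: 4, 3+1, 2+2, 2+1+1, or four distinct values at every such position. Copy
  \<open>c\<close> only sends out arms and keeps no core, so a largest class is put there.\<close>

theorem packs_four_step:
  assumes I3: "card I \<ge> 3" and S: "fst ` S \<subseteq> W" "card S = 4"
    and IH: "\<And>p c. p \<in> I \<Longrightarrow> p \<noteq> ctr \<Longrightarrow> c \<in> V \<Longrightarrow> (\<And>s. s \<in> S \<Longrightarrow> fst s p = c) \<Longrightarrow>
      packs (star.E ctr (I - {p}) (V - {c}) (h(p := c))) S {..<card V - 2}"
  shows "packs E S {..<card V - 1}"
proof -
  have finS: "finite S" using S(2) card.infinite by fastforce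
  have cV: "card V \<ge> 5" using I3 cardV by simp
  define fib where "fib p c = {s \<in> S. fst s p = c}" for p c
  have fibS: "fib p c \<subseteq> S" "finite (fib p c)" for p c using finS by (auto simp: fib_def)
  have other_pos: "\<exists>q. q \<in> I \<and> q \<noteq> ctr \<and> q \<noteq> p" for p
  proof -
    have "card {ctr, p} \<le> 2" by (simp add: card_insert_if)
    then have "\<not> I \<subseteq> {ctr, p}" using I3 card_mono[of "{ctr, p}" I] by auto
    then show ?thesis by blast
  qed
  have sW: "fst s \<in> W" "p \<in> I \<Longrightarrow> fst s p \<in> V" if "s \<in> S" for s p using that S(1) W_V by auto
  have fibV: "c \<in> V" if pI: "p \<in> I" and ne: "fib p c \<noteq> {}" for p c
  proof -
    obtain s where "s \<in> S" "fst s p = c" using ne by (auto simp: fib_def)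
    then show ?thesis using sW(2)[OF _ pI] by blast
  qed
  have colours: "packs E S {..<card V - 1}" if "packs E S (V - {c})" "c \<in> V" for c
    using packs_recolour[OF that(1)] finite_same_card_bij[of "V - {c}" "{..<card V - 1}"] finV that(2) by auto
  have singles: "packs E S (V - {c})"
    if p: "p \<in> I" "p \<noteq> ctr" and c: "c \<in> V" and Z: "Z = S - fib p c" and inj: "inj_on (\<lambda>s. fst s p) Z"
      and m: "m \<in> Z"
      and noconf: "\<And>z w. z \<in> Z \<Longrightarrow> w \<in> Z \<Longrightarrow> z \<noteq> m \<Longrightarrow> w \<noteq> m \<Longrightarrow> z \<noteq> w \<Longrightarrow> \<not> conf p z w"
      and arms: "star.arms ctr (I - {p}) (V - {c}) (h(p := c)) (fib p c)
        {(nb ctr (fst z) (fst z p), \<not> snd z) | z. z \<in> {z \<in> Z. z \<noteq> m \<and> snd z = snd m \<and> conf p z m}}"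
    for p c Z m
  proof -
    obtain q where q: "q \<in> I" "q \<noteq> ctr" "q \<noteq> p" using other_pos by blast
    have "packs E (fib p c \<union> Z) (V - {c})"
    proof (rule packs_singles[OF p q c _ _ _ _ _ m noconf refl arms])
      show "fst ` fib p c \<subseteq> W" using S(1) fibS(1)[of p c] by blast
      show "fst ` Z \<subseteq> W" using S(1) Z by blast
      show "z = w" if "z \<in> Z" "w \<in> Z" "fst z p = fst w p" for z w using inj that by (auto dest: inj_onD)
    qed (use Z in \<open>auto simp: fib_def\<close>)
    then show ?thesis using Z fibS(1)[of p c] by (simp add: Un_absorb1)
  qed
  have sub_W: "fst ` fib p c \<subseteq> star.W (I - {p}) (V - {c}) (h(p := c))"
    if "p \<in> I" "p \<noteq> ctr" "c \<in> V" for p c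
    using S(1) by (auto simp: W_copy[OF that] fib_def)
  consider (four) p c where "p \<in> I" "p \<noteq> ctr" "\<forall>s\<in>S. fst s p = c"
    | (three) p c where "p \<in> I" "p \<noteq> ctr" "card (fib p c) = 3"
    | (pairs) p c d where "p \<in> I" "p \<noteq> ctr" "c \<noteq> d" "card (fib p c) = 2" "card (fib p d) = 2"
        "\<not> (\<exists>q c. q \<in> I \<and> q \<noteq> ctr \<and> (\<forall>s\<in>S. fst s q = c))"
    | (pair) p c where "p \<in> I" "p \<noteq> ctr" "card (fib p c) = 2" "\<And>d. d \<noteq> c \<Longrightarrow> card (fib p d) \<noteq> 2"
    | (none) "\<And>p c. p \<in> I \<Longrightarrow> p \<noteq> ctr \<Longrightarrow> card (fib p c) \<le> 1"
  proof -
    have sizes: "card (fib p c) \<le> 1 \<or> card (fib p c) = 2 \<or> card (fib p c) = 3 \<or> fib p c = S" for p c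
    proof -
      have "card (fib p c) \<le> 4" using card_mono[OF finS fibS(1)] S(2) by metis
      moreover have "fib p c = S" if "card (fib p c) = 4"
        using card_subset_eq[OF finS fibS(1)] that S(2) by metis
      ultimately show ?thesis by linarith
    qed
    have all: "\<forall>s\<in>S. fst s p = c" if "fib p c = S" for p c using that by (auto simp: fib_def)
    let ?c4 = "\<exists>p c. p \<in> I \<and> p \<noteq> ctr \<and> (\<forall>s\<in>S. fst s p = c)"
    let ?c3 = "\<exists>p c. p \<in> I \<and> p \<noteq> ctr \<and> card (fib p c) = 3"
    let ?c22 = "\<exists>p c d. p \<in> I \<and> p \<noteq> ctr \<and> c \<noteq> d \<and> card (fib p c) = 2 \<and> card (fib p d) = 2"
    let ?c2 = "\<exists>p c. p \<in> I \<and> p \<noteq> ctr \<and> card (fib p c) = 2"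
    consider "?c4" | "?c3" | "\<not> ?c4" "?c22" | "\<not> ?c22" "?c2" | "\<not> ?c4" "\<not> ?c3" "\<not> ?c2" by argo
    then show ?thesis
    proof cases
      case 1
      then show ?thesis using that(1) by blast
    next
      case 2
      then show ?thesis using that(2) by blast
    next
      case 3
      from 3(2) obtain p c d where "p \<in> I" "p \<noteq> ctr" "c \<noteq> d" "card (fib p c) = 2" "card (fib p d) = 2" by blast
      then show ?thesis using that(3) 3(1) by presburger
    next
      case 4
      from 4(2) obtain p c where "p \<in> I" "p \<noteq> ctr" "card (fib p c) = 2" by blast
      then show ?thesis using that(4)[of p c] 4(1) by blast
    next
      case 5
      have "card (fib p c) \<le> 1" if "p \<in> I" "p \<noteq> ctr" for p c
        using 5 sizes[of p c] all[of p c] that by blast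
      then show ?thesis using that(5) by blast
    qed
  qed
  then show ?thesis
  proof cases
    case four
    have "S \<noteq> {}" using S(2) by auto
    then have "fib p c \<noteq> {}" using four by (auto simp: fib_def)
    then have c: "c \<in> V" using fibV four by blast
    have val: "\<And>s. s \<in> S \<Longrightarrow> fst s p = c" using four(3) by blast
    have "packs E S {..<Suc (card V - 2)}"
      by (rule packs_one_copy[OF four(1,2) c S(1) val IH[OF four(1,2) c val]])
    then show ?thesis using cV by (simp add: Suc_diff_Suc numeral_2_eq_2)
  next
    case three
    have "fib p c \<noteq> {}" using three by auto
    then have c: "c \<in> V" using fibV three by blast
    interpret C: star ctr "I - {p}" "V - {c}" "h(p := c)" using star_copy[OF three(1,2) c] .
    obtain q where q: "q \<in> I - {p}" "q \<noteq> ctr" using other_pos by blast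
    have "C.all_arms (fib p c)"
      using three fibS sub_W[OF three(1,2) c] by (intro C.all_arms_upto3[OF q]) auto
    then have arms0: "C.arms (fib p c) {}" by (rule C.arms_of_all_arms)
    have "card (S - fib p c) = 1" using three S(2) fibS by (simp add: card_Diff_subset)
    then obtain w where w: "S - fib p c = {w}" by (auto simp: card_1_singleton_iff)
    \<comment> \<open>With one member outside copy \<open>c\<close> there is no conflict, hence no
      forbidden end.\<close>
    have "{(nb ctr (fst z) (fst z p), \<not> snd z) | z. z \<in> {z \<in> {w}. z \<noteq> w \<and> snd z = snd w \<and> conf p z w}} = {}"
      by blast
    with arms0 have arms1: "C.arms (fib p c)
        {(nb ctr (fst z) (fst z p), \<not> snd z) | z. z \<in> {z \<in> {w}. z \<noteq> w \<and> snd z = snd w \<and> conf p z w}}"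
      by (simp only:)
    have "packs E S (V - {c})"
      by (rule singles[OF three(1,2) c w[symmetric] _ _ _ arms1]) auto
    then show ?thesis using colours c by blast
  next
    case pairs
    have "fib p c \<noteq> {}" "fib p d \<noteq> {}" using pairs by auto
    then have cd: "c \<in> V" "d \<in> V" using fibV pairs by blast+
    have "fib p c \<inter> fib p d = {}" using pairs(3) by (auto simp: fib_def)
    then have "card (fib p c \<union> fib p d) = 4" using pairs fibS by (simp add: card_Un_disjoint)
    then have Seq: "S = fib p c \<union> fib p d" using card_subset_eq[OF finS, of "fib p c \<union> fib p d"] fibS S(2) by simp
    obtain q where q: "q \<in> I" "q \<noteq> ctr" "q \<noteq> p" using other_pos by blast
    obtain z w where zw: "fib p d = {z, w}" "z \<noteq> w" using pairs(5) by (auto simp: card_2_iff)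
    obtain x y where xy: "fib p c = {x, y}" "x \<noteq> y" using pairs(4) by (auto simp: card_2_iff)
    have mem: "x \<in> S" "y \<in> S" "z \<in> S" "w \<in> S" using zw xy fibS by blast+
    have val: "fst x p = c" "fst y p = c" "fst z p = d" "fst w p = d" using zw xy by (auto simp: fib_def)
    have fibW: "fst ` fib p' c' \<subseteq> W" for p' c' using S(1) fibS by blast
    show ?thesis
    proof (cases "fst z = fst w \<and> fst z ctr = c")
      case False
      have "packs E (fib p c \<union> {(fst z, snd z), (fst w, snd w)}) (V - {c})"
        using pairs False fibW fibS sW(1)[OF mem(3)] sW(1)[OF mem(4)] val
        by (intro packs_two_pairs[OF pairs(1,2) q cd]) (auto simp: fib_def)
      then show ?thesis using colours[OF _ cd(1)] Seq zw by simp
    next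
      case exz: True
      show ?thesis
      proof (cases "fst x = fst y \<and> fst x ctr = d")
        case False
        have "packs E (fib p d \<union> {(fst x, snd x), (fst y, snd y)}) (V - {d})"
          using pairs False fibW fibS sW(1)[OF mem(1)] sW(1)[OF mem(2)] val
          by (intro packs_two_pairs[OF pairs(1,2) q cd(2,1)]) (auto simp: fib_def)
        then show ?thesis using colours[OF _ cd(2)] Seq xy by (simp add: Un_commute)
      next
        case exx: True
        \<comment> \<open>Both choices of the core pair are exceptional, so each pair is one
          function in both layers. At \<open>q\<close> the pairs still have two different values,
          because \<open>S\<close> is not constant there. The exception cannot recur: the centre
          value of \<open>z\<close> is \<open>fst x p\<close>, which differs from
          \<open>fst x q\<close>.\<close>
        define c' where "c' = fst x q"
        define d' where "d' = fst z q"
        have cd': "c' \<in> V" "d' \<in> V" using sW mem q by (auto simp: c'_def d'_def)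
        have S4: "S = {x, y, z, w}" using Seq zw xy by auto
        have ne: "d' \<noteq> c'"
        proof
          assume "d' = c'"
          then have "\<forall>s\<in>S. fst s q = c'" using S4 exx exz by (auto simp: c'_def d'_def)
          then show False using pairs(6) q by blast
        qed
        have "fst z ctr \<noteq> c'"
        proof
          assume "fst z ctr = c'"
          then have "fst x p = fst x q" using conjunct2[OF exz] val(1) c'_def by metis
          then show False using W_inj[OF sW(1)[OF mem(1)] pairs(1) q(1)] q by simp
        qed
        then have "packs E ({x, y} \<union> {(fst z, snd z), (fst w, snd w)}) (V - {c'})"
          using ne exx exz sW(1)[OF mem(1)] sW(1)[OF mem(2)] sW(1)[OF mem(3)] sW(1)[OF mem(4)] pairs xy(2)
          by (intro packs_two_pairs[OF q(1,2) pairs(1,2) q(3)[symmetric] cd']) (auto simp: c'_def d'_def)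
        then show ?thesis using colours[OF _ cd'(1)] S4 by (simp add: insert_commute)
      qed
    qed
  next
    case pair
    have "fib p c \<noteq> {}" using pair by auto
    then have c: "c \<in> V" using fibV pair by blast
    interpret C: star ctr "I - {p}" "V - {c}" "h(p := c)" using star_copy[OF pair(1,2) c] .
    have "card (S - fib p c) = 2" using pair S(2) fibS by (simp add: card_Diff_subset)
    then obtain z w where zw: "S - fib p c = {z, w}" "z \<noteq> w" by (auto simp: card_2_iff)
    have zwS: "z \<in> S" "w \<in> S" "z \<notin> fib p c" using zw(1) by blast+
    have "fst z p \<noteq> fst w p"
    proof
      assume eq: "fst z p = fst w p"
      have zc: "fst z p \<noteq> c" using zwS by (simp add: fib_def)
      have "fib p (fst z p) = {z, w}"
      proof
        show "fib p (fst z p) \<subseteq> {z, w}"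
        proof
          fix v assume "v \<in> fib p (fst z p)"
          then have "v \<in> S - fib p c" using zc by (simp add: fib_def)
          then show "v \<in> {z, w}" unfolding zw(1) .
        qed
        show "{z, w} \<subseteq> fib p (fst z p)" using zwS eq by (simp add: fib_def)
      qed
      then have "card (fib p (fst z p)) = 2" using zw(2) by simp
      then show False using pair(4)[OF zc] by blast
    qed
    then have inj: "inj_on (\<lambda>s. fst s p) {z, w}" by auto
    \<comment> \<open>Only \<open>z\<close> can be rerouted, so at most one end is
      forbidden.\<close>
    have arms0: "C.arms (fib p c) {(nb ctr (fst v) (fst v p), \<not> snd v) | v.
        v \<in> {v \<in> {z, w}. v \<noteq> w \<and> snd v = snd w \<and> conf p v w}}"
      by (rule C.arms_upto2[where a = "(nb ctr (fst z) (fst z p), \<not> snd z)"])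
        (use pair fibS sub_W[OF pair(1,2) c] in auto)
    have "packs E S (V - {c})"
      by (rule singles[OF pair(1,2) c zw(1)[symmetric] inj _ _ arms0]) auto
    then show ?thesis using colours c by blast
  next
    case none
    obtain p where p: "p \<in> I" "p \<noteq> ctr" using other_pos[of ctr] by blast
    obtain q where q: "q \<in> I" "q \<noteq> ctr" "q \<noteq> p" using other_pos by blast
    have inj: "fst s r \<noteq> fst s' r" if "r \<in> I" "r \<noteq> ctr" "s \<in> S" "s' \<in> S" "s \<noteq> s'" for r s s'
    proof
      assume "fst s r = fst s' r"
      then have "{s, s'} \<subseteq> fib r (fst s r)" using that by (auto simp: fib_def)
      then have "card {s, s'} \<le> card (fib r (fst s r))" using fibS by (intro card_mono) auto
      then show False using none[OF that(1,2), of "fst s r"] that(5) by simp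
    qed
    obtain s1 s2 s3 s4 where s: "S = {s1, s2, s3, s4}" "distinct [s1, s2, s3, s4]"
    proof -
      obtain s1 S1 where 1: "S = insert s1 S1" "s1 \<notin> S1" "card S1 = 3"
        using S(2) by (metis card_eq_SucD eval_nat_numeral(2) semiring_norm(26) semiring_norm(27))
      from 1(3) obtain s2 s3 s4 where 2: "S1 = {s2, s3, s4}" and d: "s2 \<noteq> s3" "s3 \<noteq> s4" "s2 \<noteq> s4"
        unfolding card_3_iff by blast
      have "distinct [s1, s2, s3, s4]" using 1(2) 2 d by simp
      moreover have "S = {s1, s2, s3, s4}" using 1(1) 2 by simp
      ultimately show ?thesis using that by blast
    qed
    \<comment> \<open>Pigeonhole: if \<open>s1\<close> conflicted with all three others, each of
      them would satisfy one of the two equations of \<open>conf_shared_position\<close>. As values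
      at \<open>p\<close> and at \<open>q\<close> are distinct, each equation holds for at most one
      of the three.\<close>
    have "\<exists>a b. a \<in> S \<and> b \<in> S \<and> a \<noteq> b \<and> \<not> conf p a b"
    proof (rule ccontr)
      assume "\<not> ?thesis"
      moreover have ms: "s1 \<in> S" "s2 \<in> S" "s3 \<in> S" "s4 \<in> S" "s2 \<noteq> s1" "s3 \<noteq> s1" "s4 \<noteq> s1"
        "s2 \<noteq> s3" "s2 \<noteq> s4" "s3 \<noteq> s4"
        using s by auto
      ultimately have all: "conf p s1 s2" "conf p s1 s3" "conf p s1 s4" by blast+
      have sh: "fst s1 q = fst b p \<or> fst b q = fst s1 p" if "b \<in> S" "b \<noteq> s1" "conf p s1 b" for b
      proof (rule conf_shared_position[OF q p _ _ that(3)])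
        have "s1 \<in> S" using s(1) by simp
        then show "fst s1 \<in> W" "fst b \<in> W" "fst s1 q \<noteq> fst b q"
          using sW(1) that inj[OF q(1,2), of s1 b] by auto
      qed
      have d: "fst s1 q = fst s2 p \<or> fst s2 q = fst s1 p" "fst s1 q = fst s3 p \<or> fst s3 q = fst s1 p"
        "fst s1 q = fst s4 p \<or> fst s4 q = fst s1 p" by (rule sh[OF ms(2,5) all(1)], rule sh[OF ms(3,6) all(2)], rule sh[OF ms(4,7) all(3)])
      have "fst s2 p \<noteq> fst s3 p" "fst s2 p \<noteq> fst s4 p" "fst s3 p \<noteq> fst s4 p"
        "fst s2 q \<noteq> fst s3 q" "fst s2 q \<noteq> fst s4 q" "fst s3 q \<noteq> fst s4 q"
        using inj[OF p] inj[OF q(1,2)] ms by blast+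
      then show False using d by metis
    qed
    then obtain a b where ab: "a \<in> S" "b \<in> S" "a \<noteq> b" "\<not> conf p a b" by blast
    have "card (S - {a, b}) = 2" using ab S(2) finS by (simp add: card_Diff_subset)
    \<comment> \<open>\<open>x\<close> names the copy without a core, and \<open>m\<close> is the
      member that is allowed conflicts; the remaining pair \<open>a\<close>, \<open>b\<close> has
      none.\<close>
    then obtain x m where xm: "S - {a, b} = {x, m}" "x \<noteq> m" by (auto simp: card_2_iff)
    have x: "x \<in> S" "m \<in> S" "x \<notin> {a, b}" "m \<notin> {a, b}" using xm by auto
    define c where "c = fst x p"
    have c: "c \<in> V" using sW x p by (simp add: c_def)
    interpret C: star ctr "I - {p}" "V - {c}" "h(p := c)" using star_copy[OF p c] .
    have fibx: "fib p c = {x}" unfolding fib_def c_def using inj[OF p] x(1) by blast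
    have Z: "{a, b, m} = S - fib p c" unfolding fibx using xm x ab by blast
    let ?R = "{z \<in> {a, b, m}. z \<noteq> m \<and> snd z = snd m \<and> conf p z m}"
    have arms0: "C.arms (fib p c) {(nb ctr (fst z) (fst z p), \<not> snd z) | z. z \<in> ?R}" (is "C.arms _ ?Y")
    proof (rule C.arms_nonadjacent)
      show "fst ` fib p c \<subseteq> C.W" using sub_W[OF p c] .
      show "\<not> C.A u w" if "(u, b') \<in> fib p c" "(w, b') \<in> fib p c" for u w b'
        using that fibx C.A_ctr[of u w] by auto
      show "(u, \<not> b') \<notin> ?Y" if u: "(u, b') \<in> ?Y" for u b'
      proof
        assume u': "(u, \<not> b') \<in> ?Y"
        obtain z where z: "u = nb ctr (fst z) (fst z p)" "b' = (\<not> snd z)" "z \<in> ?R" using u by blast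
        obtain z' where z': "u = nb ctr (fst z') (fst z' p)" "(\<not> b') = (\<not> snd z')" "z' \<in> ?R" using u' by blast
        \<comment> \<open>Two forbidden ends over one function share their centre value, so they
          come from the same copy and hence from the same member.\<close>
        have "fst z p = fst z' p" using z(1) z'(1) by (metis nb_ctr)
        moreover have "z \<in> S" "z' \<in> S" using z(3) z'(3) ab(1,2) x(2) by auto
        ultimately have "z = z'" using inj[OF p] by blast
        then show False using z(2) z'(2) by simp
      qed
    qed
    have "packs E S (V - {c})"
    proof (rule singles[OF p c Z _ _ _ arms0])
      show "inj_on (\<lambda>s. fst s p) {a, b, m}" using inj[OF p] ab x by (intro inj_onI) blast+
      show "\<not> conf p z w" if "z \<in> {a, b, m}" "w \<in> {a, b, m}" "z \<noteq> m" "w \<noteq> m" "z \<noteq> w" for z w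
        using that ab(4) conf_sym[of p b a] by auto
    qed auto
    then show ?thesis using colours c by blast
  qed
qed

end

section \<open>The base cases\<close>

text \<open>Each listed vertex must have a neighbour among the earlier ones, so connectedness is
  checked in one pass without a search.\<close>

fun grows :: "('a \<Rightarrow> 'a \<Rightarrow> bool) \<Rightarrow> 'a list \<Rightarrow> ('a \<times> 'a) list \<Rightarrow> 'a list \<Rightarrow> 'a list \<Rightarrow> bool" where
  "grows E s ss seen [] \<longleftrightarrow> (\<forall>x\<in>set s. x \<in> set seen)"
| "grows E s ss seen (v # vs) \<longleftrightarrow>
     (\<exists>u\<in>set seen. E u v \<and> (u \<in> set s \<and> v \<in> set s \<longrightarrow> (u, v) \<in> set ss)) \<and> grows E s ss (v # seen) vs"

text \<open>A certificate lists for each tree the vertices in an order of growth from the root \<open>hd s\<close>, and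
  its edges inside \<open>S\<close>.\<close>

definition certifies :: "('a \<Rightarrow> 'a \<Rightarrow> bool) \<Rightarrow> 'a list \<Rightarrow> ('a list \<times> ('a \<times> 'a) list) list \<Rightarrow> bool" where
  "certifies E s ts \<longleftrightarrow> (\<forall>(vs, ss)\<in>set ts. grows E s ss [hd s] vs) \<and>
     distinct (concat (map (\<lambda>(vs, ss). filter (\<lambda>v. v \<notin> set s) vs) ts)) \<and>
     distinct (concat (map (\<lambda>(vs, ss). ss @ map prod.swap ss) ts))"

lemma distinct_concat_index:
  assumes "distinct (concat (map f xs))" "i < length xs" "j < length xs" "x \<in> set (f (xs ! i))" "x \<in> set (f (xs ! j))"
  shows "i = j"
  using assms
proof (induction xs arbitrary: i j)
  case (Cons y ys)
  have "x \<notin> set (f y)" if "k < length ys" "x \<in> set (f (ys ! k))" for k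
  proof -
    have "x \<in> set (concat (map f ys))" using that nth_mem[OF that(1)] by auto
    then show ?thesis using Cons.prems(1) by auto
  qed
  then show ?case using Cons by (cases i; cases j) auto
qed simp

lemma certifies_packs:
  assumes E: "symp E" and s: "s \<noteq> []" and c: "certifies E s ts"
  shows "packs E (set s) {..<length ts}"
proof -
  let ?V = "\<lambda>i. set (filter (\<lambda>v. v \<notin> set s) (fst (ts ! i)))"
  let ?P = "\<lambda>i. set (snd (ts ! i) @ map prod.swap (snd (ts ! i)))"
  \<comment> \<open>The distinctness tests of the certificate make the index unique wherever one
    exists, so \<open>LEAST\<close> just picks the tree in question.\<close>
  define col where "col v = (LEAST i. i < length ts \<and> v \<in> ?V i)" for v
  define ecol where "ecol u v = (LEAST i. i < length ts \<and> (u, v) \<in> ?P i)" for u v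
  have colv: "col v = i" if "i < length ts" "v \<in> ?V i" for v i
    unfolding col_def
  proof (rule Least_equality)
    fix j assume "j < length ts \<and> v \<in> ?V j"
    then have "i = j" using c that unfolding certifies_def
      by (intro distinct_concat_index[of "\<lambda>(vs, ss). filter (\<lambda>v. v \<notin> set s) vs" ts i j v]) (auto simp: case_prod_beta)
    then show "i \<le> j" by simp
  qed (use that in simp)
  have ecole: "ecol u v = i" if "i < length ts" "(u, v) \<in> ?P i" for u v i
    unfolding ecol_def
  proof (rule Least_equality)
    fix j assume "j < length ts \<and> (u, v) \<in> ?P j"
    then have "i = j" using c that unfolding certifies_def
      by (intro distinct_concat_index[of "\<lambda>(vs, ss). ss @ map prod.swap ss" ts i j "(u, v)"]) (auto simp: case_prod_beta)
    then show "i \<le> j" by simp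
  qed (use that in simp)
  have sym: "ecol u v = ecol v u" for u v
  proof -
    have "(u, v) \<in> ?P i \<longleftrightarrow> (v, u) \<in> ?P i" for i by (force simp: image_iff)
    then show ?thesis unfolding ecol_def by simp
  qed
  let ?F = "packing_edge E (set s) col ecol"
  have symF: "symp (?F i)" for i by (rule packing_edge_sym[OF E sym])
  have grow: "(?F i)\<^sup>*\<^sup>* (hd s) x"
    if i: "i < length ts" and g: "grows E s (snd (ts ! i)) seen vs"
      and vs: "set vs \<subseteq> set (fst (ts ! i))"
      and seen: "\<And>u. u \<in> set seen \<Longrightarrow> (?F i)\<^sup>*\<^sup>* (hd s) u \<and> (u \<in> set s \<or> col u = i)"
      and x: "x \<in> set s" for i seen vs x
    using g vs seen
  proof (induction vs arbitrary: seen)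
    case Nil
    then show ?case using x by auto
  next
    case (Cons v vs)
    then obtain u where u: "u \<in> set seen" "E u v" "u \<in> set s \<and> v \<in> set s \<longrightarrow> (u, v) \<in> set (snd (ts ! i))"
      "grows E s (snd (ts ! i)) (v # seen) vs" by auto
    have v: "v \<in> set s \<or> col v = i" using colv[OF i, of v] Cons.prems(2) by auto
    have "?F i u v" using u v Cons.prems(3)[OF u(1)] ecole[OF i, of u v] by (intro packing_edgeI) auto
    then have "(?F i)\<^sup>*\<^sup>* (hd s) v" using Cons.prems(3)[OF u(1)] by (meson rtranclp.rtrancl_into_rtrancl)
    then show ?case using Cons.IH[OF u(4)] Cons.prems v by (metis set_ConsD set_subset_Cons subset_trans)
  qed
  have "(?F i)\<^sup>*\<^sup>* (hd s) x" if i: "i < length ts" and x: "x \<in> set s" for i x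
  proof (rule grow[OF i _ subset_refl _ x])
    show "grows E s (snd (ts ! i)) [hd s] (fst (ts ! i))"
      using c nth_mem[OF i] unfolding certifies_def by (auto simp: case_prod_beta)
    show "(?F i)\<^sup>*\<^sup>* (hd s) u \<and> (u \<in> set s \<or> col u = i)" if "u \<in> set [hd s]" for u
      using that s by auto
  qed
  then have "(?F i)\<^sup>*\<^sup>* x y" if "i < length ts" "x \<in> set s" "y \<in> set s" for i x y
    using that rtranclp_symp[OF symF] by (meson rtranclp_trans)
  then show ?thesis unfolding packs_def using sym
    by (intro exI[of _ col] exI[of _ ecol]) auto
qed

text \<open>A decision tree over the elements of \<open>vs\<close>: the candidate lists are split by
  whether they contain \<open>v\<close>, so all subsets of size \<open>k\<close> are treated without
  being enumerated against the whole table.\<close>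

fun covers :: "nat \<Rightarrow> 'a list list \<Rightarrow> 'a list \<Rightarrow> bool" where
  "covers 0 L vs \<longleftrightarrow> L \<noteq> []"
| "covers (Suc k) L [] \<longleftrightarrow> True"
| "covers (Suc k) L (v # vs) \<longleftrightarrow>
     covers k (filter (\<lambda>l. v \<in> set l) L) vs \<and> covers (Suc k) (filter (\<lambda>l. v \<notin> set l) L) vs"

lemma coversD:
  assumes "covers k L vs" "T \<subseteq> set vs" "card T = k"
  shows "\<exists>l\<in>set L. T \<subseteq> set l"
  using assms
proof (induction k L vs arbitrary: T rule: covers.induct)
  case (1 L vs)
  have "finite T" using 1(2) finite_subset by blast
  then have "T = {}" using 1(3) by simp
  then show ?case using 1(1) by (cases L) auto
next
  case (2 k L)
  then show ?case by simp
next
  case (3 k L v vs)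
  have fin: "finite T" using 3(4) finite_subset by blast
  show ?case
  proof (cases "v \<in> T")
    case True
    have "T - {v} \<subseteq> set vs" "card (T - {v}) = k" using 3(4,5) True fin by auto
    then obtain l where "l \<in> set L" "v \<in> set l" "T - {v} \<subseteq> set l" using 3(1)[of "T - {v}"] 3(3) by auto
    then show ?thesis using True by blast
  next
    case False
    then have "T \<subseteq> set vs" using 3(4) by auto
    then show ?thesis using 3(2)[of T] 3(3,5) by auto
  qed
qed

section \<open>Encoded graphs and certificate tables\<close>

type_synonym bits = "bool \<times> bool"
type_synonym vtx = "bits \<times> bits \<times> bool"

text \<open>For \<open>n = 4\<close> a vertex of the star model is given by its centre value, its value at the other
  position and its layer. Values are encoded by two bits; a vertex is named by the character whose
  five low bits are the concatenation of these data. For \<open>n = 3\<close> the vertices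
  with second value 3 are used.\<close>

fun vtx_of :: "char \<Rightarrow> vtx" where
  "vtx_of (Char b0 b1 b2 b3 b4 b5 b6 b7) = ((b0, b1), (b2, b3), b4)"

fun adj4 :: "vtx \<Rightarrow> vtx \<Rightarrow> bool" where
  "adj4 (a, t, b) (a', t', b') \<longleftrightarrow> a \<noteq> t \<and> a' \<noteq> t' \<and>
     (if b = b' then t = t' \<and> a \<noteq> a' \<or> a = t' \<and> t = a' else a = a' \<and> t = t')"

fun adj3 :: "vtx \<Rightarrow> vtx \<Rightarrow> bool" where
  "adj3 (a, t, b) (a', t', b') \<longleftrightarrow> t = (True, True) \<and> t' = (True, True) \<and> adj4 (a, t, b) (a', t', b')"

fun pairs_of :: "'a list \<Rightarrow> ('a \<times> 'a) list" where
  "pairs_of (x # y # zs) = (x, y) # pairs_of zs"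
| "pairs_of _ = []"

definition decode :: "string \<times> (string \<times> string) list \<Rightarrow> vtx list \<times> (vtx list \<times> (vtx \<times> vtx) list) list" where
  "decode = (\<lambda>(s, ts). (map vtx_of s, map (\<lambda>(vs, ss). (map vtx_of vs, pairs_of (map vtx_of ss))) ts))"

definition checked :: "(vtx \<Rightarrow> vtx \<Rightarrow> bool) \<Rightarrow> nat \<Rightarrow> string \<times> (string \<times> string) list \<Rightarrow> bool" where
  "checked E r c \<longleftrightarrow> (let (s, ts) = decode c in s \<noteq> [] \<and> distinct s \<and> length s = 4 \<and> length ts = r \<and> certifies E s ts)"

definition bits_list :: "bits list" where
  "bits_list = [(False, False), (True, False), (False, True), (True, True)]"

definition vtxs4 :: "vtx list" where
  "vtxs4 = [(a, t, b). a \<leftarrow> bits_list, t \<leftarrow> bits_list, b \<leftarrow> [False, True], a \<noteq> t]"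

definition vtxs3 :: "vtx list" where
  "vtxs3 = [(a, (True, True), b). a \<leftarrow> bits_list, b \<leftarrow> [False, True], a \<noteq> (True, True)]"

text \<open>One entry for each of the 15 four-element subsets of the six vertices. After the subset
  come two trees, each given by its vertices after the root and its edges inside the subset as
  consecutive pairs of characters.\<close>

definition table3 :: "(string \<times> (string \<times> string) list) list" where
  "table3 = [
   (''lmn|'', [(''|nm'', ''l|lnnm''), (''m}|~n'', ''lm'')]),
   (''lmn}'', [(''|n}m'', ''lnnm''), (''m}~n'', ''lmm}'')]),
   (''lmn~'', [(''m}~n'', ''lm~n''), (''|n~m'', ''lnnm'')]),
   (''lm|}'', [(''|n}m'', ''l||}''), (''m}~|'', ''lmm}'')]),
   (''lm|~'', [(''|m}~'', ''l|lm''), (''n~m|'', ''~|'')]),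
   (''lm}~'', [(''m}~'', ''lmm}}~''), (''|n}~m'', '''')]),
   (''ln|}'', [(''|n~}'', ''l|ln''), (''m}n|'', ''}|'')]),
   (''ln|~'', [(''n~}|'', ''lnn~''), (''|m~n'', ''l||~'')]),
   (''ln}~'', [(''|m}~n'', ''''), (''n~}'', ''lnn~~}'')]),
   (''l|}~'', [(''|n~}'', ''l|~}''), (''m}|~'', ''}||~'')]),
   (''mn|}'', [(''l|n}'', ''|}''), (''}n~|'', ''m}mn'')]),
   (''mn|~'', [(''}n|~'', ''mn''), (''l|n~'', ''|~'')]),
   (''mn}~'', [(''}n|~'', ''m}mn''), (''ln~}'', ''n~~}'')]),
   (''m|}~'', [(''}l|~'', ''m}|~''), (''n~}|'', ''~}}|'')]),
   (''n|}~'', [(''~}|'', ''n~~}}|''), (''lm|}~'', ''|~'')])]"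

text \<open>Every listed set contains \<open>d\<close>, which encodes \<open>hd vtxs4\<close>. Up to
  permuting the four values and flipping the layers these sets represent all four-element sets; each
  comes with three trees.\<close>

definition table4 :: "(string \<times> (string \<times> string) list) list" where
  "table4 = [
   (''dhla'', [(''tqarxhknl'', ''''), (''gmlcabh'', ''''), (''afiyh{~|l'', ''da'')]),
   (''dhli'', [(''abchli'', ''hi''), (''fikhnl'', ''''), (''tvyixhrs|l'', '''')]),
   (''dhlt'', [(''aqbcthl'', ''''), (''tfihknl'', ''dt''), (''gwmtl|srxh'', '''')]),
   (''dhlq'', [(''aqbchl'', ''''), (''tqs|lnkh'', ''''), (''fgimhlxrq'', '''')]),
   (''dhly'', [(''tavbcyhl'', ''''), (''fiyhknl'', ''''), (''gw}|lsrxhy'', '''')]),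
   (''dhai'', [(''fikhnlca'', ''''), (''tqvayixh'', ''''), (''abhi'', ''dahi'')]),
   (''dham'', [(''gmlcabh'', ''''), (''afihknm'', ''da''), (''tqwar}xmh'', '''')]),
   (''dhab'', [(''tqarbxh'', ''''), (''abh'', ''daabbh''), (''fihknlcab'', '''')]),
   (''dhaf'', [(''gmflnckah'', ''''), (''tqarxhif'', ''''), (''afbh'', ''dadf'')]),
   (''dhan'', [(''fihbacln'', ''''), (''agmnkh'', ''da''), (''tqarxh{~n'', '''')]),
   (''dhac'', [(''tqarsxch'', ''''), (''gmlnckah'', ''ca''), (''abhc'', ''da'')]),
   (''dhag'', [(''gmnkhba'', ''dg''), (''afigh'', ''da''), (''tqwargxh'', '''')]),
   (''dhak'', [(''afihk'', ''da''), (''tqwa}~{kh'', ''kh''), (''gmlnckabh'', '''')]),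
   (''dhat'', [(''tabh'', ''dtda''), (''fvithqa'', ''''), (''gwmtlnckah'', '''')]),
   (''dhax'', [(''gmlnckahx'', ''hx''), (''abrhx'', ''da''), (''tfqiayhx'', '''')]),
   (''dha|'', [(''gmln|ckah'', ''''), (''afihx{~|'', ''da''), (''tqwa}b|h'', '''')]),
   (''dhaq'', [(''afqih'', ''daaq''), (''tqrbha'', ''''), (''gmlncksahq'', '''')]),
   (''dhay'', [(''gwvy{khba'', ''''), (''afiyh'', ''da''), (''tqarxhy'', '''')]),
   (''dha}'', [(''afcish|}'', ''da''), (''gm}nkhba'', ''''), (''tqwar}xh'', '''')]),
   (''dhar'', [(''abrh'', ''da''), (''tqarxh'', ''''), (''gmln|cksahr'', '''')]),
   (''dhav'', [(''tqvabh'', ''''), (''gwmvlycxah'', ''''), (''afvih'', ''da'')]),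
   (''dha~'', [(''fiyh{b~a'', ''''), (''acln~kh'', ''da''), (''tqarsx|h~'', '''')]),
   (''dhas'', [(''gw}|srbha'', ''''), (''acslnkh'', ''da''), (''tfqiash'', '''')]),
   (''dhaw'', [(''afviwh'', ''da''), (''tqwarxh'', ''''), (''gwmlcabh'', '''')]),
   (''dha{'', [(''gmlcabhk{'', ''''), (''tqarxh{'', ''''), (''afiyh{'', ''da'')]),
   (''dhim'', [(''fgimh'', ''ih''), (''abhkinm'', ''''), (''tvwy}ixmh'', '''')]),
   (''dhif'', [(''fikh'', ''dffi''), (''tvfyixh'', ''''), (''agbfhi'', ''hi'')]),
   (''dhin'', [(''tvyix{h~n'', ''''), (''abhkin'', ''''), (''fgimhn'', ''ih'')]),
   (''dhic'', [(''tqrsxchyi'', ''''), (''fihbc'', ''ih''), (''aclnkhi'', '''')]),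
   (''dhig'', [(''fvigyxh'', ''''), (''gmnkhi'', ''dg''), (''tawbghi'', ''hi'')]),
   (''dhik'', [(''fikh'', ''ikkh''), (''tvyix{hk'', ''''), (''agbmhnik'', ''hi'')]),
   (''dhit'', [(''tfih'', ''dtih''), (''gwmtnkhi'', ''''), (''aqbthvyi'', '''')]),
   (''dhix'', [(''fik{hx'', ''''), (''tqrbxhi'', ''hi''), (''gwvyixh'', ''xh'')]),
   (''dhi|'', [(''tvyixhrs|'', ''''), (''abchli|'', ''hi''), (''fgimk}h|'', '''')]),
   (''dhiq'', [(''aqbhi'', ''hi''), (''tgqmnkhi'', ''''), (''fviyxhrq'', '''')]),
   (''dhiy'', [(''abhxyi'', ''yi''), (''tw}~{kyhi'', ''''), (''fviyh'', ''ih'')]),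
   (''dhi}'', [(''tvwy}ixh'', ''''), (''abrhsk|i}'', ''''), (''fgimh}'', ''ih'')]),
   (''dhir'', [(''tvyixhr'', ''''), (''fihbr'', ''ih''), (''agqmrnkhi'', '''')]),
   (''dhiv'', [(''gwvyixh'', ''''), (''fvikh'', ''''), (''tavbhi'', ''hi'')]),
   (''dhi~'', [(''abhxy{i~'', ''''), (''tfwi}h~'', ''ih''), (''gmn~khi'', '''')]),
   (''dhis'', [(''tqs|lnkhi'', ''''), (''fiyxhrs'', ''''), (''abchsi'', ''hi'')]),
   (''dhiw'', [(''gw}~nkhi'', ''''), (''tawbhi'', ''hi''), (''fviywxh'', '''')]),
   (''dhi{'', [(''fihx{'', ''ih''), (''gmnk{hi'', ''''), (''tavbyhi{'', '''')]),
   (''dhmn'', [(''fiyh{~n}m'', ''''), (''abchlmn'', ''''), (''gmnkh'', ''mn'')]),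
   (''dhmc'', [(''fviwh}mlc'', ''''), (''agbcmh'', ''''), (''tqrsxchknm'', '''')]),
   (''dhmg'', [(''fighm'', ''gm''), (''tqwrg}xmh'', ''''), (''agbhknm'', ''dg'')]),
   (''dhmk'', [(''tgvmyx{hk'', ''''), (''fihknm'', ''''), (''abchlkm'', ''hk'')]),
   (''dhmt'', [(''fgvimth'', ''''), (''aqbcthlm'', ''''), (''tw}mnkh'', ''dt'')]),
   (''dhmx'', [(''abchlxm'', ''hx''), (''gmnk{hx'', ''''), (''fviywhx}m'', '''')]),
   (''dhm|'', [(''abchl|m'', ''''), (''gm}|srxh'', ''''), (''fihkn~m|'', '''')]),
   (''dhmq'', [(''gm}|sqrxh'', ''''), (''tfqihknm'', ''''), (''aqbchlm'', '''')]),
   (''dhmy'', [(''fviywh}m'', ''''), (''gmnk{hy'', ''''), (''aqbsh|xlym'', '''')]),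
   (''dhm}'', [(''abchl|m}'', ''''), (''fviwh}m'', ''}m''), (''gmn~k}h'', '''')]),
   (''dhmr'', [(''tvwy}xmhr'', ''''), (''agqmrnkh'', ''''), (''fihbrclm'', '''')]),
   (''dhmv'', [(''abchlxmyv'', ''''), (''fviwh}m'', ''''), (''tgvmnkh'', '''')]),
   (''dhm~'', [(''tw}m~{kh'', ''''), (''fgimhn~'', ''''), (''abrhs|l~m'', '''')]),
   (''dhms'', [(''tqws}mnkh'', ''''), (''abchslm'', ''''), (''fgimhxrs'', '''')]),
   (''dhmw'', [(''fviwh}m'', ''''), (''gwmnkh'', ''''), (''tawbchlm'', '''')]),
   (''dhm{'', [(''fgimyh{'', ''''), (''tqwr}xmh{'', ''''), (''abhk{nm'', '''')]),
   (''dhct'', [(''afcvith'', ''''), (''gwmtlcbh'', ''''), (''tqrsxch'', ''dt'')]),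
   (''dhc|'', [(''tqrsxc|h'', ''''), (''fihknl|c'', ''''), (''agbcwh}|'', '''')]),
   (''dhcq'', [(''afqcih'', ''''), (''gmlnckshq'', ''''), (''tqrbhc'', '''')]),
   (''dhcy'', [(''tqrsxchy'', ''''), (''gmlcbhk{y'', ''''), (''afciyh'', '''')]),
   (''dhc}'', [(''gm}l~c{kh'', ''''), (''tqsc|b}h'', ''''), (''afcviwh}'', '''')]),
   (''dhcs'', [(''gml|c~s{kh'', ''''), (''afcish'', ''cs''), (''tqrsbhc'', '''')]),
   (''dhcw'', [(''agbcwh'', ''''), (''tw}mlnckh'', ''''), (''fvywxhrsc'', '''')]),
   (''dhgk'', [(''gmnk{xh'', ''dg''), (''fighk'', ''''), (''tawbghk'', ''hk'')]),
   (''dhgt'', [(''aqbthwg'', ''''), (''gmnk{hyvt'', ''dg''), (''tfigh'', ''dt'')]),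
   (''dhgx'', [(''fvigyhx'', ''''), (''agbrhx'', ''dg''), (''twgmnkhx'', ''hx'')]),
   (''dhg|'', [(''agbrhs|'', ''dg''), (''fighml|'', ''''), (''tvwyg{k~h|'', '''')]),
   (''dhgq'', [(''tqwrgxh'', ''''), (''fighknl|sq'', ''''), (''agqbh'', ''dg'')]),
   (''dhgy'', [(''agbhxy'', ''dg''), (''tvwyg{kh'', ''''), (''figyh'', '''')]),
   (''dhg}'', [(''fighm}'', ''''), (''agbchl|}'', ''dg''), (''twg}~nkh'', '''')]),
   (''dhgr'', [(''tqwrgmnkh'', ''''), (''agbrh'', ''dg''), (''fighxr'', '''')]),
   (''dhgv'', [(''gwvyxh'', ''dg''), (''tavbhknmg'', ''''), (''fvigh'', '''')]),
   (''dhg~'', [(''figyh{~'', ''''), (''gmn~kh'', ''dg''), (''tawbg}h~'', '''')]),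
   (''dhgs'', [(''agbchs'', ''dg''), (''tvwygxhrs'', ''''), (''fighml|s'', '''')]),
   (''dhgw'', [(''fvigwh'', ''''), (''tqwrgbh'', ''wg''), (''gm}nwkh'', ''dg'')]),
   (''dhg{'', [(''figyh{'', ''''), (''abhk{nmg'', ''''), (''tgqrxh{'', ''dg'')]),
   (''dhtx'', [(''gwt}~{kxh'', ''''), (''fvityhx'', ''''), (''tqrxh'', ''dtxh'')]),
   (''dht|'', [(''aqbtsh|'', ''''), (''fvitwh}|'', ''''), (''tgmn~k|h'', ''dt'')]),
   (''dhtq'', [(''tvyxhrq'', ''dt''), (''aqbth'', ''qt''), (''fgiwht}|sq'', '''')]),
   (''dhty'', [(''tfiyh'', ''dt''), (''aqtrxhy'', ''''), (''gwtvy{kh'', '''')]),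
   (''dht}'', [(''aqbtsh|}'', ''''), (''tw}~nkh'', ''dt''), (''fgvimth}'', '''')]),
   (''dhtr'', [(''aqbtrh'', ''''), (''fgiwht}|sr'', ''''), (''tvyxhr'', ''dt'')]),
   (''dhtv'', [(''tfvih'', ''dt''), (''gwtvyxh'', ''''), (''aqbthv'', ''tv'')]),
   (''dht~'', [(''gwt}~nkh'', ''''), (''tqrxh{~'', ''dt''), (''afbcvhlt|~'', '''')]),
   (''dhts'', [(''fvithqs'', ''''), (''gwt}~{xhrs'', ''''), (''tabchs'', ''dt'')]),
   (''dhtw'', [(''aqbthw'', ''tw''), (''tgwmnkh'', ''dt''), (''fvitwh'', '''')]),
   (''dht{'', [(''tabhk{'', ''dt''), (''gwt}~{xh'', ''''), (''fvityh{'', '''')]),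
   (''dh|q'', [(''tqvy{k~h|'', ''''), (''fihxrqs|'', ''''), (''aqbchl|'', '''')]),
   (''dh|y'', [(''abhk{y~|'', ''''), (''tfqisyh|'', ''''), (''gw}v|yxh'', '''')]),
   (''dh|}'', [(''aqbsh|}'', ''|}''), (''gm}ln|kh'', ''''), (''tvyx{h~|}'', '''')]),
   (''dh|s'', [(''gwm}n|ksh'', ''|s''), (''tqrsxh{~|'', ''''), (''abchsl|'', '''')]),
   (''dh|w'', [(''taqwbsh|'', ''''), (''gwmln|kh'', ''''), (''fviwh}|'', '''')]),
   (''dhqy'', [(''tqw}~{kyh'', ''''), (''aqbhiy'', ''''), (''fvyxhrq'', '''')]),
   (''dhq}'', [(''gm}lcsbqh'', ''''), (''aqrxhkn~}'', ''''), (''tqvwy}ih'', '''')]),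
   (''dhqr'', [(''fgiwh}|sqr'', ''''), (''aqbrh'', ''''), (''tqrxh'', ''qr'')]),
   (''dhqv'', [(''fvihbrq'', ''''), (''agqw}v~{kh'', ''''), (''tqvyxh'', '''')]),
   (''dhq~'', [(''tqw}~{xh'', ''''), (''fihbrqs|~'', ''''), (''agqmn~kh'', '''')]),
   (''dhqs'', [(''gw}|srxqh'', ''''), (''tfqish'', ''qs''), (''aqbchs'', '''')]),
   (''dhqw'', [(''fviwh}|sq'', ''''), (''agqbwh'', ''''), (''tqwrxh'', '''')]),
   (''dhq{'', [(''gwmvly|i{shq'', ''''), (''tqrxh{'', ''''), (''aqbhk{'', '''')]),
   (''dhy}'', [(''aqrsx|hy}'', ''''), (''gm}~{kyh'', ''''), (''tfwi}yh'', '''')]),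
   (''dhyv'', [(''gwvy{kh'', ''vy''), (''fviyh'', ''''), (''tavbhxy'', '''')]),
   (''dhy~'', [(''tqvsy|x~h'', ''''), (''abhk{y~'', ''''), (''fgiwyh}~'', '''')]),
   (''dhys'', [(''fvyxhrs'', ''''), (''gm}|~s{kyh'', ''''), (''taqbshiy'', '''')]),
   (''dhyw'', [(''tqwrxhy'', ''''), (''fvyw{kh'', ''''), (''agbwhiy'', '''')]),
   (''dhy{'', [(''abhk{y'', ''{y''), (''fgiwyh}~{'', ''''), (''tqrxhy{'', '''')]),
   (''dh}~'', [(''abhx{~|}'', ''''), (''tfwi}h~'', ''}~''), (''gm}n~kh'', '''')]),
   (''dh}s'', [(''gm}n|ksh'', ''''), (''fihxr{s~}'', ''''), (''tawbc}hs'', '''')]),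
   (''dh}w'', [(''tawb}h'', ''w}''), (''fviywh{~}'', ''''), (''gwm}nkh'', '''')]),
   (''dh}{'', [(''abhk{~}'', ''''), (''tqwr}xh{'', ''''), (''fgimyh}{'', '''')]),
   (''dhw{'', [(''fviywh{'', ''''), (''agbwh}~{'', ''''), (''tqwrxh{'', '''')]),
   (''dabc'', [(''acb'', ''daaccb''), (''gmlnckhba'', ''ba''), (''tqarsbc'', '''')]),
   (''dabg'', [(''tqwargb'', ''''), (''agb'', ''dadgab''), (''fighbca'', '''')]),
   (''dabk'', [(''tqarbx{k'', ''''), (''gmlnckab'', ''''), (''abhk'', ''daab'')]),
   (''dabt'', [(''gwmtlcab'', ''''), (''tqarb'', ''dt''), (''afbvt'', ''daab'')]),
   (''dabx'', [(''abhx'', ''daab''), (''tqarbx'', ''''), (''gw}v|ylxcab'', '''')]),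
   (''dab|'', [(''gml|cab'', ''''), (''tqarsb|'', ''''), (''afbvw}|'', ''daab'')]),
   (''dabq'', [(''gml|csabq'', ''''), (''tqab'', ''qaab''), (''afihbrq'', ''da'')]),
   (''daby'', [(''tqarbxy'', ''''), (''abhiy'', ''daab''), (''fgvmylcab'', '''')]),
   (''dab}'', [(''acsb|}'', ''da''), (''fgimh}ba'', ''ba''), (''tqwar}b'', '''')]),
   (''dabr'', [(''tqarb'', ''rb''), (''abhxr'', ''daab''), (''gmlcsabr'', '''')]),
   (''dabv'', [(''gwvyxhba'', ''ba''), (''tqvarb'', ''''), (''afcvb'', ''da'')]),
   (''dab~'', [(''fihkbna~'', ''ba''), (''aclb|~'', ''da''), (''tqwar}b~'', '''')]),
   (''dabs'', [(''tqasb'', ''ab''), (''afihbrs'', ''da''), (''gmlcsab'', '''')]),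
   (''dabw'', [(''agbw'', ''daab''), (''fviwhbca'', ''''), (''tqwarb'', '''')]),
   (''dab{'', [(''aqrbx{'', ''da''), (''tw}m~l{cab'', ''''), (''fiyh{ba'', ''ba'')]),
   (''dank'', [(''tqarx{k~n'', ''''), (''agmnk'', ''dank''), (''fihkbacln'', '''')]),
   (''dant'', [(''gwmtnqa'', ''''), (''fvithkbna'', ''''), (''tacln'', ''dtda'')]),
   (''danx'', [(''gm}n|scrax'', ''''), (''afvyx{~n'', ''da''), (''tqabhxkn'', '''')]),
   (''dan|'', [(''gmln|ca'', ''''), (''afvw}|~n'', ''da''), (''tqasb|hkn'', '''')]),
   (''danr'', [(''acslrn'', ''da''), (''tgqmarn'', ''''), (''fihkbnra'', '''')]),
   (''dan~'', [(''fihkb{na~'', ''''), (''tgqman~'', ''n~''), (''acsl|n~'', ''da'')]),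
   (''dans'', [(''fihkxbnras'', ''''), (''acsln'', ''da''), (''tqwas}~n'', '''')]),
   (''dan{'', [(''agmnk{'', ''da''), (''tqvay{~n'', ''''), (''fihxb{acln'', '''')]),
   (''datq'', [(''afqvt'', ''daaq''), (''gwmtlcsaq'', ''''), (''tqrba'', ''dttq'')]),
   (''daty'', [(''tqabhiy'', ''dt''), (''afvty'', ''da''), (''gwmtlcsarxy'', '''')]),
   (''datr'', [(''tacsr'', ''dtda''), (''fvtyxrba'', ''''), (''gwtqar'', '''')]),
   (''datv'', [(''tfviknlca'', ''dt''), (''aqtv'', ''datv''), (''gwtvyxrba'', '''')]),
   (''dat~'', [(''tqas|~'', ''dt''), (''fvtyx{r~ba'', ''''), (''agwt}~'', ''da'')]),
   (''daxy'', [(''tqvayx'', ''yx''), (''gm}l~c{axy'', ''''), (''abhxiy'', ''da'')]),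
   (''dax}'', [(''fvywx}hba'', ''''), (''agm}~{x'', ''da''), (''tqarsx|}'', '''')]),
   (''daxr'', [(''tqarx'', ''rx''), (''acs|r~{x'', ''da''), (''fihxbra'', '''')]),
   (''daxv'', [(''fvihxba'', ''''), (''agwvyx'', ''da''), (''tqvarx'', '''')]),
   (''dax~'', [(''tqwa}~{x'', ''''), (''fihkxbna~'', ''''), (''acs|r~x'', ''da'')]),
   (''daxs'', [(''gmlncksahx'', ''''), (''abrxs'', ''da''), (''tqvasyx'', '''')]),
   (''daxw'', [(''gw}|scabhx'', ''''), (''tqwarx'', ''''), (''afvywx'', ''da'')]),
   (''dax{'', [(''tqvayx{'', ''''), (''abhxk{'', ''da''), (''gm}l~c{ax'', ''{x'')]),
   (''dars'', [(''abrs'', ''dars''), (''tqars'', ''''), (''fihkxnrlcsa'', '''')]),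
   (''darw'', [(''afvywxr'', ''da''), (''tqwar'', ''''), (''gw}|scra'', '''')]),
   (''dar{'', [(''gmlncksa{r'', ''''), (''abrx{'', ''da''), (''tqvary{'', '''')]),
   (''da~{'', [(''fik{n~lca'', ''''), (''tqvasy|{~'', ''''), (''agm}~{'', ''da~{'')]),
   (''dibc'', [(''abclnki'', ''''), (''fihbc'', ''bc''), (''tvyixrbsc'', '''')]),
   (''dibt'', [(''gwmtlcbhi'', ''''), (''tvyixrb'', ''dt''), (''afqbit'', '''')]),
   (''dibx'', [(''abhxi'', ''''), (''tvyixrb'', ''''), (''fik{nxlcb'', '''')]),
   (''dib|'', [(''gmln|ckbi'', ''''), (''tfwi}h|b'', ''''), (''abrxsy|i'', '''')]),
   (''dibs'', [(''fihbrs'', ''''), (''gmlncksbi'', ''''), (''taqvbsyi'', '''')]),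
   (''dinc'', [(''tqws}c~n{yi'', ''''), (''agbcmhni'', ''''), (''fiknlc'', '''')]),
   (''dint'', [(''tvyi{~n'', ''dt''), (''fgiwmtn'', ''''), (''aqbthikn'', '''')]),
   (''dinx'', [(''fik{nx'', ''''), (''acslrnxhi'', ''''), (''tgvmynix'', '''')]),
   (''din|'', [(''fgiwk}n|'', ''''), (''tqvsy|i~n'', ''''), (''abchli|n'', '''')]),
   (''dinq'', [(''aqclnki'', ''''), (''tqvyi{~n'', ''''), (''fgimhnxrq'', '''')]),
   (''diny'', [(''tvy{kin'', ''''), (''abchlxiny'', ''''), (''fgimyn'', ''iy'')]),
   (''din}'', [(''gm}nki'', ''''), (''fviw}~n'', ''''), (''abchli|n}'', '''')]),
   (''dinr'', [(''fik{nxr'', ''''), (''tgqvmryni'', ''''), (''abcrhlin'', '''')]),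
   (''dinv'', [(''gwmvnyi'', ''''), (''tavbchlin'', ''''), (''fvikn'', '''')]),
   (''din~'', [(''gm}n~ki'', ''''), (''fiy{~n'', ''~n''), (''abchli|n~'', '''')]),
   (''dins'', [(''afcisln'', ''''), (''tqvsy|i~n'', ''''), (''gmnkhibrs'', '''')]),
   (''dinw'', [(''tawbchlin'', ''''), (''fiy{~n}w'', ''''), (''gwmnki'', '''')]),
   (''din{'', [(''fik{n'', ''''), (''tvyi{~n'', ''''), (''agbmhnxi{'', '''')]),
   (''digt'', [(''twg}~nki'', ''dt''), (''agqbthi'', ''dg''), (''fvigt'', '''')]),
   (''digx'', [(''tvwygix'', ''''), (''figk{x'', ''''), (''agqrxhi'', ''dg'')]),
   (''dig|'', [(''afcigs|'', ''''), (''tvwyg}i|'', ''''), (''gmn~k|i'', ''dg'')]),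
   (''digq'', [(''aqbhiknmg'', ''''), (''tfqig'', ''''), (''gwvyixrq'', ''dg'')]),
   (''digy'', [(''figy'', ''iy''), (''gmnk{iy'', ''dg''), (''tvwygxhi'', '''')]),
   (''digr'', [(''tqvwrygi'', ''''), (''gmnk{ixr'', ''dg''), (''afbigr'', '''')]),
   (''digv'', [(''tavbhiknmg'', ''''), (''fvig'', ''''), (''gwvyi'', ''dg'')]),
   (''dikt'', [(''aqbthik'', ''''), (''fgiwkt'', ''ik''), (''tvyi{k'', ''dt'')]),
   (''dikx'', [(''tvyix{k'', ''''), (''fihxk'', ''''), (''abcrlxnki'', ''ki'')]),
   (''dik|'', [(''tvwy}i{|k'', ''''), (''aqbsh|ik'', ''''), (''fiknl|'', ''ik'')]),
   (''dikq'', [(''tqvyik'', ''ik''), (''aqrxhik'', ''''), (''fgim}n|ksq'', '''')]),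
   (''diky'', [(''fiy{k'', ''iy''), (''abhxiky'', ''''), (''gwmvnyki'', ''ki'')]),
   (''dik}'', [(''tw}~{kyi'', ''''), (''afqisk|}'', ''ik''), (''gm}nkhi'', '''')]),
   (''dikr'', [(''fiyx{rk'', ''''), (''abrhik'', ''''), (''tqwr}mnki'', ''ki'')]),
   (''dikv'', [(''tvyi{k'', ''''), (''fvik'', ''ik''), (''agbwhvik'', '''')]),
   (''dik~'', [(''fihbkrs|~'', ''''), (''acln~ki'', ''ki''), (''tvyi{k~'', '''')]),
   (''diks'', [(''tvyix{rks'', ''''), (''fiknl|s'', ''ik''), (''abchsik'', '''')]),
   (''dikw'', [(''gwmnki'', ''ki''), (''tfwihk'', ''''), (''acsrxy{ivkw'', '''')]),
   (''dik{'', [(''tvyi{k'', ''{k''), (''acln~k{i'', ''ki''), (''fihxk{'', '''')]),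
   (''dity'', [(''tabhxiy'', ''dt''), (''gwmtnk{iy'', ''''), (''fvity'', '''')]),
   (''dit}'', [(''tfik{~}'', ''dt''), (''aqbtsh|i}'', ''''), (''gwt}vyi'', '''')]),
   (''ditr'', [(''afqitr'', ''''), (''tvyihbr'', ''dt''), (''gwt}|~s{rki'', '''')]),
   (''ditv'', [(''aqbthvi'', ''tv''), (''gwtvyi'', ''''), (''tfvi'', ''dt'')]),
   (''dit~'', [(''tvyi{~'', ''dt''), (''fikn~}wt'', ''''), (''aqbtsh|i~'', '''')]),
   (''dits'', [(''tvyixrs'', ''dt''), (''aqctslnki'', ''''), (''fgiwt}|s'', '''')]),
   (''ditw'', [(''agqbwthi'', ''''), (''fvitw'', ''''), (''tw}mnki'', ''dttw'')]),
   (''dit{'', [(''aqbthxi{'', ''''), (''tvyi{'', ''dt''), (''fgiwkt{'', '''')]),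
   (''dixq'', [(''fik{xrq'', ''''), (''aqbhxi'', ''''), (''tqvyix'', '''')]),
   (''dixy'', [(''fviyx'', ''yx''), (''abhxiy'', ''iy''), (''tqrx{kyi'', '''')]),
   (''dix}'', [(''gm}lcbhxi'', ''''), (''aqrx{k~i}'', ''''), (''tfwi}yx'', '''')]),
   (''dixv'', [(''tqvrx{ki'', ''''), (''gwvyix'', ''''), (''fvihx'', '''')]),
   (''dix~'', [(''abcrhsxi|~'', ''''), (''fik{x~'', ''''), (''tgvmynix~'', '''')]),
   (''dixs'', [(''tqvsyix'', ''''), (''abchsxi'', ''''), (''fik{xrs'', '''')]),
   (''dixw'', [(''gwvyix'', ''''), (''fik{x~}w'', ''''), (''tqwrxhi'', '''')]),
   (''dix{'', [(''fgimh}x~{'', ''''), (''tvyix{'', ''''), (''aclnk{ix'', ''{x'')]),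
   (''di|q'', [(''tfqis|'', ''''), (''aqbchli|'', ''''), (''gw}v|yixrq'', '''')]),
   (''di|y'', [(''aqrsx|hyi'', ''''), (''fik{y~|'', ''''), (''tvwy}i|'', ''yi'')]),
   (''di|}'', [(''abrhsi|}'', ''|}''), (''gm}ln|ki'', ''''), (''tfwi}~|'', '''')]),
   (''di|r'', [(''agbmrn~k|i'', ''''), (''tqvwry}i|'', ''''), (''fihxrs|'', '''')]),
   (''di|v'', [(''gw}v|yi'', ''''), (''fvik{~|'', ''''), (''taqvbsh|i'', '''')]),
   (''di|~'', [(''fikn~l|'', ''''), (''tvyi{~|'', ''~|''), (''abchsi|}~'', '''')]),
   (''di|{'', [(''gw}v|yi{'', ''''), (''fik{~|'', ''''), (''tqrsx|h{i'', '''')]),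
   (''diqr'', [(''fgiw}|sqr'', ''''), (''tqvryi'', ''qr''), (''aqbrhi'', '''')]),
   (''diqv'', [(''tqvyi'', ''''), (''afqvi'', ''''), (''gw}v|~s{qki'', '''')]),
   (''diq~'', [(''agqbmh}i~'', ''''), (''fikn~|sq'', ''''), (''tqvyi{~'', '''')]),
   (''diqs'', [(''tqrxsyi'', ''''), (''fik{~|sq'', ''sq''), (''aqbchsi'', '''')]),
   (''diqw'', [(''fviw}|sq'', ''''), (''agqbwhi'', ''''), (''tqwrxyi'', '''')]),
   (''diq{'', [(''fik{xrq'', ''''), (''aqbsh|i~{'', ''''), (''tqvyi{'', '''')]),
   (''diys'', [(''afbirxsy'', ''''), (''tqvsyi'', ''yi''), (''gw}|~s{kyi'', '''')]),
   (''diyw'', [(''fviyw'', ''''), (''agbwhxiy'', ''''), (''tw}~{kyi'', '''')]),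
   (''diy{'', [(''fgimn~{y'', ''{y''), (''tvyik{'', ''yi''), (''abhxiy{'', '''')]),
   (''di}r'', [(''tqvwry}i'', ''''), (''abrx{k~i}'', ''''), (''fgim}|sr'', '''')]),
   (''di}~'', [(''abhxi{~}'', ''~}''), (''fviw}|~'', ''''), (''gm}n~ki'', '''')]),
   (''dirs'', [(''tqrsxyi'', ''''), (''fgim}|sr'', ''sr''), (''abcrhsi'', '''')]),
   (''dirw'', [(''abrhiyvw'', ''''), (''gwml|srx{ki'', ''''), (''tfqwir'', '''')]),
   (''dir{'', [(''abcrs|~{ki'', ''''), (''fihxr{'', ''''), (''tqvryi{'', '''')]),
   (''divs'', [(''tqvrsbhi'', ''''), (''fvik{~|s'', ''''), (''agcwsvyi'', '''')]),
   (''divw'', [(''tvw}~{ki'', ''''), (''agqwrxyiv'', ''''), (''fviw'', ''vw'')]),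
   (''div{'', [(''gw}v~{ki'', ''''), (''tavbhxi{'', ''''), (''fviy{'', '''')]),
   (''di~s'', [(''acsln~ki'', ''''), (''gw}~{xyris'', ''''), (''tfqis|~'', '''')]),
   (''dfgt'', [(''tgf'', ''dtdggf''), (''fvtwg'', ''df''), (''aqbthikfnmg'', '''')]),
   (''dfgx'', [(''abchlxmgf'', ''gf''), (''tvwfygx'', ''''), (''fgik{x'', ''dfdg'')]),
   (''dfgq'', [(''afqg'', ''dffg''), (''tqvwfg'', ''''), (''gml|~s{qkif'', ''dg'')]),
   (''dftv'', [(''tfv'', ''dtdffv''), (''aqtvyif'', ''tv''), (''gwftv'', '''')]),
   (''dft~'', [(''aqtsv|f~'', ''''), (''tfik{~'', ''dtdf''), (''gwft}~'', '''')]),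
   (''dftw'', [(''fvtw'', ''df''), (''tgwf'', ''dt''), (''aqtw}~{yif'', ''tw'')]),
   (''dft{'', [(''gwft}~{'', ''''), (''aqtvfy{'', ''''), (''tfik{'', ''dtdf'')]),
   (''dfxy'', [(''afbrx{y'', ''df''), (''tvfyx'', ''yx''), (''gfiyhx'', '''')]),
   (''dfx}'', [(''gwf}ihx'', ''''), (''tvfyx{~}'', ''''), (''afqrsx|}'', ''df'')]),
   (''dfxw'', [(''fvywx'', ''df''), (''gwf}~{x'', ''''), (''tqwrxhif'', '''')]),
   (''dfx{'', [(''abhxikf{'', ''''), (''fvyx{'', ''df''), (''tgqfrx{'', ''x{'')]),
   (''df|y'', [(''tqvsfy|'', ''''), (''gwf}|~{y'', ''''), (''fiyknl|'', ''df'')]),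
   (''df|~'', [(''fik{~|'', ''df~|''), (''tvwf}|~'', ''''), (''gmfln|~'', '''')]),
   (''dfqs'', [(''agqcfs'', ''''), (''fihxrqs'', ''df''), (''tqvsf'', ''qs'')]),
   (''dfq{'', [(''fihxr{q'', ''df''), (''tqvfy{'', ''''), (''agqmfnk{'', '''')]),
   (''dnt~'', [(''fvitkn~'', ''n~''), (''gwmt}n~'', ''''), (''tacl|n~'', ''dt'')]),
   (''dnt{'', [(''aqbcthlxn{'', ''''), (''tgmn~{'', ''dt''), (''fvty{kn'', '''')]),
   (''dnx}'', [(''tqrsx|l}n'', ''''), (''fviwhk}xn'', ''''), (''gm}n~{x'', '''')]),
   (''dnxw'', [(''fviwhkxn'', ''''), (''agqwmrnx'', ''''), (''tw}~n{x'', '''')]),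
   (''dn|v'', [(''gwm}vn|'', ''''), (''tavcl|n'', ''''), (''fvy{k~n|'', '''')]),
   (''dnq{'', [(''gmn~|{sq'', ''''), (''aqcrlxn{'', ''''), (''tqvy{kn'', '''')]),
   (''dnys'', [(''acslrnxy'', ''''), (''tgqvmsyn'', ''''), (''fiy{~n|s'', '''')])]"

lemma table3_checked: "list_all (checked adj3 2) table3"
  by code_simp

lemma table3_covers: "covers 4 (map (fst \<circ> decode) table3) vtxs3"
  by code_simp

lemma table4_checked: "list_all (checked adj4 3) table4"
  by code_simp

text \<open>A 4-tuple read as a function on two-bit codes. It serves as a permutation of the values
  and also selects members of a 4-tuple of vertices.\<close>

fun relabel :: "'a \<times> 'a \<times> 'a \<times> 'a \<Rightarrow> bits \<Rightarrow> 'a" where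
  "relabel (w, x, y, z) (False, False) = w"
| "relabel (w, x, y, z) (True, False) = x"
| "relabel (w, x, y, z) (False, True) = y"
| "relabel (w, x, y, z) (True, True) = z"

fun act :: "(bits \<times> bits \<times> bits \<times> bits) \<times> bool \<Rightarrow> vtx \<Rightarrow> vtx" where
  "act (p, e) (a, t, b) = (relabel p a, relabel p t, b \<noteq> e)"

text \<open>Formulated for lists so that the table entries become rewrite rules for literal lists;
  this is why a reordering has to be stored with each set.\<close>

definition good4 :: "vtx list \<Rightarrow> bool" where
  "good4 l \<longleftrightarrow> packs adj4 (set l) {..<3::nat}"

text \<open>The first two characters give a permutation of the values and a layer flip, the last two a
  reordering; they carry \<open>S\<close> to a listed orbit representative.\<close>

fun fits :: "vtx \<times> vtx \<times> vtx \<times> vtx \<Rightarrow> char \<times> char \<times> char \<times> char \<Rightarrow> bool" where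
  "fits S (c1, c2, c3, c4) = (case (vtx_of c1, vtx_of c2, vtx_of c3, vtx_of c4) of
     ((w, x, e), (y, z, _), (i, j, _), (k, l, _)) \<Rightarrow>
       distinct [w, x, y, z] \<and> distinct [i, j, k, l] \<and>
       good4 (map (\<lambda>m. act ((w, x, y, z), e) (relabel S m)) [i, j, k, l]))"

text \<open>Together with \<open>fit_third\<close> and \<open>fit_second\<close> this walks through
  all four-element sets with first member \<open>u\<close> in list order, so \<open>rows\<close>
  need not name the sets: it stores just four characters for each.\<close>

fun fit_last :: "vtx \<Rightarrow> vtx \<Rightarrow> vtx \<Rightarrow> vtx list \<Rightarrow> string \<Rightarrow> bool" where
  "fit_last u y z [] cs \<longleftrightarrow> True"
| "fit_last u y z (w # ws) (c1 # c2 # c3 # c4 # cs) \<longleftrightarrow>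
     fits (u, y, z, w) (c1, c2, c3, c4) \<and> fit_last u y z ws cs"
| "fit_last u y z (w # ws) _ \<longleftrightarrow> False"

fun fit_third :: "vtx \<Rightarrow> vtx \<Rightarrow> vtx list \<Rightarrow> string list \<Rightarrow> bool" where
  "fit_third u y [] rs \<longleftrightarrow> True"
| "fit_third u y (z # zs) (r # rs) \<longleftrightarrow> fit_last u y z zs r \<and> fit_third u y zs rs"
| "fit_third u y (z # zs) [] \<longleftrightarrow> False"

fun fit_second :: "vtx \<Rightarrow> vtx list \<Rightarrow> string list list \<Rightarrow> bool" where
  "fit_second u [] rs \<longleftrightarrow> True"
| "fit_second u (y # ys) (r # rs) \<longleftrightarrow> fit_third u y ys r \<and> fit_second u ys rs"
| "fit_second u (y # ys) [] \<longleftrightarrow> False"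

lemma good4_table: "list_all (\<lambda>c. good4 (map vtx_of (fst c))) table4"
proof -
  have sym: "symp adj4" by (rule sympI) (auto split: if_splits)
  have "good4 (map vtx_of (fst c))" if "checked adj4 3 c" for c
  proof -
    have "packs adj4 (set (fst (decode c))) {..<length (snd (decode c))}"
      using that by (intro certifies_packs[OF sym]) (auto simp: checked_def case_prod_beta)
    moreover have "length (snd (decode c)) = 3" using that by (simp add: checked_def case_prod_beta)
    ultimately show ?thesis by (simp add: good4_def decode_def case_prod_beta)
  qed
  then show ?thesis using table4_checked by (auto simp: list_all_iff)
qed

lemmas good4_rules = good4_table[unfolded table4_def, simplified list.pred_inject list.map fst_conv vtx_of.simps simp_thms]

text \<open>Data for the 1771 sets formed by \<open>hd vtxs4\<close> and three of the other 23
  vertices. For example, \<open>dnhm\<close> stands for no change of values and layers, with the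
  second and third member exchanged.\<close>

definition rows :: "string list list" where
  "rows = [
   [''dnhmdnhgdnhmdnhgdnhmdnhgdnhmdnhgdnhmhmbgdnhmhmbgdnhmhmbgdnhmdnhgdnhmdnhgdnhmhmbgdnhm'',
    ''tniltnictniltnictniltnictniltnictnilxmfctnilxmfctnilxmfctniltnictniltnictnilxmfc'',
    ''dkhmdkhgdkhmdkhgdkhmdkhgdkhmdkhgdkhmdkhgdkhmhgbgdkhmhgbgdkhmhgbgdkhmhgbgdkhm'',
    ''tkiltkictkiltkictkiltkictkiltkictkiltkictkilxgfctkilxgfctkilxgfctkilxgfc'',
    ''dnhmannddnhmaknddkhmdnhgdnhmanbgdnhmdnhgdnhmdkhgdkhmakbgdkhmdkhgdkhm'',
    ''tnilqnnatkilqknatniltnictnilqnfctniltnictkiltkictkilqkfctkiltkic'',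
    ''dnhmcinddnhmdnhgdnhmbmnddnhmdnhgdnhmiccfdnhmdnhgdnhmdnhgdnhm'',
    ''tnilsinatniltnictnilrmnatniltnictnilycgbtniltnictniltnic'',
    ''dkhmilcfdkhmdkhgdkhmdkhgdkhmdkhgdkhmbgnddkhmdkhgdkhm'',
    ''tkilylgbtkiltkictkiltkictkiltkictkilrgnatkiltkic'',
    ''ilbgilndilbgmhndilbgilbgilbmilbgilbmnakdilbm'', ''ylfcylnaylfc}hnaylflylfcylflylfcylfl~aka'',
    ''dnhmghnddnhmiccfycghdnhgdnhmkakddnhm'', ''tnilwhnaicciycgbtniltnictnil{aka'',
    ''dnhmndndycghkdndtkmhndnddnhm'', ''icci~dnadkli{dnatnil~dna'', ''icbgicndicbgmbndicbg'',
    ''ycfcycnaycfc}bna'', ''dkhmgbnddkhm'', ''tkilwbna'', ''dkhm'', ''''],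
   [''hmakhmandndkhmandndkhmandndkhmanhmakhmanhmakhmanhmakhmanhmakhmandndkhmanhmakhman'',
    ''hgbmdndndndndndndndndkhmdkhmhmanhmanhmanhmanliilliilhgbmhgbmhgbmhgbmlffllffl'',
    ''dndkdndndndkdndndndkdndnhmakhmanhmakhmanhmakhmandndkdndndndkdndnhmakhman'',
    ''dndndndndndndndndndndndndndndndndndndndndndndndndndndndndndndndndndn'',
    ''dndkdndndndkdndnhmakdndnhmakdndnhmakdndndndkdndndndkdndnhmakdndn'',
    ''dndndndndndnhmakdndndndndndndndndndndndndndndndndndndndndndn'',
    ''dndkdndnhmakhmakhmakdndnhmakdndndndkdndndndkdndnhmakdndn'',
    ''dndnhmakdndnhmakdndndndndndndndndndndndndndndndndndn'',
    ''hmakhmakhmakhmakhmakdndndndkdndndndkdndnhmakdndn'',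
    ''hmanhmanhmanhmanhmanhmanhmanhmanhmanhmanhman'', ''hmakhmanhmakhmanhmakhmandndkhmanhmakhman'',
    ''hmanhmanhmanhmanhmanhmanhmanhmanhman'', ''hmakhmanhmakhmandndkhmanhmakhman'',
    ''hmanhmanhmanhmanhmanhmanhman'', ''hmakhmandndkhmanhmakhman'', ''dndnicnddndnmbnahman'',
    ''dndkycndhmak}bna'', ''dndndndndndn'', ''hmakdndn'', ''hman'', ''''],
   [''hgbgdkhgdkhmdkhgdkhmdkhgdkhmdkhgdkhmdkhgdkhmhgbghgbmhgbghgbmhgbghgbmhgbghgbm'',
    ''|iil|iic|iil|iic|ffl|ffc|iil|iic|iil|iic|iil|iic|ffl|ffc|ffl|ffc|ffl|ffc'',
    ''anbgannddnhmaknddnhmdnhgdnhmanbgdnhmdnhgdnhmdkhgdnhmakbgdnhmdkhgdnhm'',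
    ''dnliqnnadkliqknaqnflxmmbqnflxmmbqnflqnfcqnflqnfcqnflvckaqnflqnfc'',
    ''dnhmcinddnhmdnhgxmmhbmnddnhmdnhgdnhmiccfdnhmdnhgdnhmdnhgdnhm'',
    ''dklisinailciylgbdnlivlkaxmil|imbicci}bgbxmilwbkaxmilxmic'',
    ''dkhmilcfxmmhdkhgxmmhdkhgdkhmdkhgdkhmbgnddkhmdkhgdkhm'',
    ''ilcixmmbdnlixmmbdnli|imbiccirgnadklirgnaxmilsfna'',
    ''ylgbilndxmmhmhnd|imhilbgilbmilbgilbmnakdilbm'', ''xmilylnaxmil}hnaxmil|iicxmil|iicxmil}hfc'',
    ''xmmhghnd|imhiccf}bghdnhgdnhmkakddnhm'', ''xmilwhnaxmil}bgbxmilxmicxmilxmic'',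
    ''|imhndnd}bghkdnddnhmndnd|imh'', ''|iil|iic|iil|iic|iil~dna'', ''icbgicndicbgmbndicbg'',
    ''}bfcycna}bfc}bna'', ''fcbggbnddkhm'', ''dkli{aka'', ''~agb'', ''''],
   [''dkdkhgandkdkhgandkdkhganhgakhgandkdkhganhgakhganhgakhganhgakhganhgakhgan'',
    ''dkdndkdndkdndkdndkdndkdndkdndkdndkdndkdndkdndkdndkdndkdndkdndkdndkdn'',
    ''dkdkdkdndkdkdkdndkdkdkdndkdkdkdnhgakdkdnhgakdkdnhgakdkdnhgakdkdn'',
    ''dkdndkdkdkdndkdndkdndkdndkdndkdndkdnhgakdkdnhgakdkdndkdndkdn'',
    ''dkdkdkdkdkdkdkdndkdkdkdnhgakdkdnhgakhgakhgakhgakhgakdkdn'',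
    ''dkdndkdndkdndkdndkdndkdndkdnhgakdkdndkdndkdndkdndkdn'',
    ''dkdkdkdndkdkdkdnhgakdkdnhgakhgakhgakdkdnhgakdkdn'',
    ''dkdnilnddkdnmhnahganhgakhganhgakhganhgakhgan'', ''dkdkylndhgak}hnahgakhgakhgakhgakhgakhgak'',
    ''dkdndkdndkdnhgakdkdnhgakdkdnhgakdkdn'', ''hgakdkdnhgakhgakhgakhgakhgakhgak'',
    ''hganhgakhganhgakhganhgakhgan'', ''hgakhgakhgakhgakhgakhgak'', ''hganhganhganhganhgan'',
    ''hgakhganhgakhgan'', ''hganhganhgan'', ''hgakhgan'', ''hgan'', ''''],
   [''akbgannddkhmaknddkhmdnhgdkhmanbgdkhmdnhgdkhmdkhgdkhmakbgdkhmdkhgdkhm'',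
    ''dnliqnnadkliqknaqkflqkfcqkflvlkaqkflqkfcqkflxgmbqkflxgmbqkflqkfc'',
    ''dnhmcfkddnhmdnhgdnhmbmnddnhmdnhgdnhmiccfxgmhdnhgxgmhdnhgdnhm'',
    ''dklisfkailcirmnadnlirmnaxgilsinaiccixgmbdklixgmbdkli|fmb'',
    ''dkhmilcfdkhmdkhgdkhmdkhgdkhmdkhgxgmhbgnddkhmdkhgdkhm'',
    ''ilci}hgbxgilwhkaxgilxgicicciycgbdklivckaxgil|fmb'',
    ''ilbgilndilbgmhndilbgiccfxgmhilbgxgmhnakd|fmh'', ''}hfcylna}hfc}hnaicci|fmb}hfl}hfc}hfl|fmb'',
    ''flbgghnddnhmiccfxgmhdklfxgmhkakd|fmh'', ''dnli{dkaicci|fmbdklixgmbdkli|fmb'',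
    ''~dgbndndxgmhkdndxgmhnakd|fmh'', ''icci}bgbdklixgmb|fil~aka'', ''ycgbicndxgmhmbnd|fmh'',
    ''xgilycnaxgil}bna'', ''xgmhgbnd|fmh'', ''xgilwbna'', ''|fmh'', ''''],
   [''anmhqnnaakmhqknadndkanananakanananakanandkdkakanakakakanakakakan'',
    ''anilanicanilanilanilanilanilanilanilanilanilanilanilanilanil'',
    ''akmhsinadndkanananakanananakanandkdkananakakananakakanan'',
    ''akilakilakilakilakilakilakilakilakilakilakilakilakil'',
    ''dndkakananakakananakakandkdkakanakakakanakakakan'',
    ''dndnilnddndnmhnddndndndndndndndndndndndndndn'', ''anakylnddndk}hnddkdkdndnakakdndndkdkdndn'',
    ''ananghnaanandkdkanananananananananan'', ''anakwhnadkdkdkdkakakananakakanan'',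
    ''dndndkdkdndnakakanandndndndn'', ''dkdkdkdkakakakakdkdkdndn'', ''dkdnicnddkdnmbnddkdn'',
    ''akakycnddkdk}bnd'', ''akangbnaakan'', ''akakwbna'', ''dkdn'', ''''],
   [''rmgbcindqkmbbmnddnhmbmnddnhmdnhgdnhmiccfdnhmdnhgdnhmdnhgdnhm'',
    ''qnicqnicqnilrmfcqnilrmfcqnilrmfcqnilqnicqnilqnicqnilrmfc'',
    ''rggbilcfdkhmdkhgdkhmdkhgdkhmbgnddkhmbgnddkhmdkhgdkhm'',
    ''qkilqkicqkilqkicqkilrgfcqkilrgfcqkilrgfcqkilrgfc'',
    ''ilbgilndilbgmhndilbgilbgilbmilbgilbmnakdilbm'', ''ylfcvlkaylfc}hnaicciqnicdklivcgbqnil~aka'',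
    ''vlgbghndflbgiccfdnhmdnhgvcghkakddnhm'', ''vlfcwhnaiccivlfcvlflvlfcvlfl{aka'',
    ''ndbgndndqkmhkdndvcghndnddnhm'', ''icci~dnadkli{dnadkli{dna'', ''icbgicndicbgmbndicbg'',
    ''ycfcvckaycfc}bna'', ''vcgbgbndfcbg'', ''vcfcwbna'', ''nabg'', ''''],
   [''cimhsinabmmhrmnabmmhrmnadndksinaiccidndndndkdndndndkdndn'',
    ''cfflciicciilciicciilciicciilcffccfflcffccfflcffccffl'',
    ''bmmhdndnbmmhwhkadndkdndniccirgnagbghsfnadndksfna'',
    ''ilbmflkailbmmhndilbmdndndndnbmilbmililbmilbm'', ''bmmhvlkadndk}hndiccidndndndkdndndndkdndn'',
    ''bmilghnabmilbmilbmilbmilbmilbmilbmil'', ''dndkwhnaiccidndndndkdndndndkdndn'',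
    ''dndndndndndnciicdndnkdnadndn'', ''iccidndngbgh{dnadndk{dna'', ''icbmicndicbmmbndicbm'',
    ''gbghycnddndk}bnd'', ''gbflgbnagbfl'', ''dndkwbna'', ''dndn'', ''''],
   [''sfgbilcfrmmbghkdsimbdkhgsimbbgnddkhmbgndwbgbdkhgdkhm'',
    ''siicsiicsiicsiicsiicsiicsffcsffcsffcsffcsffcsffc'',
    ''ilbgilndvlgbmhndilbgilbgilbmilbgilbmnakdilbm'', ''rmicvlkarmic}hnarmilrmicrmilwbgbrmilrmic'',
    ''vlgbghndsimbiccfflbmflbgwbgbkakdflbm'', ''whfcwhnarmilsiicrmilsiicrmilwhfc'',
    ''simbndnddnhmkdndwbgbndnd{agb'', ''iccisiicsiicsiicsiic{dna'', ''icbgicndicbgmbndicbg'',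
    ''fccfvckanacf~aka'', ''wbgbgbnd{agb'', ''wbfcwbna'', ''{agb'', ''''],
   [''ilcidkdndkdkdkdndkdkdkdnbgmhrgnabgmhrgnadkdksfna'',
    ''ilbmilndilbmmhndilbmdkdkilbmbgmhilbmdkdkilbm'', ''ghghylnddkdk}hnddkdkdkdkbgmhdkdkdkdkdkdk'',
    ''ghflghnaghflbgmhdkdnbgmhdkdncfmbghfl'', ''dkdkwhnabgmhdkdkbgmhdkdkdkdk{aka'',
    ''dkdniccidkdnbgmhdkdnkakadkdn'', ''iccidkdkbgmhdkdkdkdk{aka'', ''icbmfckaicbmmbndicbm'',
    ''bgmhvckadkdk}bnd'', ''bgilgbnabgil'', ''dkdkwbna'', ''dkdn'', ''''],
   [''ilbgilndilbgmhndilbgiccfrgmhilbgrgmhnakdilbm'', ''flcfvlkandcf~dkaiccirgmbfccisfmbdklisfmb'',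
    ''whgbghnd{dgbiccfrgmhfccfrgmhkakdsfmb'', ''whfcwhnaicciwhfcwhfcsfmbwhfcsfmb'',
    ''{dgbndndrgmhkdndrgmhnakdsfmb'', ''iccirgmbfcciwbgb{dfc{aka'', ''icbgicndvcgbmbndicbg'',
    ''rgicvckargic}bna'', ''vcgbgbndsfmb'', ''wbfcwbna'', ''sfmb'', ''''],
   [''ilmhylnamhmh}hnailakilanilakilannaghilan'', ''ilililicilililililililililililililil'',
    ''mhmhwhnailakilanilakilannaghilan'', ''mhilndfcmhilmhilmhilndfcmhil'',
    ''ilak~dnailakilannagh~dna'', ''icbmicndicbmnakaicbm'', ''ilakycndnagh~aka'', ''ilankakailan'',
    ''nagh{aka'', ''nafl'', ''''],
   [''vlgbghnd}hmbiccfflbmflbgflbmkakd~agb'', ''ylicylicylilylicylilvlfcylilylic'',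
    ''~dgbndnd}hmbkdnd}hmbndnd~agb'', ''~dfc~dfc}hil~dfc~dfc~dfc'', ''icbgicndicbgmbnd~agb'',
    ''fccfycna}bfc~aka'', ''fcbggbnd~agb'', ''wbfc{aka'', ''~agb'', ''''],
   [''ghmhwhnaicciflanflakflankagh{aka'', ''ghilkdfcghilkdfcghilkdfcghil'',
    ''icci~dnaghmh{dnakagh{dna'', ''icbmicndicbmmbndicbm'', ''fcciycndkagh}bnd'', ''fcbmkakagbfl'',
    ''kagh{aka'', ''kafl'', ''''],
   [''{dgbndndwhmbkdndwhmbndnd{agb'', ''{dfc{dfc{dfc{dfc{dfc{dfc'', ''icbgicndicbgmbndicbg'',
    ''fccfvcka}bfc~aka'', ''fcbggbnd{agb'', ''wbfc{aka'', ''{agb'', ''''],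
   [''ndmh~dnakdmh{dnandmh~dna'', ''ndilicndndilnakandil'', ''kdmhycndnagh~aka'', ''kdilkakakdil'',
    ''nagh{aka'', ''nafl'', ''''],
   [''icbgicndicbgmbnd~agb'', ''~dicycna~dic~aka'', ''{dmbgbnd{agb'', ''{dic{aka'', ''~agb'', ''''],
   [''icmhycnambmh}bna'', ''icilicicicil'', ''mbmhwbna'', ''mbil'', ''''],
   [''vcgbgbnd}bmb'', ''ycicycic'', ''~agb'', ''''],
   [''gbmhwbna'', ''gbil'', ''''],
   [''{agb'', ''''],
   [''''],
   []]"

lemma rows_fit: "fit_second (hd vtxs4) (tl vtxs4) rows"
proof -
  have vs: "vtxs4 = [
((False, False), (True, False), False), ((False, False), (True, False), True),
    ((False, False), (False, True), False), ((False, False), (False, True), True),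
    ((False, False), (True, True), False), ((False, False), (True, True), True),
    ((True, False), (False, False), False), ((True, False), (False, False), True),
    ((True, False), (False, True), False), ((True, False), (False, True), True),
    ((True, False), (True, True), False), ((True, False), (True, True), True),
    ((False, True), (False, False), False), ((False, True), (False, False), True),
    ((False, True), (True, False), False), ((False, True), (True, False), True),
    ((False, True), (True, True), False), ((False, True), (True, True), True),
    ((True, True), (False, False), False), ((True, True), (False, False), True),
    ((True, True), (True, False), False), ((True, True), (True, False), True),
    ((True, True), (False, True), False), ((True, True), (False, True), True)]"
    by (simp add: vtxs4_def bits_list_def)
  show ?thesis
  unfolding rows_def vs
  by (simp only: list.sel fit_second.simps fit_third.simps simp_thms; (intro conjI)?; simp add: good4_rules)
qed

lemma UNIV_bits: "(UNIV :: bits set) = {(False, False), (True, False), (False, True), (True, True)}"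
  by auto

lemma card_bits: "card (UNIV :: bits set) = 4"
  by (simp add: UNIV_bits)

fun relabel_vtx :: "(bits \<Rightarrow> bits) \<Rightarrow> bool \<Rightarrow> vtx \<Rightarrow> vtx" where
  "relabel_vtx \<pi> e (a, t, b) = (\<pi> a, \<pi> t, b \<noteq> e)"

lemma act_eq: "act (p, e) = relabel_vtx (relabel p) e"
  by (rule ext) (auto simp: fun_eq_iff)

lemma relabel_bij:
  assumes "distinct [w, x, y, z]"
  shows "inj (relabel (w, x, y, z))"
proof (rule injI)
  fix m n assume "relabel (w, x, y, z) m = relabel (w, x, y, z) n"
  then show "m = n" using assms by (cases "((w, x, y, z), m)" rule: relabel.cases; cases "((w, x, y, z), n)" rule: relabel.cases) auto
qed

text \<open>Permuting the values and flipping the layers is an automorphism of \<open>adj4\<close>;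
  injectivity on the finite type \<open>bits\<close> gives the preimages of neighbours.\<close>

lemma packs_adj4_relabel:
  assumes \<pi>: "inj \<pi>" and p: "packs adj4 (relabel_vtx \<pi> e ` T) J"
  shows "packs adj4 T J"
proof (rule packs_inj_image[of "relabel_vtx \<pi> e" UNIV T adj4 adj4 J])
  show "inj (relabel_vtx \<pi> e)" using \<pi> by (auto simp: inj_def)
  have "surj \<pi>" using \<pi> finite_UNIV_inj_surj[of \<pi>] by simp
  then have pre: "\<exists>a. \<pi> a = x" for x by (metis surjD)
  fix u v assume uv: "adj4 (relabel_vtx \<pi> e u) v"
  obtain a t b where v: "v = (a, t, b)" by (cases v) auto
  obtain a' t' where at: "\<pi> a' = a" "\<pi> t' = t" using pre by metis
  have v': "v = relabel_vtx \<pi> e (a', t', b \<noteq> e)" using v at by auto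
  moreover have "adj4 (relabel_vtx \<pi> e x) (relabel_vtx \<pi> e y) = adj4 x y" for x y
    using \<pi> by (cases x; cases y) (auto simp: inj_eq)
  ultimately show "\<exists>w\<in>UNIV. v = relabel_vtx \<pi> e w \<and> adj4 u w" using uv by blast
qed (use p in auto)

lemma fits_packs:
  assumes "fits (u, y, z, w) c"
  shows "packs adj4 {u, y, z, w} {..<3::nat}"
proof -
  obtain c1 c2 c3 c4 where c: "c = (c1, c2, c3, c4)" by (cases c) auto
  obtain p1 p2 e where 1: "vtx_of c1 = (p1, p2, e)" by (cases "vtx_of c1") auto
  obtain p3 p4 e' where 2: "vtx_of c2 = (p3, p4, e')" by (cases "vtx_of c2") auto
  obtain i j e1 where 3: "vtx_of c3 = (i, j, e1)" by (cases "vtx_of c3") auto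
  obtain k l e2 where 4: "vtx_of c4 = (k, l, e2)" by (cases "vtx_of c4") auto
  let ?S = "(u, y, z, w)"
  have d: "distinct [p1, p2, p3, p4]" and ijkl: "distinct [i, j, k, l]"
    and g: "good4 (map (\<lambda>m. act ((p1, p2, p3, p4), e) (relabel ?S m)) [i, j, k, l])"
    using assms by (simp_all add: c 1 2 3 4)
  \<comment> \<open>Four distinct codes exhaust \<open>bits\<close>, so the reordered list has
    exactly the members of the given set.\<close>
  have "card {i, j, k, l} = card (UNIV :: bits set)" using ijkl by (simp add: card_bits)
  then have all: "{i, j, k, l} = UNIV" by (intro card_subset_eq) auto
  have "relabel ?S ` UNIV = {u, y, z, w}"
    unfolding UNIV_bits by auto
  then have "relabel ?S ` {i, j, k, l} = {u, y, z, w}" unfolding all .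
  moreover have "set (map (\<lambda>m. act ((p1, p2, p3, p4), e) (relabel ?S m)) [i, j, k, l]) =
      relabel_vtx (relabel (p1, p2, p3, p4)) e ` relabel ?S ` {i, j, k, l}"
    unfolding act_eq by simp
  ultimately have "packs adj4 (relabel_vtx (relabel (p1, p2, p3, p4)) e ` {u, y, z, w}) {..<3::nat}"
    using g unfolding good4_def by simp
  then show ?thesis using packs_adj4_relabel relabel_bij[OF d] by blast
qed

declare fits.simps [simp del]

lemma fit_lastD: "fit_last u y z ws cs \<Longrightarrow> w \<in> set ws \<Longrightarrow> \<exists>c. fits (u, y, z, w) c"
  by (induction u y z ws cs rule: fit_last.induct) auto

lemma fit_thirdD:
  "fit_third u y zs rs \<Longrightarrow> T \<subseteq> set zs \<Longrightarrow> card T = 2 \<Longrightarrow> \<exists>z w c. T = {z, w} \<and> fits (u, y, z, w) c"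
proof (induction u y zs rs rule: fit_third.induct)
  case (2 u y z zs r rs)
  show ?case
  proof (cases "z \<in> T")
    case True
    then have "card (T - {z}) = 1" using 2(4) by simp
    then obtain w where w: "T - {z} = {w}" by (auto simp: card_1_singleton_iff)
    then have "w \<in> set zs" using 2(3) by auto
    then obtain c where "fits (u, y, z, w) c" using fit_lastD[of u y z zs r w] 2(2) by auto
    moreover have "T = {z, w}" using w True by blast
    ultimately show ?thesis by blast
  next
    case False
    then have "T \<subseteq> set zs" using 2(3) by auto
    moreover have "fit_third u y zs rs" using 2(2) by simp
    ultimately show ?thesis using 2(1,4) by blast
  qed
qed simp_all

lemma fit_secondD:
  "fit_second u ys rs \<Longrightarrow> T \<subseteq> set ys \<Longrightarrow> card T = 3 \<Longrightarrow> \<exists>y z w c. T = {y, z, w} \<and> fits (u, y, z, w) c"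
proof (induction u ys rs rule: fit_second.induct)
  case (2 u y ys r rs)
  show ?case
  proof (cases "y \<in> T")
    case True
    then have "card (T - {y}) = 2" "T - {y} \<subseteq> set ys" using 2(3,4) by auto
    then obtain z w c where c: "T - {y} = {z, w}" "fits (u, y, z, w) c" using fit_thirdD[of u y ys r "T - {y}"] 2(2) by auto
    moreover have "T = {y, z, w}" using c(1) True by blast
    ultimately show ?thesis by blast
  next
    case False
    then have "T \<subseteq> set ys" using 2(3) by auto
    moreover have "fit_second u ys rs" using 2(2) by simp
    ultimately show ?thesis using 2(1,4) by blast
  qed
qed simp_all

lemma set_vtxs4: "set vtxs4 = {(a, t, b). a \<noteq> t}"
proof (rule set_eqI)
  fix v :: vtx
  obtain a0 a1 t0 t1 b where v: "v = ((a0, a1), (t0, t1), b)" by (metis prod.exhaust)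
  show "v \<in> set vtxs4 \<longleftrightarrow> v \<in> {(a, t, b). a \<noteq> t}"
    unfolding v vtxs4_def bits_list_def by (cases a0; cases a1; cases t0; cases t1; cases b; simp)
qed

lemma packs_adj4:
  assumes T: "T \<subseteq> set vtxs4" "card T = 4"
  shows "packs adj4 T {..<3::nat}"
proof -
  have "T \<noteq> {}" using T(2) by auto
  then obtain a t b where s: "(a, t, b) \<in> T" by (metis ex_in_conv prod_cases3)
  then have at: "a \<noteq> t" using T(1) by (auto simp: set_vtxs4)
  \<comment> \<open>The inner transposition brings \<open>a\<close> to its place; the outer one then
    places the image of \<open>t\<close> without moving \<open>a\<close> again. With the flip by
    \<open>b\<close> the chosen member becomes \<open>hd vtxs4\<close>, so \<open>rows\<close>
    applies.\<close>
  define \<pi> where "\<pi> = transpose (transpose a (False, False) t) (True, False) \<circ> transpose a (False, False)"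
  have inj: "inj \<pi>" unfolding \<pi>_def by (intro inj_compose) auto
  have "transpose a (False, False) t \<noteq> (False, False)" using at by (metis transpose_apply_first transpose_involutory)
  then have \<pi>: "\<pi> a = (False, False)" "\<pi> t = (True, False)" by (auto simp: \<pi>_def transpose_def)
  let ?T = "relabel_vtx \<pi> b ` T"
  have u: "hd vtxs4 = ((False, False), (True, False), False)" by (simp add: vtxs4_def bits_list_def)
  have uT: "hd vtxs4 \<in> ?T" using s \<pi> u by (auto intro!: image_eqI[of _ _ "(a, t, b)"])
  have sub: "?T \<subseteq> set vtxs4"
  proof
    fix v assume "v \<in> ?T"
    then obtain a' t' b' where v: "(a', t', b') \<in> T" "v = relabel_vtx \<pi> b (a', t', b')" by auto
    then have "a' \<noteq> t'" using T(1) by (auto simp: set_vtxs4)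
    then have "\<pi> a' \<noteq> \<pi> t'" using inj by (simp add: inj_eq)
    then show "v \<in> set vtxs4" using v by (simp add: set_vtxs4)
  qed
  have "inj (relabel_vtx \<pi> b)" using inj by (auto simp: inj_def)
  then have "card ?T = 4" using T(2) by (metis card_image inj_on_subset subset_UNIV)
  then have "card (?T - {hd vtxs4}) = 3" using uT by simp
  moreover have "?T - {hd vtxs4} \<subseteq> set (tl vtxs4)"
  proof -
    have "vtxs4 \<noteq> []" by (simp add: vtxs4_def bits_list_def)
    then have "set vtxs4 = insert (hd vtxs4) (set (tl vtxs4))" by (metis list.exhaust_sel list.simps(15))
    then show ?thesis using sub by blast
  qed
  ultimately have "\<exists>y z w c. ?T - {hd vtxs4} = {y, z, w} \<and> fits (hd vtxs4, y, z, w) c"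
    by (intro fit_secondD[OF rows_fit])
  then obtain y z w c where c: "?T - {hd vtxs4} = {y, z, w}" "fits (hd vtxs4, y, z, w) c"
    by (elim exE conjE)
  have "?T = {hd vtxs4, y, z, w}" unfolding c(1)[symmetric] using uT by (rule insert_Diff[symmetric])
  then have "packs adj4 ?T {..<3::nat}" using fits_packs[OF c(2)] by (simp only:)
  then show ?thesis by (rule packs_adj4_relabel[OF inj])
qed

lemma packs_adj3:
  assumes T: "T \<subseteq> set vtxs3" "card T = 4"
  shows "packs adj3 T {..<2::nat}"
proof -
  obtain l where l: "l \<in> set (map (fst \<circ> decode) table3)" "T \<subseteq> set l"
    using coversD[OF table3_covers T] by blast
  then obtain c where c: "c \<in> set table3" "l = fst (decode c)" by auto
  then have ch: "checked adj3 2 c" using table3_checked by (simp add: list_all_iff)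
  have "symp adj3" by (rule sympI) (auto split: if_splits)
  then have "packs adj3 (set l) {..<length (snd (decode c))}"
    using ch c by (intro certifies_packs) (auto simp: checked_def case_prod_beta)
  moreover have "length (snd (decode c)) = 2" "length l = 4" using ch c by (auto simp: checked_def case_prod_beta)
  moreover have "T = set l" using l(2) T(2) card_length[of l] calculation(3)
    by (metis List.finite_set card_seteq)
  ultimately show ?thesis by simp
qed

section \<open>Transfer of the certificates to stars with one or two positions\<close>

context star
begin

lemma packs_four_two_positions:
  assumes I: "card I = 2" and S: "fst ` S \<subseteq> W" "card S = 4"
  shows "packs E S {..<3::nat}"
proof -
  have "card (I - {ctr}) = 1" using I ctrI by simp
  then obtain q where q: "I - {ctr} = {q}" by (auto simp: card_1_singleton_iff)
  then have I: "I = {ctr, q}" "q \<noteq> ctr" using ctrI by auto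
  have "card (UNIV :: bits set) = card V" using cardV I by (simp add: card_bits)
  then obtain e :: "bits \<Rightarrow> 'v" where e: "bij_betw e UNIV V"
    using finite_same_card_bij[OF finite_class.finite_UNIV finV] by blast
  define d where "d = inv_into UNIV e"
  have ed: "e (d x) = x" if "x \<in> V" for x using e that by (auto simp: d_def bij_betw_def f_inv_into_f)
  have de: "d (e x) = x" for x using e by (simp add: d_def bij_betw_def)
  have eV: "e x \<in> V" for x using e by (auto simp: bij_betw_def)
  have einj: "e x = e y \<longleftrightarrow> x = y" for x y by (metis de)
  define \<phi> where "\<phi> = (\<lambda>(f, b). (d (f ctr), d (f q), b :: bool))"
  let ?A = "W \<times> (UNIV :: bool set)"
  have inj: "inj_on \<phi> ?A"
  proof (rule inj_onI)
    fix u v assume uv: "u \<in> ?A" "v \<in> ?A" "\<phi> u = \<phi> v"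
    then have "fst u ctr = fst v ctr" "fst u q = fst v q" "snd u = snd v"
      using ed W_V I by (auto simp: \<phi>_def case_prod_beta) (metis insertCI)+
    then show "u = v" using uv W_eqI[of "fst u" "fst v"] I by (auto simp: prod_eq_iff mem_Times_iff)
  qed
  have SA: "S \<subseteq> ?A" using S(1) by (auto simp: mem_Times_iff)
  show ?thesis
  proof (rule packs_inj_image[OF inj SA])
    have "\<phi> ` S \<subseteq> set vtxs4"
    proof
      fix v assume "v \<in> \<phi> ` S"
      then obtain f b where f: "(f, b) \<in> S" "v = \<phi> (f, b)" by auto
      then have fW: "f \<in> W" using S(1) by force
      then have "f ctr \<noteq> f q" using W_inj I by auto
      then have "d (f ctr) \<noteq> d (f q)" using ed W_V[OF fW] I by (metis insertCI)
      then show "v \<in> set vtxs4" using f by (simp add: set_vtxs4 \<phi>_def)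
    qed
    moreover have "card (\<phi> ` S) = 4" using S(2) card_image[OF inj_on_subset[OF inj SA]] by simp
    ultimately show "packs adj4 (\<phi> ` S) {..<3::nat}" by (rule packs_adj4)
    fix u v assume u: "u \<in> ?A" and uv: "adj4 (\<phi> u) v"
    obtain f b where f: "u = (f, b)" "f \<in> W" using u by auto
    obtain a t b' where v: "v = (a, t, b')" by (cases v) auto
    have fV: "f ctr \<in> V" "f q \<in> V" using W_V[OF f(2)] I by auto
    have at: "a \<noteq> t" "d (f ctr) \<noteq> d (f q)" using uv by (auto simp: f \<phi>_def v)
    define g where "g i = (if i = ctr then e a else if i = q then e t else h i)" for i
    have gW: "g \<in> W" unfolding W_def using at eV I by (auto simp: g_def inj_on_def einj)
    have gv: "v = \<phi> (g, b')" using I by (simp add: \<phi>_def g_def de v)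
    have "E u (g, b')"
    proof (cases "b = b'")
      case True
      have or: "d (f q) = t \<and> d (f ctr) \<noteq> a \<or> d (f ctr) = t \<and> d (f q) = a"
        using uv True by (auto simp: f \<phi>_def v)
      have "g = nb ctr f (g ctr)"
      proof (rule W_eqI[OF gW W_nb[OF f(2)]])
        show "g ctr \<in> V" using eV by (simp add: g_def)
        have "g q = (if f q = g ctr then f ctr else f q)"
          using or at ed[OF fV(1)] ed[OF fV(2)] de[of a] I by (auto simp: g_def)
        then show "g i = nb ctr f (g ctr) i" if "i \<in> I" for i
          using that I nb_at[OF f(2), of q "g ctr"] by auto
      qed
      moreover have "f \<noteq> g"
      proof
        assume "f = g"
        then have "d (f ctr) = a" "d (f q) = t" using de I by (simp_all add: g_def)
        then show False using or at(1) by argo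
      qed
      ultimately show ?thesis using True f gW by (simp add: E_def A_def)
    next
      case False
      then have "d (f ctr) = a" "d (f q) = t" using uv by (auto simp: f \<phi>_def v)
      then have "f = g" using f gW I ed[OF fV(1)] ed[OF fV(2)] by (intro W_eqI) (auto simp: g_def)
      then show ?thesis using False f by (simp add: E_def)
    qed
    then show "\<exists>w\<in>?A. v = \<phi> w \<and> E u w" using gv gW by blast
  qed
qed

lemma packs_four_one_position:
  assumes I: "card I = 1" and S: "fst ` S \<subseteq> W" "card S = 4"
  shows "packs E S {..<2::nat}"
proof -
  have I: "I = {ctr}" using I ctrI by (auto simp: card_1_singleton_iff)
  \<comment> \<open>Only three values exist here. The fourth code is reserved for the constant
    second value of the encoded vertices.\<close>
  let ?U = "UNIV - {(True, True)} :: bits set"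
  have "card ?U = card V" using cardV I by (simp add: card_Diff_subset card_bits)
  then obtain e :: "bits \<Rightarrow> 'v" where e: "bij_betw e ?U V"
    using finite_same_card_bij[of ?U V] finV by auto
  define d where "d = inv_into ?U e"
  have ed: "e (d x) = x" "d x \<in> ?U" if "x \<in> V" for x
    using e that by (auto simp: d_def bij_betw_def f_inv_into_f intro: inv_into_into[of x e ?U, simplified] dest: inv_into_into[of x e ?U])
  have de: "d (e x) = x" "e x \<in> V" if "x \<noteq> (True, True)" for x
    using e that by (auto simp: d_def bij_betw_def)
  define \<phi> where "\<phi> = (\<lambda>(f, b). (d (f ctr), (True, True), b :: bool))"
  let ?A = "W \<times> (UNIV :: bool set)"
  have inj: "inj_on \<phi> ?A"
  proof (rule inj_onI)
    fix u v assume uv: "u \<in> ?A" "v \<in> ?A" "\<phi> u = \<phi> v"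
    then have "d (fst u ctr) = d (fst v ctr)" "snd u = snd v" by (auto simp: \<phi>_def case_prod_beta)
    moreover have "fst u ctr \<in> V" "fst v ctr \<in> V" using uv W_ctr by (auto simp: mem_Times_iff)
    ultimately have "fst u ctr = fst v ctr" "snd u = snd v" using ed(1) by metis+
    then show "u = v" using uv W_eqI[of "fst u" "fst v"] I by (auto simp: prod_eq_iff mem_Times_iff)
  qed
  have SA: "S \<subseteq> ?A" using S(1) by (auto simp: mem_Times_iff)
  show ?thesis
  proof (rule packs_inj_image[OF inj SA])
    have set3: "set vtxs3 = {(a, t, b). a \<noteq> (True, True) \<and> t = (True, True)}"
    proof (rule set_eqI)
      fix v :: vtx
      obtain a0 a1 t0 t1 b where v: "v = ((a0, a1), (t0, t1), b)" by (metis prod.exhaust)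
      show "v \<in> set vtxs3 \<longleftrightarrow> v \<in> {(a, t, b). a \<noteq> (True, True) \<and> t = (True, True)}"
        unfolding v vtxs3_def bits_list_def by (cases a0; cases a1; cases t0; cases t1; cases b; simp)
    qed
    have "\<phi> ` S \<subseteq> set vtxs3"
    proof
      fix v assume "v \<in> \<phi> ` S"
      then obtain f b where f: "(f, b) \<in> S" "v = \<phi> (f, b)" by auto
      then have "f ctr \<in> V" using S(1) W_ctr by force
      then show "v \<in> set vtxs3" using f ed(2)[of "f ctr"] by (simp add: set3 \<phi>_def)
    qed
    moreover have "card (\<phi> ` S) = 4" using S(2) card_image[OF inj_on_subset[OF inj SA]] by simp
    ultimately show "packs adj3 (\<phi> ` S) {..<2::nat}" by (rule packs_adj3)
    fix u v assume u: "u \<in> ?A" and uv: "adj3 (\<phi> u) v"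
    obtain f b where f: "u = (f, b)" "f \<in> W" using u by auto
    obtain a t b' where v: "v = (a, t, b')" by (cases v) auto
    have fV: "f ctr \<in> V" using W_ctr[OF f(2)] .
    have at: "a \<noteq> (True, True)" "t = (True, True)" using uv by (auto simp: f \<phi>_def v)
    define g where "g i = (if i = ctr then e a else h i)" for i
    have gW: "g \<in> W" unfolding W_def using de(2)[OF at(1)] I by (auto simp: g_def inj_on_def)
    have gv: "v = \<phi> (g, b')" using de(1)[OF at(1)] at(2) by (simp add: \<phi>_def g_def v)
    have "E u (g, b')"
    proof (cases "b = b'")
      case True
      have "g = nb ctr f (g ctr)"
        using I gW W_nb[OF f(2), of "g ctr"] W_ctr[OF gW] by (intro W_eqI) auto
      moreover have "d (f ctr) \<noteq> a" using uv True by (auto simp: f \<phi>_def v)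
      then have "f \<noteq> g" using de(1)[OF at(1)] by (auto simp: g_def)
      ultimately show ?thesis using True f gW by (simp add: E_def A_def)
    next
      case False
      then have "d (f ctr) = a" using uv by (auto simp: f \<phi>_def v)
      then have "f = g" using f gW I ed(1)[OF fV] by (intro W_eqI) (auto simp: g_def)
      then show ?thesis using False f by (simp add: E_def)
    qed
    then show "\<exists>w\<in>?A. v = \<phi> w \<and> E u w" using gv gW by blast
  qed
qed

end

theorem packs_four:
  "star ctr I V h \<Longrightarrow> fst ` S \<subseteq> star.W I V h \<Longrightarrow> card S = 4 \<Longrightarrow> packs (star.E ctr I V h) S {..<card V - 1}"
proof (induction "card I" arbitrary: I V h rule: less_induct)
  case less
  interpret star ctr I V h by fact
  have "card I > 0" using ctrI finI card_gt_0_iff by blast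
  then consider "card I = 1" | "card I = 2" | "card I \<ge> 3" by linarith
  then show ?case
  proof cases
    case 1
    then have "card V - 1 = 2" using cardV by simp
    then show ?thesis using packs_four_one_position[OF 1 less.prems(2,3)] by (simp only:)
  next
    case 2
    then have "card V - 1 = 3" using cardV by simp
    then show ?thesis using packs_four_two_positions[OF 2 less.prems(2,3)] by (simp only:)
  next
    case 3
    show ?thesis
    proof (rule packs_four_step[OF 3 less.prems(2,3)])
      fix p c assume p: "p \<in> I" "p \<noteq> ctr" "c \<in> V" and S: "\<And>s. s \<in> S \<Longrightarrow> fst s p = c"
      interpret C: star ctr "I - {p}" "V - {c}" "h(p := c)" using star_copy[OF p] .
      have "fst ` S \<subseteq> C.W" using less.prems(2) S by (auto simp: W_copy[OF p])
      moreover have "card (I - {p}) < card I" using p(1) finI by (meson card_Diff1_less)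
      ultimately have "packs C.E S {..<card (V - {c}) - 1}"
        using less.hyps C.star_axioms less.prems(3) by blast
      then show "packs C.E S {..<card V - 2}" using p(3) finV by (simp add: numeral_2_eq_2)
    qed
  qed
qed

section \<open>The godan graph\<close>

text \<open>The two values at positions 1 and 2 are determined up to order by the others, and the
  parity settles the order. The value 0 plays the part of \<open>h\<close>, outside {1..n}.\<close>

definition split_perm :: "nat \<Rightarrow> (nat \<Rightarrow> nat) \<Rightarrow> (nat \<Rightarrow> nat) \<times> bool" where
  "split_perm n u = ((\<lambda>i. if i \<in> {3..n} then u i else 0), evenperm u)"

lemma star_perms: "3 \<le> n \<Longrightarrow> star 3 {3..n} {1..n} (\<lambda>_. 0 :: nat)"
  by unfold_locales auto

lemma inj_on_split_perm: "inj_on (split_perm n) {u. u permutes {1..n}}"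
proof (rule inj_onI)
  fix u v assume uv: "u \<in> {u. u permutes {1..n}}" "v \<in> {u. u permutes {1..n}}" "split_perm n u = split_perm n v"
  then have u: "u permutes {1..n}" and v: "v permutes {1..n}" by auto
  have ev: "evenperm u = evenperm v" using uv(3) by (simp add: split_perm_def)
  have same: "u i = v i" if "i \<in> {3..n}" for i
    using fun_cong[OF arg_cong[OF uv(3), of fst], of i] that by (simp add: split_perm_def)
  let ?z = "inv v \<circ> u"
  have "?z permutes {1..n}" using permutes_compose[OF u permutes_inv[OF v]] .
  moreover have "?z i = i" if "i \<in> {1..n} - {1, 2}" for i
  proof -
    have "i \<in> {3..n}" using that by auto
    then show ?thesis using same permutes_inverses(2)[OF v] by simp
  qed
  ultimately have "?z permutes {1, 2}" by (rule permutes_superset) auto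
  then have z: "?z = id \<or> ?z = transpose 1 2" by (simp add: permutes_doubleton_iff)
  have pu: "permutation u" "permutation v" using u v by (auto intro: permutation_permutes[THEN iffD2])
  then have "evenperm ?z" using ev by (simp add: evenperm_comp evenperm_inv permutation_inverse)
  moreover have "\<not> evenperm (transpose 1 (2 :: nat))" by (simp add: evenperm_swap)
  ultimately have "?z = id" using z by auto
  then have "v \<circ> ?z = v" by simp
  moreover have "v \<circ> ?z = u" using permutes_inverses(1)[OF v] by (simp add: fun_eq_iff)
  ultimately show "u = v" by simp
qed

lemma godan_arcI:
  assumes "n \<ge> 3" "u permutes {1..n}" "s \<in> godan_gens n"
  shows "(u, u \<circ> s) \<in> parcs (godan_graph n)"
proof -
  interpret pair_graph "godan_graph n" by (rule pair_graph_godan_graph)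
  have "(u \<circ> s, u) \<in> parcs (godan_graph n)"
    using assms permutes_compose[OF godan_gens_permutes[OF assms(1,3)] assms(2)] by (auto simp: godan_graph_def)
  then show ?thesis by (rule arcs_symmetric)
qed

text \<open>These are the even generators: (1 2 3), (1 3 2) and (1 2)(3 i). Composition with (1 2)
  on the right changes no position from 3 on, so only the exchange with position 3 is visible in the
  star.\<close>

lemma transposes_in_godan_gens:
  assumes "1 \<le> i" "i \<le> n" "i \<noteq> 3"
  shows "transpose 3 i \<circ> transpose 1 2 \<in> godan_gens n"
proof -
  consider "i = 1" | "i = 2" | "i \<ge> 4" using assms by linarith
  then show ?thesis
  proof cases
    case 1
    have "transpose 3 i \<circ> transpose 1 2 = cycle_of_list [1, 2, 3]"
      unfolding 1 by (rule ext) (simp add: transpose_def)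
    then show ?thesis by (simp add: godan_gens_def)
  next
    case 2
    have "transpose 3 i \<circ> transpose 1 2 = cycle_of_list [1, 3, 2]"
      unfolding 2 by (rule ext) (simp add: transpose_def)
    then show ?thesis by (simp add: godan_gens_def)
  next
    case 3
    have "transpose 3 i \<circ> transpose 1 2 = cycle_of_list [1, 2] \<circ> cycle_of_list [3, i]"
      using 3 by (intro ext) (simp add: transpose_def)
    then show ?thesis using 3 assms unfolding godan_gens_def by blast
  qed
qed

text \<open>Exchanging the values \<open>u 3\<close> and \<open>u i\<close> on the left of
  \<open>u\<close> is the same as exchanging the positions 3 and \<open>i\<close> on the right. The
  additional (1 2) restores the parity, and (1 2) alone is the edge between the layers.\<close>

lemma star_edge_lifts:
  assumes n: "n \<ge> 3" and u: "u permutes {1..n}"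
    and e: "star.E 3 {3..n} {1..n} (\<lambda>_. 0) (split_perm n u) v"
  shows "\<exists>w\<in>{w. w permutes {1..n}}. v = split_perm n w \<and> (u, w) \<in> parcs (godan_graph n)"
proof -
  interpret star 3 "{3..n}" "{1..n}" "\<lambda>_. 0 :: nat" by (rule star_perms[OF n])
  have pu: "permutation u" using u by (auto intro: permutation_permutes[THEN iffD2])
  have lift: ?thesis if "s \<in> godan_gens n" "v = split_perm n (u \<circ> s)" for s
    using that godan_arcI[OF n u that(1)] permutes_compose[OF godan_gens_permutes[OF n that(1)] u] by blast
  obtain f b g b' where fg: "split_perm n u = (f, b)" "v = (g, b')" by (metis prod.exhaust)
  have f: "f = (\<lambda>i. if i \<in> {3..n} then u i else 0)" "b = evenperm u" using fg(1) by (auto simp: split_perm_def)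
  show ?thesis
  proof (cases "b = b'")
    case False
    then have fg': "f = g" using e False by (simp only: fg E_def fst_conv snd_conv if_False)
    have "g = (\<lambda>i. if i \<in> {3..n} then (u \<circ> transpose 1 2) i else 0)"
      unfolding fg'[symmetric] f(1) by (rule ext) (simp add: transpose_def)
    moreover have "evenperm (u \<circ> transpose 1 2) \<longleftrightarrow> \<not> evenperm u"
      using evenperm_comp[OF pu permutation_swap_id[of 1 2]] by (simp add: evenperm_swap)
    ultimately have "v = split_perm n (u \<circ> transpose 1 2)"
      unfolding fg split_perm_def using False f(2) by simp
    moreover have "transpose 1 2 \<in> godan_gens n" by (simp add: godan_gens_def)
    ultimately show ?thesis by (intro lift)
  next
    case True
    then have a: "A f g" using e unfolding fg by (simp only: E_same)
    then have g: "g = nb 3 f (g 3)" "g 3 \<in> {1..n}" "g 3 \<noteq> f 3"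
      using A_eq[OF a] A_ctr[OF a] A_W[OF a] W_ctr[of g] by auto
    have f3: "f 3 = u 3" using f n by simp
    define i where "i = inv u (g 3)"
    have ui: "u i = g 3" using permutes_inverses(1)[OF u] by (simp add: i_def)
    then have i: "i \<in> {1..n}" "i \<noteq> 3" using g(2,3) permutes_in_image[OF u, of i] f3 by auto
    have "g k = (if k \<in> {3..n} then (u \<circ> (transpose 3 i \<circ> transpose 1 2)) k else 0)" for k
    proof -
      have gk: "g k = transpose (u 3) (u i) (f k)" by (subst g(1)) (simp add: nb_def f3 ui)
      show ?thesis
      proof (cases "k \<in> {3..n}")
        case True
        have "f k = u k" by (simp only: f(1) True if_True)
        moreover have "transpose (u 3) (u i) (u k) = u (transpose 3 i k)"
          using permutes_inj[OF u] by (simp add: transpose_def inj_eq)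
        moreover have "transpose 1 2 k = k" using True by (simp add: transpose_def)
        ultimately show ?thesis using True gk by simp
      next
        case False
        have "f k = 0" by (simp only: f(1) False if_False)
        moreover have "u 3 \<in> {1..n}" "u i \<in> {1..n}" using permutes_in_image[OF u] n i(1) by simp_all
        then have "u 3 \<noteq> 0" "u i \<noteq> 0" by auto
        ultimately have "g k = 0" using gk by (simp add: transpose_def)
        then show ?thesis by (simp only: False if_False)
      qed
    qed
    moreover have "evenperm (u \<circ> (transpose 3 i \<circ> transpose 1 2)) = evenperm u"
      using i pu by (simp add: evenperm_comp evenperm_swap permutation_swap_id permutation_compose)
    ultimately have "v = split_perm n (u \<circ> (transpose 3 i \<circ> transpose 1 2))"
      unfolding fg split_perm_def using True f(2) by (intro prod_eqI ext) (simp_all only: fst_conv snd_conv)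
    then show ?thesis using transposes_in_godan_gens[of i n] i by (intro lift) auto
  qed
qed

lemma IDSTs_godan_exists:
  assumes n: "n \<ge> 3" and S: "S \<subseteq> pverts (godan_graph n)" "card S = 4"
  shows "\<exists>T. IDSTs (godan_graph n) S (n - 1) T"
proof -
  interpret star 3 "{3..n}" "{1..n}" "\<lambda>_. 0 :: nat" by (rule star_perms[OF n])
  let ?P = "{u. u permutes {1..n}}"
  have SP: "S \<subseteq> ?P" using S(1) by (simp add: godan_graph_def)
  have "fst (split_perm n u) \<in> W" if "u \<in> S" for u
  proof -
    have u: "u permutes {1..n}" using SP that by blast
    have "u i \<in> {1..n}" if "i \<in> {3..n}" for i using permutes_in_image[OF u, of i] that by auto
    moreover have "inj_on (fst (split_perm n u)) {3..n}"
      using permutes_inj[OF u] by (intro inj_onI) (simp add: split_perm_def inj_eq)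
    ultimately show ?thesis unfolding W_def by (simp add: split_perm_def image_subset_iff)
  qed
  then have "fst ` split_perm n ` S \<subseteq> W" by blast
  moreover have "card (split_perm n ` S) = 4"
    using S(2) card_image[OF inj_on_subset[OF inj_on_split_perm SP]] by simp
  ultimately have "packs E (split_perm n ` S) {..<n - 1}"
    using packs_four[OF star_axioms] by simp
  then have "packs (\<lambda>u v. (u, v) \<in> parcs (godan_graph n)) S {..<n - 1}"
    using star_edge_lifts[OF n] by (intro packs_inj_image[OF inj_on_split_perm SP]) auto
  then have "packs (\<lambda>u v. (u, v) \<in> parcs (godan_graph n)) S {1..n - 1}"
    by (rule packs_card_cong) auto
  moreover have "S \<noteq> {}" using S(2) by auto
  ultimately show ?thesis using IDSTs_of_packs[OF pair_graph_godan_graph S(1)] by blast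
qed

section \<open>The upper bound\<close>

lemma S_tree_leaves:
  assumes T: "S_tree G S T" and S: "x \<in> S" "x \<in> A" "y \<in> S" "y \<notin> A"
  shows "\<exists>a\<in>A. \<exists>b. b \<notin> A \<and> (a, b) \<in> parcs T"
proof (rule ccontr)
  assume no: "\<not> ?thesis"
  interpret T: pair_graph T using T by (simp add: S_tree_def undirected_tree_def)
  have "connected (with_proj T)" "S \<subseteq> pverts T"
    using T by (auto simp: S_tree_def undirected_tree_def)
  then have "x \<rightarrow>\<^sup>*\<^bsub>with_proj (mk_symmetric (with_proj T))\<^esub> y"
    using S by (auto simp: connected_def strongly_connected_def mk_symmetric_def)
  then have "(x, y) \<in> (arcs_ends (with_proj (mk_symmetric (with_proj T))))\<^sup>*"
    by (rule reachable_rtranclI)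
  moreover have "parcs (mk_symmetric (with_proj T)) \<subseteq> parcs T"
    by (auto simp: mk_symmetric_def intro: T.arcs_symmetric)
  ultimately have "(x, y) \<in> (parcs T)\<^sup>*"
    using rtrancl_mono[of "parcs (mk_symmetric (with_proj T))" "parcs T"] by auto
  then have "y \<in> A"
    by (induction rule: rtrancl_induct) (use S(2) no in auto)
  then show False using S(4) by blast
qed

text \<open>At one end of the arc every tree uses an arc other than \<open>uv\<close>. If no tree
  contains \<open>uv\<close>, the end \<open>u\<close> will do. If \<open>T k\<close> contains it, a
  third member of \<open>S\<close> forces \<open>T k\<close> to leave {u, v} at one of the two ends,
  and this end will do: no other tree may use \<open>uv\<close>.\<close>

lemma IDSTs_less_degree:
  assumes G: "pair_graph G" and T: "IDSTs G S r T" and S: "u \<in> S" "v \<in> S" "3 \<le> card S"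
    and uv: "(u, v) \<in> parcs G"
    and deg: "card {w. (u, w) \<in> parcs G} \<le> d" "card {w. (v, w) \<in> parcs G} \<le> d"
  shows "r \<le> d - 1"
proof -
  interpret G: pair_graph G by fact
  have tree: "S_tree G S (T i)" if "i \<in> {1..r}" for i using T that by (auto simp: IDSTs_def)
  have sub: "parcs (T i) \<subseteq> parcs G" if "i \<in> {1..r}" for i
    using tree[OF that] by (simp add: S_tree_def subgraph_def)
  have symT: "(a, b) \<in> parcs (T i) \<Longrightarrow> (b, a) \<in> parcs (T i)" if "i \<in> {1..r}" for i a b
  proof -
    interpret pair_graph "T i" using tree[OF that] by (simp add: S_tree_def undirected_tree_def)
    show "(a, b) \<in> parcs (T i) \<Longrightarrow> (b, a) \<in> parcs (T i)" by (rule arcs_symmetric)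
  qed
  have disj: "i = j" if "i \<in> {1..r}" "j \<in> {1..r}" "e \<in> parcs (T i)" "e \<in> parcs (T j)" for i j e
  proof (rule ccontr)
    assume "i \<noteq> j"
    then have "parcs (T i) \<inter> parcs (T j) = {}"
      using T that(1,2) unfolding IDSTs_def by (metis Int_commute atLeastAtMost_iff nat_neq_iff)
    then show False using that by blast
  qed
  have bound: "r \<le> d - 1"
    if xy: "(x, y) \<in> parcs G" and x: "card {w. (x, w) \<in> parcs G} \<le> d"
      and ex: "\<And>i. i \<in> {1..r} \<Longrightarrow> \<exists>w. w \<noteq> y \<and> (x, w) \<in> parcs (T i)" for x y
  proof -
    obtain f where f: "\<And>i. i \<in> {1..r} \<Longrightarrow> f i \<noteq> y \<and> (x, f i) \<in> parcs (T i)" using ex by metis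
    have "inj_on f {1..r}" using f disj by (metis inj_onI)
    moreover have "f ` {1..r} \<subseteq> {w. (x, w) \<in> parcs G} - {y}" using f sub by blast
    moreover have fin: "finite {w. (x, w) \<in> parcs G}"
      by (rule finite_subset[OF _ finite_imageI[OF G.pair_finite_arcs, of snd]]) force
    ultimately have "card {1..r} \<le> card ({w. (x, w) \<in> parcs G} - {y})"
      by (intro card_inj_on_le) auto
    then show ?thesis using xy x fin by simp
  qed
  have "finite S" using S(3) card.infinite by fastforce
  then have ne: "\<not> S \<subseteq> {u, v}" using card_mono[of "{u, v}" S] S(3) card_insert_le_m1[of 2 "{v}" u] by force
  have leave: "\<exists>w. w \<noteq> x \<and> (x, w) \<in> parcs (T i)" if "i \<in> {1..r}" "x \<in> S" for x i
  proof -
    have "\<not> S \<subseteq> {x}" using ne S(1,2) by auto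
    then obtain y where "y \<in> S" "y \<notin> {x}" by blast
    then show ?thesis using S_tree_leaves[OF tree[OF that(1)] that(2), of "{x}" y] by auto
  qed
  have uv': "(v, u) \<in> parcs G" using uv by (rule G.arcs_symmetric)
  show ?thesis
  proof (cases "\<exists>i\<in>{1..r}. (u, v) \<in> parcs (T i)")
    case False
    show ?thesis by (rule bound[OF uv deg(1)]) (metis False leave S(1))
  next
    case True
    then obtain k where k: "k \<in> {1..r}" "(u, v) \<in> parcs (T k)" by blast
    obtain y where "y \<in> S" "y \<notin> {u, v}" using ne by blast
    then obtain a b where ab: "a \<in> {u, v}" "b \<notin> {u, v}" "(a, b) \<in> parcs (T k)"
      using S_tree_leaves[OF tree[OF k(1)] S(1), of "{u, v}" y] by auto
    show ?thesis
    proof (cases "a = u")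
      case True
      have "\<exists>w. w \<noteq> v \<and> (u, w) \<in> parcs (T i)" if i: "i \<in> {1..r}" for i
      proof (cases "i = k")
        case True
        then show ?thesis using ab \<open>a = u\<close> by auto
      next
        case False
        then have "(u, v) \<notin> parcs (T i)" using disj[OF i k(1)] k(2) by blast
        then show ?thesis using leave[OF i S(1)] by metis
      qed
      then show ?thesis by (rule bound[OF uv deg(1)])
    next
      case False
      have "\<exists>w. w \<noteq> u \<and> (v, w) \<in> parcs (T i)" if i: "i \<in> {1..r}" for i
      proof (cases "i = k")
        case True
        then show ?thesis using ab False by auto
      next
        case False
        then have "(v, u) \<notin> parcs (T i)" using disj[OF i k(1)] symT[OF i] k(2) by blast
        then show ?thesis using leave[OF i S(2)] by metis
      qed
      then show ?thesis by (rule bound[OF uv' deg(2)])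
    qed
  qed
qed

lemma godan_degree:
  assumes "n \<ge> 3"
  shows "card {w. (u, w) \<in> parcs (godan_graph n)} \<le> n"
proof -
  interpret pair_graph "godan_graph n" by (rule pair_graph_godan_graph)
  let ?R = "{cycle_of_list [1, 2], cycle_of_list [1, 2, 3], cycle_of_list [1, 3, 2 :: nat]}"
  let ?D = "(\<lambda>i. cycle_of_list [1, 2] \<circ> cycle_of_list [3, i]) ` {4..n}"
  have gens: "godan_gens n = ?R \<union> ?D" unfolding godan_gens_def by auto
  have three: "card {x, y, z} \<le> 3" for x y z :: "nat \<Rightarrow> nat" using card_length[of "[x, y, z]"] by simp
  have "card (godan_gens n) \<le> card ?R + card ?D" unfolding gens by (rule card_Un_le)
  also have "\<dots> \<le> 3 + card {4..n}"
    by (intro add_mono card_image_le three) simp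
  finally have "card (godan_gens n) \<le> n" using assms by simp
  moreover have fin: "finite (godan_gens n)" unfolding gens by simp
  moreover have "{w. (u, w) \<in> parcs (godan_graph n)} \<subseteq> (\<lambda>s. u \<circ> s) ` godan_gens n"
  proof
    fix w assume "w \<in> {w. (u, w) \<in> parcs (godan_graph n)}"
    then have "(w, u) \<in> parcs (godan_graph n)" using arcs_symmetric by blast
    then show "w \<in> (\<lambda>s. u \<circ> s) ` godan_gens n" by (auto simp: godan_graph_def)
  qed
  ultimately show ?thesis
    by (meson card_image_le card_mono finite_imageI le_trans)
qed

theorem theorem1p1:
  fixes n :: nat
  assumes "n \<ge> 3"
  shows "kappa 4 (godan_graph n) = n - 1"
proof -
  let ?G = "godan_graph n"
  let ?K = "{kappa_set ?G S | S. S \<subseteq> pverts ?G \<and> card S = 4}"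
  have finV: "finite (pverts ?G)" by (simp add: godan_graph_def finite_permutations)
  have fin: "finite {r. \<exists>T. IDSTs ?G S r T}" if "card S = 4" for S
    using finite_IDSTs[OF pair_graph_godan_graph] that by simp
  have "?K = kappa_set ?G ` {S. S \<subseteq> pverts ?G \<and> card S = 4}" by blast
  then have finK: "finite ?K" using finV by simp
  have low: "n - 1 \<le> k" if k: "k \<in> ?K" for k
  proof -
    obtain S where S: "S \<subseteq> pverts ?G" "card S = 4" "k = kappa_set ?G S" using k by blast
    show ?thesis unfolding S(3) kappa_set_def
      using IDSTs_godan_exists[OF assms S(1,2)] by (intro Max_ge fin[OF S(2)]) blast
  qed
  \<comment> \<open>A set containing both ends of an arc attains the minimum; n! \<ge> 6 leaves room
    to enlarge this pair to four vertices.\<close>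
  let ?e = "transpose 1 2 :: nat \<Rightarrow> nat"
  have arc: "(id, ?e) \<in> parcs ?G"
    using godan_arcI[OF assms permutes_id, of ?e] by (simp add: godan_gens_def)
  then have idS: "{id, ?e} \<subseteq> pverts ?G" by (auto simp: godan_graph_def)
  have "card (pverts ?G) = fact n"
    using card_permutations[of "{1..n}" n] by (simp add: godan_graph_def)
  then have "4 \<le> card (pverts ?G)" using fact_mono[OF assms, where 'a = nat] by (simp add: fact_numeral)
  moreover have "card {id, ?e} \<le> 4" by (auto intro: order_trans[OF card_insert_le_m1])
  ultimately obtain S where S: "{id, ?e} \<subseteq> S" "S \<subseteq> pverts ?G" "card S = 4"
    using exists_subset_between[of "{id, ?e}" 4 "pverts ?G"] finV idS by blast
  have "kappa_set ?G S \<le> n - 1"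
    unfolding kappa_set_def
  proof (rule Max.boundedI[OF fin[OF S(3)]])
    show "{r. \<exists>T. IDSTs ?G S r T} \<noteq> {}" using IDSTs_0 by blast
    fix r assume "r \<in> {r. \<exists>T. IDSTs ?G S r T}"
    then obtain T where "IDSTs ?G S r T" by blast
    then show "r \<le> n - 1"
      using IDSTs_less_degree[OF pair_graph_godan_graph _ _ _ _ arc godan_degree godan_degree] S assms by auto
  qed
  moreover have SK: "kappa_set ?G S \<in> ?K" using S by blast
  ultimately have "n - 1 \<in> ?K" using low[OF SK] by simp
  then show ?thesis unfolding kappa_def using low finK by (intro Min_eqI)
qed

end
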